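(* Let $\alpha,\beta,\gamma\ge1$ be integers and put $n=\alpha+\beta+\gamma-1$. Consider the family $\mathcal F$ of all unit vectors of the form $$\mathbf a=(\underbrace{p,\ldots,p}_{\alpha},\underbrace{q,\ldots,q}_{\beta},\underbrace{r,\ldots,r}_{\gamma})\in\mathbb R^{n+1},$$ where $p,q,r\in\mathbb R$ are not necessarily distinct and $\alpha p+\beta q+\gamma r=0$, $\alpha p^2+\beta q^2+\gamma r^2=1$. If $\mathbf a\in\mathcal F$ minimises $\mathrm{Vol}_{n-1}(\Delta_n\cap\mathbf a^\perp)$ over $\mathcal F$, then either $\mathbf a$ has only two distinct coordinate values, or at least one of the coordinate values $p,q,r$ is zero.
   Context: $\Delta_n$ is the standard regular simplex, i.e. the convex hull of the standard basis vectors $\mathbf e_1,\dots,\mathbf e_{n+1}$ of $\mathbb R^{n+1}$. $\mathbf a^\perp$ is the linear hyperplane orthogonal to $\mathbf a$. $\mathrm{Vol}_{n-1}$ denotes $(n-1)$-dimensional volume. *)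

theory Defs
  imports "HOL-Analysis.Analysis"
begin

definition orthonormal_frame :: "nat \<Rightarrow> (nat \<Rightarrow> 'a::euclidean_space) \<Rightarrow> bool" where
  "orthonormal_frame k b \<longleftrightarrow> (\<forall>i<k. \<forall>j<k. b i \<bullet> b j = (if i = j then 1 else 0))"

definition frame_point :: "nat \<Rightarrow> 'a::euclidean_space \<Rightarrow> (nat \<Rightarrow> 'a) \<Rightarrow> (nat \<Rightarrow> real) \<Rightarrow> 'a" where
  "frame_point k c b t = c + (\<Sum>i<k. t i *\<^sub>R b i)"

text \<open>
  The \<open>k\<close>-dimensional volume of a set lying in a \<open>k\<close>-dimensional affine subspace: its Lebesgue
  measure in Cartesian coordinates with respect to an origin \<open>c\<close> and an orthonormal frame \<open>b\<close>
  of directions of such a subspace. For measurable sets the value does not depend on the choice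
  of \<open>c\<close> and \<open>b\<close>, by invariance of Lebesgue measure under isometries.
  For a set contained in no \<open>k\<close>-dimensional affine subspace the value is unspecified.
\<close>
definition flat_volume :: "nat \<Rightarrow> 'a::euclidean_space set \<Rightarrow> real" where
  "flat_volume k S =
    (SOME v. \<exists>c b. orthonormal_frame k b \<and> S \<subseteq> range (frame_point k c b) \<and>
       v = measure (\<Pi>\<^sub>M i\<in>{..<k}. lborel)
             {t \<in> {..<k} \<rightarrow>\<^sub>E UNIV. frame_point k c b t \<in> S})"

definition standard_simplex :: "(real ^ 'n) set" where
  "standard_simplex = convex hull (range (\<lambda>i. axis i 1))"

definition hyperplane_perp :: "'a::real_inner \<Rightarrow> 'a set" where
  "hyperplane_perp a = {x. a \<bullet> x = 0}"

text \<open>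
  Coordinates are indexed by a disjoint sum of three nonempty finite types, one for each block;
  their cardinalities are the block lengths.
\<close>
definition block_vec :: "real \<Rightarrow> real \<Rightarrow> real \<Rightarrow> real ^ ('a::finite + 'b::finite + 'c::finite)" where
  "block_vec p q r = (\<chi> i. case i of Inl _ \<Rightarrow> p | Inr (Inl _) \<Rightarrow> q | Inr (Inr _) \<Rightarrow> r)"

definition block_constraints :: "nat \<Rightarrow> nat \<Rightarrow> nat \<Rightarrow> real \<Rightarrow> real \<Rightarrow> real \<Rightarrow> bool" where
  "block_constraints \<alpha> \<beta> \<gamma> p q r \<longleftrightarrow>
     real \<alpha> * p + real \<beta> * q + real \<gamma> * r = 0 \<and>
     real \<alpha> * p\<^sup>2 + real \<beta> * q\<^sup>2 + real \<gamma> * r\<^sup>2 = 1"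

text \<open>The second constraint says exactly that the vector has norm 1.\<close>
definition block_family :: "(real ^ ('a::finite + 'b::finite + 'c::finite)) set" where
  "block_family =
     {block_vec p q r | p q r. block_constraints CARD('a) CARD('b) CARD('c) p q r}"

end

theory Submission
  imports Defs
begin

text \<open>
  Decompose the space of the section orthogonally into the zero-sum subspaces of the three blocks
  and one further direction \<open>d\<close>. Integrating first over the blocks, each of which contributes a
  power of its coordinate sum, shows that the volume of the section is a constant times
  \[ \int (1 + \textstyle\frac{q-r}{\alpha} t)_+^{\alpha-1} (1 + \frac{r-p}{\beta} t)_+^{\beta-1}
     (1 + \frac{p-q}{\gamma} t)_+^{\gamma-1} \, dt. \]
  By symmetry let \<open>p > q > 0 > r\<close>. Rescaled to \<open>r = -1\<close> and \<open>\<alpha>p + \<beta>q = \<gamma>\<close>, the squared volume is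
  proportional to \<open>N f\<^sup>2\<close> with \<open>N = \<alpha>p\<^sup>2 + \<beta>q\<^sup>2 + \<gamma>\<close>, where \<open>f\<close> satisfies the
  Euler--Poisson--Darboux equation \<open>(p - q) f\<^sub>p\<^sub>q = \<beta> f\<^sub>p - \<alpha> f\<^sub>q\<close> and a first-order
  equation. Along the constraint line the derivative of \<open>N f\<^sup>2\<close> is \<open>2 (p - q) f G\<close> with
  \<open>G = \<alpha>\<beta> f + N f\<^sub>p\<^sub>q\<close>, and \<open>(p - q) G' = A G + B f\<close> where \<open>A < 0\<close> on the diagonal and \<open>B\<close> has
  the sign of \<open>5/2 (\<alpha> + \<beta> + \<gamma>) p q - (p + q - 1) N\<close>. This expression is positive on the diagonal and,
  moving away from it, changes sign at most once. At a critical point where it is negative, \<open>N f\<^sup>2\<close>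
  has a strict local maximum; at any other critical point it is positive all the way back to the
  diagonal, so \<open>N f\<^sup>2\<close> is smaller on the diagonal. Either way the point is no minimum.
\<close>

section \<open>Sign of the second variation\<close>

text \<open>A block with prescribed coordinate sum ranges over a simplex proportional to that sum;
  this produces the truncated powers in the integral. The substitution u = p/(1+p), v = q/(1+q)
  turns the integral into that of t^(\<alpha>-1) (1-t)^(\<beta>-1) (t u + (1-t) v)^(\<gamma>-1) over
  [0,1], up to powers of 1+p and 1+q. Expanding the last factor gives a finite sum, so all
  derivatives are taken term by term and never under an integral. The Euler--Poisson--Darboux
  equation is then the recurrence of the Beta coefficients, and the first-order equation is
  homogeneity in u and v.

  Critical points of N f^2 are not explicit, so the equation for G' is read only where it
  simplifies. At a zero of G the term with A disappears. On the diagonal the factor p - q removes G'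
  and leaves 0 = A G + B f, so the sign of A there transfers the sign of B to G.

  Volume in a flat is defined by choosing some frame. Before anything is computed, every admissible
  frame must be shown to span the same directions.\<close>

lemma cubic_no_four_sign_changes:
  fixes k0 k1 k2 k3 :: real
  defines "h \<equiv> \<lambda>x. k0 + k1 * x + k2 * x\<^sup>2 + k3 * x^3"
  assumes y: "y0 < y1" "y1 < y2" "y2 < y3" "y3 < y4"
    and h: "h y0 \<le> 0" "h y1 > 0" "h y2 \<le> 0" "h y3 \<ge> 0" "h y4 < 0"
  shows False
proof -
  \<comment> \<open>\<open>s\<close> and \<open>t\<close> are the first and second divided
    differences of the cubic. The sign pattern at five points makes two consecutive third
    differences, both equal to \<open>k3\<close>, of opposite sign. Unlike a count of roots, this
    tolerates zeros at the sample points.\<close>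
  define s where "s = (\<lambda>a b. k1 + k2 * (a + b) + k3 * (a\<^sup>2 + a * b + b\<^sup>2))"
  have hs: "h b - h a = (b - a) * s a b" for a b
    unfolding h_def s_def by (simp add: algebra_simps power2_eq_square power3_eq_cube)
  define t where "t = (\<lambda>a b c. k2 + k3 * (a + b + c))"
  have st: "s b c - s a b = (c - a) * t a b c" for a b c
    unfolding s_def t_def by (simp add: algebra_simps power2_eq_square)
  have "s y0 y1 > 0" "s y1 y2 < 0" "s y2 y3 \<ge> 0" "s y3 y4 < 0"
    using hs[of y1 y0] hs[of y2 y1] hs[of y3 y2] hs[of y4 y3] h y
    by (smt (verit) mult_nonneg_nonneg mult_nonneg_nonpos mult_pos_neg mult_pos_pos)+
  then have "t y0 y1 y2 < 0" "t y1 y2 y3 > 0" "t y2 y3 y4 < 0"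
    using st[of y1 y2 y0] st[of y2 y3 y1] st[of y3 y4 y2] y
    by (smt (verit) mult_nonneg_nonneg mult_nonneg_nonpos mult_pos_neg mult_pos_pos)+
  then have "k3 * (y3 - y0) > 0" "k3 * (y4 - y1) < 0"
    unfolding t_def by (simp_all add: algebra_simps)
  then show False using y
    by (smt (verit) mult_nonneg_nonneg mult_nonpos_nonneg)
qed

text \<open>The coefficient left in front of f, up to the positive factor 2 \<alpha> \<beta>
  \<gamma> / (N p q), once f_pq is expressed through G and f. The number 5/2 is a result of this
  elimination, carried out in \<open>second_order_identity\<close>.\<close>

definition sign_form :: "real \<Rightarrow> real \<Rightarrow> real \<Rightarrow> real \<Rightarrow> real \<Rightarrow> real" where
  "sign_form \<alpha> \<beta> \<gamma> p q =
     5/2 * (\<alpha> + \<beta> + \<gamma>) * p * q - (p + q - 1) * (\<alpha> * p\<^sup>2 + \<beta> * q\<^sup>2 + \<gamma>)"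

lemma sign_form_diagonal_pos:
  assumes pos: "\<alpha> > 0" "\<beta> > 0" "\<gamma> > 0" and l: "\<alpha> * p + \<beta> * p = \<gamma>"
  shows "sign_form \<alpha> \<beta> \<gamma> p p > 0"
proof -
  have p: "p > 0"
    using l pos by (metis add_pos_pos distrib_right zero_less_mult_pos)
  have N: "\<alpha> * p\<^sup>2 + \<beta> * p\<^sup>2 + \<gamma> = p * (\<alpha> + \<beta> + \<gamma>)"
    unfolding l[symmetric] by (simp add: algebra_simps power2_eq_square)
  have "sign_form \<alpha> \<beta> \<gamma> p p = p * (\<alpha> + \<beta> + \<gamma>) * (p / 2 + 1)"
    unfolding sign_form_def N by (simp add: field_simps)
  then show ?thesis using p pos by simp
qed

text \<open>On a line of constant \<alpha> p + \<beta> q the quadratic form is convex with its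
  minimum at p = q, and here the motion is away from that point.\<close>

lemma norm_form_mono:
  fixes \<alpha> \<beta> p q p0 q0 :: real
  assumes pos: "\<alpha> > 0" "\<beta> > 0"
    and l: "\<alpha> * p + \<beta> * q = \<alpha> * p0 + \<beta> * q0" and "q \<le> p" "p \<le> p0"
  shows "\<alpha> * p\<^sup>2 + \<beta> * q\<^sup>2 \<le> \<alpha> * p0\<^sup>2 + \<beta> * q0\<^sup>2"
proof -
  define d where "d = (p0 - p) / \<beta>"
  have d: "d \<ge> 0" using assms d_def by simp
  have p0: "p0 = p + \<beta> * d" using pos by (simp add: d_def)
  have "\<beta> * q0 = \<beta> * (q - \<alpha> * d)" using l p0 by (simp add: algebra_simps)
  then have q0: "q0 = q - \<alpha> * d" using pos by simp
  have "\<alpha> * p0\<^sup>2 + \<beta> * q0\<^sup>2 - (\<alpha> * p\<^sup>2 + \<beta> * q\<^sup>2)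
      = 2 * \<alpha> * \<beta> * d * (p - q) + \<alpha> * \<beta> * (\<alpha> + \<beta>) * d\<^sup>2"
    unfolding p0 q0 by (simp add: algebra_simps power2_eq_square)
  also have "\<dots> \<ge> 0" using pos d \<open>q \<le> p\<close> by simp
  finally show ?thesis by simp
qed

text \<open>Along the line the form is a cubic, and a cubic alone could be nonpositive at p and
  nonnegative again at p0. Further sign or monotonicity information is needed; the position of
  \<gamma> relative to \<alpha> and \<beta> decides which kind is available.\<close>

lemma sign_form_single_crossing:
  assumes pos: "\<alpha> > 0" "\<beta> > 0" "\<gamma> > 0"
    and l0: "\<alpha> * p0 + \<beta> * q0 = \<gamma>" and q0: "0 < q0"
    and D0: "sign_form \<alpha> \<beta> \<gamma> p0 q0 \<ge> 0"
    and l: "\<alpha> * p + \<beta> * q = \<gamma>" and "q \<le> p" "p < p0"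
  shows "sign_form \<alpha> \<beta> \<gamma> p q > 0"
proof (cases "p = q")
  case True
  then show ?thesis using sign_form_diagonal_pos[OF pos] l by simp
next
  case False
  then have qp: "q < p" using \<open>q \<le> p\<close> by simp
  define N where "N = (\<lambda>p q. \<alpha> * p\<^sup>2 + \<beta> * q\<^sup>2 + \<gamma>)"
  define d where "d = (p0 - p) / \<beta>"
  have d: "d > 0" using assms d_def by simp
  have p0: "p0 = p + \<beta> * d" using pos by (simp add: d_def)
  have "\<beta> * q0 = \<beta> * (q - \<alpha> * d)" using l l0 p0 by (simp add: algebra_simps)
  then have q0': "q0 = q - \<alpha> * d" using pos by simp
  have "\<alpha> * d > 0" using d pos by simp
  then have q: "q > 0" using q0 q0' by linarith
  have p: "p > 0" using q qp by simp
  have Npos: "N p q > 0" for p q using pos unfolding N_def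
    by (simp add: add_nonneg_pos)
  have NM: "N p q \<le> N p0 q0"
    unfolding N_def using norm_form_mono[OF pos(1,2), of p q p0 q0] l l0 qp \<open>p < p0\<close> by simp
  have Dp: "sign_form \<alpha> \<beta> \<gamma> p q = 5/2 * (\<alpha> + \<beta> + \<gamma>) * p * q - (p + q - 1) * N p q" for p q
    by (simp add: sign_form_def N_def)
  have M: "5/2 * (\<alpha> + \<beta> + \<gamma>) * p * q > 0" using pos p q by simp
  show ?thesis
  proof (cases "p + q \<le> 1")
    case True
    then have "(p + q - 1) * N p q \<le> 0" using Npos[of p q]
      by (intro mult_nonpos_nonneg) auto
    then show ?thesis using M Dp by simp
  next
    case e1: False
    \<comment> \<open>At the ends (0, \<gamma>/\<beta>) and (\<gamma>/\<alpha>, 0) of the segment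
      the form equals -(p+q-1) N. In the last case it is nonpositive at both ends, which serves the
      cubic argument. If \<gamma> \<le> \<alpha>, then p < 1 and positivity is direct. In the middle
      case q < 1, and (p+q-1) N / (p q) is larger at p0 than at p.\<close>
    consider "\<gamma> \<le> \<alpha>" | "\<gamma> < \<beta>" "\<alpha> < \<gamma>" | "\<gamma> \<ge> \<beta>" "\<gamma> > \<alpha>" by linarith
    then show ?thesis
    proof cases
      case 1
      have "\<alpha> * p < \<alpha> * 1" using l 1 mult_pos_pos[OF pos(2) q] by linarith
      then have p1: "p < 1" using pos by simp
      then have "p + q - 1 \<le> q" by simp
      then have "(p + q - 1) * N p q \<le> q * N p q"
        using Npos[of p q] by (intro mult_right_mono) auto
      moreover have "N p q \<le> 2 * (\<alpha> + \<beta> + \<gamma>) * p"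
      proof -
        have "p\<^sup>2 \<le> p" "q\<^sup>2 \<le> q" using p1 p q qp
          by (simp_all add: power2_eq_square mult_left_le)
        then have "\<alpha> * p\<^sup>2 \<le> \<alpha> * p" "\<beta> * q\<^sup>2 \<le> \<beta> * q" "\<beta> * q \<le> \<beta> * p"
          using pos qp by simp_all
        then have "N p q \<le> 2 * (\<alpha> * p + \<beta> * p)"
          unfolding N_def using l by (smt (verit) distrib_left)
        moreover have "\<gamma> * p > 0" using pos p by simp
        ultimately show ?thesis by (simp add: algebra_simps)
      qed
      then have "q * N p q \<le> q * (2 * (\<alpha> + \<beta> + \<gamma>) * p)" using q by simp
      moreover have "(\<alpha> + \<beta> + \<gamma>) * (p * q) > 0" using pos p q by simp
      then have "q * (2 * (\<alpha> + \<beta> + \<gamma>) * p) < 5/2 * (\<alpha> + \<beta> + \<gamma>) * p * q"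
        by (simp add: algebra_simps)
      ultimately show ?thesis using Dp[of p q] by linarith
    next
      case 2
      have "\<alpha> * p \<ge> \<alpha> * q" using qp pos by simp
      then have "\<beta> * q < \<beta> * 1" using l 2 mult_pos_pos[OF pos(1) p] by linarith
      then have q1: "q < 1" using pos by simp
      \<comment> \<open>The coefficient of \<open>d\<close> when the values of (p+q-1)/(p q) at the
        two points are compared by cross-multiplication. For p < 1 it is nonnegative because q(1-q)
        \<ge> p(1-p), by q < p and p + q > 1, and because \<alpha> < \<beta>.\<close>
      have br: "\<beta> * q * (1 - q) + \<alpha> * p * (p - 1) \<ge> 0"
      proof (cases "p \<ge> 1")
        case True
        then show ?thesis using pos p q q1 by simp
      next
        case False
        have "q * (1 - q) - p * (1 - p) = (p - q) * (p + q - 1)"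
          by (simp add: algebra_simps)
        also have "\<dots> \<ge> 0" using qp e1 by simp
        finally have "\<alpha> * (p * (1 - p)) \<le> \<alpha> * (q * (1 - q))" using pos by simp
        also have "\<dots> \<le> \<beta> * (q * (1 - q))"
          using 2 q q1 by (intro mult_right_mono) auto
        finally show ?thesis by (simp add: algebra_simps)
      qed
      have "(p0 + q0 - 1) * (p * q) - (p + q - 1) * (p0 * q0)
          = d * (\<beta> * q * (1 - q) + \<alpha> * p * (p - 1)) + (p + q - 1) * \<alpha> * \<beta> * d\<^sup>2"
        unfolding p0 q0' by (simp add: algebra_simps power2_eq_square)
      also have "\<dots> > 0"
        using br d e1 pos by (intro add_nonneg_pos) auto
      finally have "(p + q - 1) * (p0 * q0) < (p0 + q0 - 1) * (p * q)" by simp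
      then have "((p + q - 1) * (p0 * q0)) * N p q < ((p0 + q0 - 1) * (p * q)) * N p q"
        using Npos[of p q] by simp
      also have "\<dots> \<le> ((p0 + q0 - 1) * (p * q)) * N p0 q0"
      proof -
        have "(p0 + q0 - 1) * (p * q) \<ge> 0"
          using \<open>(p + q - 1) * (p0 * q0) < _\<close> e1 q0 p \<open>p < p0\<close>
          by (smt (verit) mult_nonneg_nonneg)
        then show ?thesis using NM by (rule mult_left_mono[rotated])
      qed
      also have "\<dots> = ((p0 + q0 - 1) * N p0 q0) * (p * q)" by simp
      also have "\<dots> \<le> (5/2 * (\<alpha> + \<beta> + \<gamma>) * p0 * q0) * (p * q)"
        using D0 Dp[of p0 q0] p q by (intro mult_right_mono) auto
      finally have "(p0 * q0) * ((p + q - 1) * N p q) < (p0 * q0) * (5/2 * (\<alpha> + \<beta> + \<gamma>) * p * q)"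
        by (simp add: mult_ac)
      then show ?thesis using Dp[of p q] p q0 \<open>p < p0\<close>
        by (auto simp: mult_less_cancel_left)
    next
      case 3
      define c where "c = \<gamma> / (\<alpha> + \<beta>)"
      define P where "P = (\<lambda>x. c + \<beta> * x)"
      define Q where "Q = (\<lambda>x. c - \<alpha> * x)"
      define h where "h = (\<lambda>x. sign_form \<alpha> \<beta> \<gamma> (P x) (Q x))"
      have lc: "\<alpha> * c + \<beta> * c = \<gamma>"
        unfolding distrib_right[symmetric] c_def using pos by simp
      have c: "c > 0" unfolding c_def using pos by simp
      obtain k0 k1 k2 k3 where k: "h = (\<lambda>x. k0 + k1 * x + k2 * x\<^sup>2 + k3 * x^3)"
      proof
        show "h = (\<lambda>x. (5/2 * (\<alpha>+\<beta>+\<gamma>) * c\<^sup>2 - (2*c-1) * ((\<alpha>+\<beta>)*c\<^sup>2+\<gamma>))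
          + (5/2 * (\<alpha>+\<beta>+\<gamma>) * c * (\<beta>-\<alpha>) - (\<beta>-\<alpha>) * ((\<alpha>+\<beta>)*c\<^sup>2+\<gamma>)) * x
          + (- 5/2 * (\<alpha>+\<beta>+\<gamma>) * \<alpha> * \<beta> - (2*c-1) * (\<alpha>*\<beta>\<^sup>2+\<beta>*\<alpha>\<^sup>2)) * x\<^sup>2
          + (- (\<beta>-\<alpha>) * (\<alpha>*\<beta>\<^sup>2+\<beta>*\<alpha>\<^sup>2)) * x^3)"
          unfolding h_def sign_form_def P_def Q_def
          by (rule ext, simp add: field_simps power2_eq_square power3_eq_cube)
      qed
      have param: "p' = P ((p' - c) / \<beta>) \<and> q' = Q ((p' - c) / \<beta>)" if "\<alpha> * p' + \<beta> * q' = \<gamma>" for p' q'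
      proof
        show "p' = P ((p' - c) / \<beta>)" using pos by (simp add: P_def)
        have "\<beta> * Q ((p' - c) / \<beta>) = \<beta> * q'"
        proof -
          have "\<beta> * Q ((p' - c) / \<beta>) = \<beta> * c - \<alpha> * (p' - c)"
            unfolding Q_def right_diff_distrib[of \<beta>] mult.left_commute[of \<beta> \<alpha>] using pos by simp
          also have "\<dots> = \<beta> * q'" using that lc unfolding right_diff_distrib by linarith
          finally show ?thesis .
        qed
        then show "q' = Q ((p' - c) / \<beta>)" using pos by simp
      qed
      have hv: "h ((p' - c) / \<beta>) = sign_form \<alpha> \<beta> \<gamma> p' q'" if "\<alpha> * p' + \<beta> * q' = \<gamma>" for p' q'
        using param[OF that] by (simp add: h_def)
      have h_lo: "h (- c / \<beta>) \<le> 0"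
      proof -
        have "\<alpha> * 0 + \<beta> * (\<gamma> / \<beta>) = \<gamma>" using pos by simp
        from hv[OF this] have "h (- c / \<beta>) = - ((\<gamma> / \<beta> - 1) * N 0 (\<gamma> / \<beta>))" by (simp add: Dp)
        also have "\<dots> \<le> 0" using Npos[of 0 "\<gamma>/\<beta>"] 3 pos by simp
        finally show ?thesis .
      qed
      have h_hi: "h ((\<gamma> / \<alpha> - c) / \<beta>) < 0"
      proof -
        have "\<alpha> * (\<gamma> / \<alpha>) + \<beta> * 0 = \<gamma>" using pos by simp
        from hv[OF this] have "h ((\<gamma> / \<alpha> - c) / \<beta>) = - ((\<gamma> / \<alpha> - 1) * N (\<gamma> / \<alpha>) 0)" by (simp add: Dp)
        also have "\<dots> < 0" using Npos[of "\<gamma>/\<alpha>" 0] 3 pos by simp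
        finally show ?thesis .
      qed
      have h_mid: "h 0 > 0" using hv[OF lc] sign_form_diagonal_pos[OF pos lc] by simp
      have cp: "c < p"
      proof -
        have "\<beta> * q < \<beta> * p" using qp pos by simp
        then have "(\<alpha> + \<beta>) * c < (\<alpha> + \<beta>) * p" using lc l by (simp add: distrib_right)
        then show ?thesis using pos by simp
      qed
      have p0hi: "p0 < \<gamma> / \<alpha>" using l0 mult_pos_pos[OF pos(2) q0] pos by (simp add: field_simps)
      show ?thesis
      \<comment> \<open>The five sample points are the lower end, the diagonal, p, p0 and the upper
        end, with the signs nonpositive, positive, nonpositive, nonnegative, negative.\<close>
      proof (rule ccontr)
        assume "\<not> ?thesis"
        then have "h ((p - c) / \<beta>) \<le> 0" using hv[OF l] by simp
        moreover have "h ((p0 - c) / \<beta>) \<ge> 0" using hv[OF l0] D0 by simp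
        moreover have "- c / \<beta> < 0" "0 < (p - c) / \<beta>" "(p - c) / \<beta> < (p0 - c) / \<beta>"
          "(p0 - c) / \<beta> < (\<gamma> / \<alpha> - c) / \<beta>"
          using c cp pos \<open>p < p0\<close> p0hi by (simp_all add: divide_strict_right_mono)
        ultimately show False
          using cubic_no_four_sign_changes[of "- c / \<beta>" 0 "(p - c) / \<beta>" "(p0 - c) / \<beta>"
              "(\<gamma> / \<alpha> - c) / \<beta>" k0 k1 k2 k3] h_lo h_hi h_mid unfolding k by blast
      qed
    qed
  qed
qed

section \<open>A solution of the Euler--Poisson--Darboux equation\<close>

text \<open>With u = x/(1+x) this is u^j (1+x)^(-k), the shape in which p and q enter the section
  integral after its substitution.\<close>

definition beta_kernel :: "nat \<Rightarrow> nat \<Rightarrow> real \<Rightarrow> real" where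
  "beta_kernel k j x = x ^ j / (1 + x) ^ (k + j)"

text \<open>The derivative is written through the first-order equation of the kernel. No exponent j
  - 1 appears, so j = 0 is no special case; the formula is meant for x > 0.\<close>

definition beta_kernel_d1 :: "nat \<Rightarrow> nat \<Rightarrow> real \<Rightarrow> real" where
  "beta_kernel_d1 k j x = beta_kernel k j x * (real j - real k * x) / (x * (1 + x))"

definition beta_kernel_d2 :: "nat \<Rightarrow> nat \<Rightarrow> real \<Rightarrow> real" where
  "beta_kernel_d2 k j x = ((real j - real k * x) * beta_kernel_d1 k j x - real k * beta_kernel k j x - (1 + 2 * x) * beta_kernel_d1 k j x)
     / (x * (1 + x))"

lemma beta_kernel_deriv:
  assumes "x > 0"
  shows "(beta_kernel k j has_real_derivative beta_kernel_d1 k j x) (at x)"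
proof -
  have pj: "x * (real j * x ^ (j - Suc 0)) = real j * x ^ j" by (cases j) auto
  have pk: "(1 + x) * (real (k+j) * (1 + x) ^ (k + j - Suc 0)) = real (k+j) * (1 + x) ^ (k + j)"
    by (cases "k + j") auto
  have "(beta_kernel k j has_real_derivative
      (real j * x ^ (j - Suc 0) * (1 + x) ^ (k + j) - x ^ j * (real (k+j) * (1 + x) ^ (k + j - Suc 0)))
       / ((1 + x) ^ (k + j) * (1 + x) ^ (k + j))) (at x)"
    unfolding beta_kernel_def[abs_def] using assms by (auto intro!: derivative_eq_intros)
  also have "(real j * x ^ (j - Suc 0) * (1 + x) ^ (k + j) - x ^ j * (real (k+j) * (1 + x) ^ (k + j - Suc 0)))
       / ((1 + x) ^ (k + j) * (1 + x) ^ (k + j))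
     = (x * (1 + x) * (real j * x ^ (j - Suc 0) * (1 + x) ^ (k + j)
         - x ^ j * (real (k+j) * (1 + x) ^ (k + j - Suc 0))))
       / (x * (1 + x) * ((1 + x) ^ (k + j) * (1 + x) ^ (k + j)))"
    using assms by simp
  also have "x * (1 + x) * (real j * x ^ (j - Suc 0) * (1 + x) ^ (k + j)
         - x ^ j * (real (k+j) * (1 + x) ^ (k + j - Suc 0)))
     = (1 + x) * (x * (real j * x ^ (j - Suc 0))) * (1 + x) ^ (k + j)
         - x * x ^ j * ((1 + x) * (real (k+j) * (1 + x) ^ (k + j - Suc 0)))"
    by (simp add: right_diff_distrib mult_ac)
  also have "\<dots> = x ^ j * (1 + x) ^ (k + j) * (real j - real k * x)"
    unfolding pj pk by (simp add: algebra_simps)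
  also have "\<dots> / (x * (1 + x) * ((1 + x) ^ (k + j) * (1 + x) ^ (k + j))) = beta_kernel_d1 k j x"
    unfolding beta_kernel_d1_def beta_kernel_def using assms by simp
  finally show ?thesis .
qed

lemma beta_kernel_d1_deriv:
  assumes "x > 0"
  shows "(beta_kernel_d1 k j has_real_derivative beta_kernel_d2 k j x) (at x)"
proof -
  define X where "X = x * (1 + x)"
  have X: "X \<noteq> 0" using assms by (simp add: X_def)
  have n: "((\<lambda>x. beta_kernel k j x * (real j - real k * x)) has_real_derivative
      beta_kernel_d1 k j x * (real j - real k * x) + beta_kernel k j x * (- real k)) (at x)"
    by (auto intro!: derivative_eq_intros beta_kernel_deriv[OF assms])
  have d: "((\<lambda>x. x * (1 + x)) has_real_derivative 1 + 2 * x) (at x)"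
    by (auto intro!: derivative_eq_intros)
  have "(beta_kernel_d1 k j has_real_derivative
     ((beta_kernel_d1 k j x * (real j - real k * x) + beta_kernel k j x * (- real k)) * (x * (1 + x))
      - beta_kernel k j x * (real j - real k * x) * (1 + 2 * x)) / ((x * (1 + x)) * (x * (1 + x)))) (at x)"
    unfolding beta_kernel_d1_def[abs_def] using DERIV_divide[OF n d] X by (simp add: X_def beta_kernel_d1_def)
  also have "((beta_kernel_d1 k j x * (real j - real k * x) + beta_kernel k j x * (- real k)) * (x * (1 + x))
      - beta_kernel k j x * (real j - real k * x) * (1 + 2 * x)) / ((x * (1 + x)) * (x * (1 + x))) = beta_kernel_d2 k j x"
  proof -
    have d: "beta_kernel_d1 k j x = beta_kernel k j x * (real j - real k * x) / X" by (simp add: beta_kernel_d1_def X_def)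
    show ?thesis
      unfolding beta_kernel_d2_def X_def[symmetric] using X
      by (simp add: d field_simps)
  qed
  finally show ?thesis .
qed

lemma beta_kernel_first_order: "x > 0 \<Longrightarrow> x * (1 + x) * beta_kernel_d1 k j x = (real j - real k * x) * beta_kernel k j x"
  by (simp add: beta_kernel_d1_def)

lemma beta_kernel_second_order:
  "x > 0 \<Longrightarrow> x * (1 + x) * beta_kernel_d2 k j x + (1 + 2 * x) * beta_kernel_d1 k j x
     = (real j - real k * x) * beta_kernel_d1 k j x - real k * beta_kernel k j x"
  by (simp add: beta_kernel_d2_def)

lemma beta_kernel_pos: "x > 0 \<Longrightarrow> beta_kernel k j x > 0"
  by (simp add: beta_kernel_def)

text \<open>The kernels satisfy \<open>x (1 + x) y' = (j - k x) y\<close>; this makes the differential equations below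
  hold term by term, except for the Euler--Poisson--Darboux equation.\<close>

definition kernel_sum ::
  "(nat \<Rightarrow> real) \<Rightarrow> nat \<Rightarrow> nat \<Rightarrow> nat \<Rightarrow> (nat \<Rightarrow> nat \<Rightarrow> real \<Rightarrow> real) \<Rightarrow> (nat \<Rightarrow> nat \<Rightarrow> real \<Rightarrow> real)
     \<Rightarrow> real \<Rightarrow> real \<Rightarrow> real" where
  "kernel_sum c a b m A B p q = (\<Sum>j\<le>m. c j * A a j p * B b (m - j) q)"

lemma kernel_sum_deriv:
  assumes A: "\<And>j. (A a j has_real_derivative A' a j (P x)) (at (P x))"
    and B: "\<And>j. (B b j has_real_derivative B' b j (Q x)) (at (Q x))"
    and P: "(P has_real_derivative u) (at x)" and Q: "(Q has_real_derivative - v) (at x)"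
  shows "((\<lambda>x. kernel_sum c a b m A B (P x) (Q x)) has_real_derivative
      u * kernel_sum c a b m A' B (P x) (Q x) - v * kernel_sum c a b m A B' (P x) (Q x)) (at x)"
proof -
  have AP: "((\<lambda>x. A a j (P x)) has_real_derivative A' a j (P x) * u) (at x)" for j
    by (rule DERIV_chain2[OF A P])
  have BQ: "((\<lambda>x. B b j (Q x)) has_real_derivative B' b j (Q x) * (- v)) (at x)" for j
    by (rule DERIV_chain2[OF B Q])
  have "((\<lambda>x. kernel_sum c a b m A B (P x) (Q x)) has_real_derivative
     (\<Sum>j\<le>m. c j * A a j (P x) * (B' b (m - j) (Q x) * (- v))
        + c j * (A' a j (P x) * u) * B b (m - j) (Q x))) (at x)"
    unfolding kernel_sum_def by (intro DERIV_sum DERIV_mult' DERIV_cmult AP BQ)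
  also have "(\<Sum>j\<le>m. c j * A a j (P x) * (B' b (m - j) (Q x) * (- v))
        + c j * (A' a j (P x) * u) * B b (m - j) (Q x))
     = u * kernel_sum c a b m A' B (P x) (Q x) - v * kernel_sum c a b m A B' (P x) (Q x)"
    unfolding kernel_sum_def sum_distrib_left sum_subtractf[symmetric]
    by (intro sum.cong) (auto simp: algebra_simps)
  finally show ?thesis .
qed

text \<open>The difference of the two sides telescopes after multiplication by \<open>p (1 + p) q (1 + q)\<close>.\<close>

lemma kernel_sum_epd:
  assumes c: "\<And>j. j < m \<Longrightarrow> real (m - j) * real (a + j) * c j = real (Suc j) * real (b + m - Suc j) * c (Suc j)"
    and p: "p > 0" and q: "q > 0"
  shows "(p - q) * kernel_sum c a b m beta_kernel_d1 beta_kernel_d1 p q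
      = real b * kernel_sum c a b m beta_kernel_d1 beta_kernel p q - real a * kernel_sum c a b m beta_kernel beta_kernel_d1 p q"
proof -
  define T where "T = (\<lambda>j. c j * beta_kernel a j p * beta_kernel b (m - j) q)"
  \<comment> \<open>\<open>R j\<close> is what the term \<open>j\<close> passes down and
    \<open>R (Suc j)\<close> what it passes up; they match by the recurrence \<open>c\<close>.
    Nothing is left at the ends: \<open>R 0\<close> has the factor j = 0, and the upward part of the
    last term has the factor m - j = 0.\<close>
  define R where "R = (\<lambda>j. q * (1 + p) * real j * real (b + (m - j)) * T j)"
  define X where "X = p * (1 + p)"
  define Y where "Y = q * (1 + q)"
  have XY: "X \<noteq> 0" "Y \<noteq> 0" using p q by (auto simp: X_def Y_def)
  have d: "X * Y * ((p - q) * (c j * beta_kernel_d1 a j p * beta_kernel_d1 b (m - j) q)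
      - (real b * (c j * beta_kernel_d1 a j p * beta_kernel b (m - j) q) - real a * (c j * beta_kernel a j p * beta_kernel_d1 b (m - j) q)))
     = (if j < m then R (Suc j) else 0) - R j" if "j \<le> m" for j
  proof -
    define k where "k = m - j"
    have dA: "X * beta_kernel_d1 a j p = (real j - real a * p) * beta_kernel a j p" using p by (simp add: beta_kernel_d1_def X_def)
    have dB: "Y * beta_kernel_d1 b k q = (real k - real b * q) * beta_kernel b k q" using q by (simp add: beta_kernel_d1_def Y_def)
    have "X * Y * ((p - q) * (c j * beta_kernel_d1 a j p * beta_kernel_d1 b k q)
      - (real b * (c j * beta_kernel_d1 a j p * beta_kernel b k q) - real a * (c j * beta_kernel a j p * beta_kernel_d1 b k q)))
     = c j * ((p - q) * (X * beta_kernel_d1 a j p) * (Y * beta_kernel_d1 b k q)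
      - (real b * (X * beta_kernel_d1 a j p) * Y * beta_kernel b k q - real a * X * beta_kernel a j p * (Y * beta_kernel_d1 b k q)))"
      by (simp add: algebra_simps)
    also have "\<dots> = T j * ((p - q) * (real j - real a * p) * (real k - real b * q)
      - real b * Y * (real j - real a * p) + real a * X * (real k - real b * q))"
      unfolding dA dB T_def k_def[symmetric] by (simp add: algebra_simps)
    also have "\<dots> = p * (1 + q) * real k * real (a + j) * T j - R j"
      unfolding R_def X_def Y_def k_def[symmetric] by (simp add: algebra_simps)
    also have "p * (1 + q) * real k * real (a + j) * T j = (if j < m then R (Suc j) else 0)"
    proof (cases "j < m")
      case True
      define l where "l = m - Suc j"
      have k: "k = Suc l" using True by (simp add: k_def l_def)
      have pp: "(1 + p) * beta_kernel a (Suc j) p = p * beta_kernel a j p"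
        using p by (simp add: beta_kernel_def)
      have qq: "(1 + q) * beta_kernel b (Suc l) q = q * beta_kernel b l q"
        using q by (simp add: beta_kernel_def)
      have cc: "real k * real (a + j) * c j = real (Suc j) * real (b + l) * c (Suc j)"
        using c[OF True] True by (simp add: k_def l_def)
      have "p * (1 + q) * real k * real (a + j) * T j
          = (real k * real (a + j) * c j) * (p * beta_kernel a j p) * ((1 + q) * beta_kernel b (Suc l) q)"
        unfolding T_def k_def[symmetric] unfolding k by (simp add: mult_ac)
      also have "\<dots> = R (Suc j)"
        unfolding cc pp[symmetric] qq R_def T_def l_def[symmetric] by (simp add: mult_ac)
      finally show ?thesis using True by simp
    next
      case False
      then show ?thesis using that by (simp add: k_def)
    qed
    finally show ?thesis unfolding k_def .
  qed
  have "X * Y * ((p - q) * kernel_sum c a b m beta_kernel_d1 beta_kernel_d1 p q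
      - (real b * kernel_sum c a b m beta_kernel_d1 beta_kernel p q - real a * kernel_sum c a b m beta_kernel beta_kernel_d1 p q))
     = (\<Sum>j\<le>m. X * Y * ((p - q) * (c j * beta_kernel_d1 a j p * beta_kernel_d1 b (m - j) q)
      - (real b * (c j * beta_kernel_d1 a j p * beta_kernel b (m - j) q) - real a * (c j * beta_kernel a j p * beta_kernel_d1 b (m - j) q))))"
    unfolding kernel_sum_def sum_distrib_left sum_subtractf[symmetric]
    by (intro sum.cong) (auto simp: mult_ac)
  also have "\<dots> = (\<Sum>j\<le>m. (if j < m then R (Suc j) else 0) - R j)"
    by (intro sum.cong) (auto simp: d)
  also have "\<dots> = (\<Sum>j\<le>m. if j < m then R (Suc j) else 0) - (\<Sum>j\<le>m. R j)"
    by (simp add: sum_subtractf)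
  also have "(\<Sum>j\<le>m. if j < m then R (Suc j) else 0) = (\<Sum>j<m. R (Suc j))"
    by (rule sum.mono_neutral_cong_right) auto
  also have "(\<Sum>j\<le>m. R j) = R 0 + (\<Sum>j<m. R (Suc j))"
    by (simp add: sum.atMost_shift)
  also have "R 0 = 0" by (simp add: R_def)
  finally show ?thesis using XY by simp
qed

text \<open>In u = p/(1+p) and v = q/(1+q) the operator p (1+p) d/dp is u d/du. Apart from the
  factors (1+p)^(-a) and (1+q)^(-b) the sum is homogeneous of degree m in u and v, and the first
  identity is Euler's relation for it. The other two are its derivatives in p and in q.\<close>

lemma kernel_sum_euler:
  assumes p: "p > 0" and q: "q > 0"
  shows "p * (1 + p) * kernel_sum c a b m beta_kernel_d1 beta_kernel p q + q * (1 + q) * kernel_sum c a b m beta_kernel beta_kernel_d1 p q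
      = (real m - real a * p - real b * q) * kernel_sum c a b m beta_kernel beta_kernel p q"
    and "p * (1 + p) * kernel_sum c a b m beta_kernel_d2 beta_kernel p q + (1 + 2 * p) * kernel_sum c a b m beta_kernel_d1 beta_kernel p q
        + q * (1 + q) * kernel_sum c a b m beta_kernel_d1 beta_kernel_d1 p q
      = (real m - real a * p - real b * q) * kernel_sum c a b m beta_kernel_d1 beta_kernel p q - real a * kernel_sum c a b m beta_kernel beta_kernel p q"
    and "q * (1 + q) * kernel_sum c a b m beta_kernel beta_kernel_d2 p q + (1 + 2 * q) * kernel_sum c a b m beta_kernel beta_kernel_d1 p q
        + p * (1 + p) * kernel_sum c a b m beta_kernel_d1 beta_kernel_d1 p q
      = (real m - real a * p - real b * q) * kernel_sum c a b m beta_kernel beta_kernel_d1 p q - real b * kernel_sum c a b m beta_kernel beta_kernel p q"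
proof -
  have 1: "p * (1 + p) * (c j * beta_kernel_d1 a j p * beta_kernel b (m - j) q) + q * (1 + q) * (c j * beta_kernel a j p * beta_kernel_d1 b (m - j) q)
    = (real m - real a * p - real b * q) * (c j * beta_kernel a j p * beta_kernel b (m - j) q)" if "j \<le> m" for j
  proof -
    have "p * (1 + p) * (c j * beta_kernel_d1 a j p * beta_kernel b (m - j) q) + q * (1 + q) * (c j * beta_kernel a j p * beta_kernel_d1 b (m - j) q)
     = c j * (p * (1 + p) * beta_kernel_d1 a j p) * beta_kernel b (m - j) q + c j * beta_kernel a j p * (q * (1 + q) * beta_kernel_d1 b (m - j) q)"
      by (simp add: mult_ac)
    then show ?thesis unfolding beta_kernel_first_order[OF p] beta_kernel_first_order[OF q]
      using that by (simp add: of_nat_diff algebra_simps)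
  qed
  show "p * (1 + p) * kernel_sum c a b m beta_kernel_d1 beta_kernel p q + q * (1 + q) * kernel_sum c a b m beta_kernel beta_kernel_d1 p q
      = (real m - real a * p - real b * q) * kernel_sum c a b m beta_kernel beta_kernel p q"
    unfolding kernel_sum_def sum_distrib_left sum.distrib[symmetric]
    by (intro sum.cong) (auto simp: 1)
  have 2: "p * (1 + p) * (c j * beta_kernel_d2 a j p * beta_kernel b (m - j) q) + (1 + 2 * p) * (c j * beta_kernel_d1 a j p * beta_kernel b (m - j) q)
      + q * (1 + q) * (c j * beta_kernel_d1 a j p * beta_kernel_d1 b (m - j) q)
    = (real m - real a * p - real b * q) * (c j * beta_kernel_d1 a j p * beta_kernel b (m - j) q)
      - real a * (c j * beta_kernel a j p * beta_kernel b (m - j) q)" if "j \<le> m" for j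
  proof -
    have "p * (1 + p) * (c j * beta_kernel_d2 a j p * beta_kernel b (m - j) q) + (1 + 2 * p) * (c j * beta_kernel_d1 a j p * beta_kernel b (m - j) q)
      + q * (1 + q) * (c j * beta_kernel_d1 a j p * beta_kernel_d1 b (m - j) q)
     = c j * (p * (1 + p) * beta_kernel_d2 a j p + (1 + 2 * p) * beta_kernel_d1 a j p) * beta_kernel b (m - j) q
       + c j * beta_kernel_d1 a j p * (q * (1 + q) * beta_kernel_d1 b (m - j) q)"
      by (simp add: algebra_simps)
    then show ?thesis unfolding beta_kernel_second_order[OF p] beta_kernel_first_order[OF q]
      using that by (simp add: of_nat_diff algebra_simps)
  qed
  show "p * (1 + p) * kernel_sum c a b m beta_kernel_d2 beta_kernel p q + (1 + 2 * p) * kernel_sum c a b m beta_kernel_d1 beta_kernel p q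
        + q * (1 + q) * kernel_sum c a b m beta_kernel_d1 beta_kernel_d1 p q
      = (real m - real a * p - real b * q) * kernel_sum c a b m beta_kernel_d1 beta_kernel p q - real a * kernel_sum c a b m beta_kernel beta_kernel p q"
    unfolding kernel_sum_def sum_distrib_left sum.distrib[symmetric] sum_subtractf[symmetric]
    by (intro sum.cong) (auto simp: 2)
  have 3: "q * (1 + q) * (c j * beta_kernel a j p * beta_kernel_d2 b (m - j) q) + (1 + 2 * q) * (c j * beta_kernel a j p * beta_kernel_d1 b (m - j) q)
      + p * (1 + p) * (c j * beta_kernel_d1 a j p * beta_kernel_d1 b (m - j) q)
    = (real m - real a * p - real b * q) * (c j * beta_kernel a j p * beta_kernel_d1 b (m - j) q)
      - real b * (c j * beta_kernel a j p * beta_kernel b (m - j) q)" if "j \<le> m" for j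
  proof -
    have "q * (1 + q) * (c j * beta_kernel a j p * beta_kernel_d2 b (m - j) q) + (1 + 2 * q) * (c j * beta_kernel a j p * beta_kernel_d1 b (m - j) q)
      + p * (1 + p) * (c j * beta_kernel_d1 a j p * beta_kernel_d1 b (m - j) q)
     = c j * beta_kernel a j p * (q * (1 + q) * beta_kernel_d2 b (m - j) q + (1 + 2 * q) * beta_kernel_d1 b (m - j) q)
       + c j * (p * (1 + p) * beta_kernel_d1 a j p) * beta_kernel_d1 b (m - j) q"
      by (simp add: algebra_simps)
    then show ?thesis unfolding beta_kernel_second_order[OF q] beta_kernel_first_order[OF p]
      using that by (simp add: of_nat_diff algebra_simps)
  qed
  show "q * (1 + q) * kernel_sum c a b m beta_kernel beta_kernel_d2 p q + (1 + 2 * q) * kernel_sum c a b m beta_kernel beta_kernel_d1 p q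
        + p * (1 + p) * kernel_sum c a b m beta_kernel_d1 beta_kernel_d1 p q
      = (real m - real a * p - real b * q) * kernel_sum c a b m beta_kernel beta_kernel_d1 p q - real b * kernel_sum c a b m beta_kernel beta_kernel p q"
    unfolding kernel_sum_def sum_distrib_left sum.distrib[symmetric] sum_subtractf[symmetric]
    by (intro sum.cong) (auto simp: 3)
qed

text \<open>The arguments stand for \<open>f\<close>, \<open>Y = f\<^sub>p\<^sub>q\<close>, the other derivatives of \<open>f\<close>, and the second derivative
  \<open>F2\<close> along the constraint line.\<close>

lemma second_order_identity:
  fixes a b g p q F Y fp fq fpp fqq F2 :: real
  assumes p: "p > 0" and q: "q > 0" and ab: "a > 0" "b > 0" and l: "a * p + b * q = g"
    and E: "(p - q) * Y = b * fp - a * fq"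
    and H: "p * (1 + p) * fp + q * (1 + q) * fq = - F"
    and Hp: "p * (1 + p) * fpp + (1 + 2 * p) * fp + q * (1 + q) * Y = - fp - a * F"
    and Hq: "q * (1 + q) * fqq + (1 + 2 * q) * fq + p * (1 + p) * Y = - fq - b * F"
    and F2: "F2 = b\<^sup>2 * fpp - 2 * a * b * Y + a\<^sup>2 * fqq"
  defines "N \<equiv> a * p\<^sup>2 + b * q\<^sup>2 + g"
  defines "A \<equiv> 3 * a * b * (p - q)\<^sup>2 / N - (2 * a * b + a + b)
      - b\<^sup>2 * q * (1 + q) * (2 * (1 + p) * (p - q) / N + 1) / (p * (1 + p))
      + a\<^sup>2 * p * (1 + p) * (2 * (1 + q) * (p - q) / N - 1) / (q * (1 + q))"
  shows "3 * a * b * (p - q)\<^sup>2 * Y + N * (F2 - (a + b) * Y)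
      = A * (a * b * F + N * Y) + 2 * a * b * g * sign_form a b g p q / (N * p * q) * F"
proof -
  define X where "X = p * (1 + p)"
  define Z where "Z = q * (1 + q)"
  define e where "e = p - q"
  have X: "X > 0" and Z: "Z > 0" using p q by (auto simp: X_def Z_def)
  have NXZ: "N = a * X + b * Z"
    unfolding N_def X_def Z_def l[symmetric] by (simp add: algebra_simps power2_eq_square)
  have N: "N > 0" using X Z ab by (simp add: NXZ add_pos_pos)
  have H': "X * fp + Z * fq = - F" and E': "b * fp - a * fq = e * Y"
    using H E by (simp_all add: X_def Z_def e_def)
  \<comment> \<open>\<open>H'\<close> and \<open>E'\<close> are two linear equations for
    \<open>fp\<close> and \<open>fq\<close>; by \<open>NXZ\<close> their determinant is N up to
    sign. From here on everything is expressed through \<open>F\<close> and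
    \<open>Y\<close>.\<close>
  have fp: "N * fp = Z * e * Y - a * F"
  proof -
    have "N * fp = a * (X * fp + Z * fq) + Z * (b * fp - a * fq)"
      by (simp add: NXZ algebra_simps)
    then show ?thesis unfolding H' E' by simp
  qed
  have fq: "N * fq = - b * F - X * e * Y"
  proof -
    have "N * fq = b * (X * fp + Z * fq) - X * (b * fp - a * fq)"
      by (simp add: NXZ algebra_simps)
    then show ?thesis unfolding H' E' by simp
  qed
  have fpp: "X * (N * fpp) = - (2 + 2 * p) * (Z * e * Y - a * F) - N * Z * Y - a * N * F"
  proof -
    have "X * fpp = - (2 + 2 * p) * fp - Z * Y - a * F"
      using Hp by (simp add: X_def Z_def algebra_simps)
    then have "N * (X * fpp) = N * (- (2 + 2 * p) * fp - Z * Y - a * F)" by simp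
    then have "X * (N * fpp) = - (2 + 2 * p) * (N * fp) - N * Z * Y - a * N * F"
      by (simp add: algebra_simps)
    then show ?thesis unfolding fp .
  qed
  have fqq: "Z * (N * fqq) = - (2 + 2 * q) * (- b * F - X * e * Y) - N * X * Y - b * N * F"
  proof -
    have "Z * fqq = - (2 + 2 * q) * fq - X * Y - b * F"
      using Hq by (simp add: X_def Z_def algebra_simps)
    then have "N * (Z * fqq) = N * (- (2 + 2 * q) * fq - X * Y - b * F)" by simp
    then have "Z * (N * fqq) = - (2 + 2 * q) * (N * fq) - N * X * Y - b * N * F"
      by (simp add: algebra_simps)
    then show ?thesis unfolding fq .
  qed
  \<comment> \<open>\<open>A\<close> cleared of denominators: precisely the coefficient that
    \<open>N * Y\<close> receives once \<open>fpp\<close> and \<open>fqq\<close> are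
    eliminated.\<close>
  define A' where "A' = (3 * a * b * e\<^sup>2 - N * (2 * a * b + a + b)) * X * Z
     - b\<^sup>2 * Z\<^sup>2 * (2 * (1 + p) * e + N) + a\<^sup>2 * X\<^sup>2 * (2 * (1 + q) * e - N)"
  have A: "N * X * Z * A = A'"
  proof -
    have "N * X * Z * A = N * X * Z * (3 * a * b * e\<^sup>2 / N) - N * X * Z * (2 * a * b + a + b)
       - N * X * Z * (b\<^sup>2 * Z * (2 * (1 + p) * e / N + 1) / X)
       + N * X * Z * (a\<^sup>2 * X * (2 * (1 + q) * e / N - 1) / Z)"
      unfolding A_def X_def Z_def e_def by (simp add: algebra_simps)
    also have "N * X * Z * (3 * a * b * e\<^sup>2 / N) = X * Z * (3 * a * b * e\<^sup>2)" using N by simp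
    also have "N * X * Z * (b\<^sup>2 * Z * (2 * (1 + p) * e / N + 1) / X) = b\<^sup>2 * Z\<^sup>2 * (2 * (1 + p) * e + N)"
      using N X by (simp add: field_simps power2_eq_square)
    also have "N * X * Z * (a\<^sup>2 * X * (2 * (1 + q) * e / N - 1) / Z) = a\<^sup>2 * X\<^sup>2 * (2 * (1 + q) * e - N)"
      using N Z by (simp add: field_simps power2_eq_square)
    finally show ?thesis by (simp add: A'_def algebra_simps)
  qed
  \<comment> \<open>Replacing \<open>N * Y\<close> by G - a b \<open>F\<close> moves a b
    \<open>A'\<close> into the coefficient of \<open>F\<close>. The remainder factors, and its
    nontrivial factor is \<open>sign_form\<close>.\<close>
  have key: "a * b * N * (b * Z * (2 * (1 + p) - N) + a * X * (2 * (1 + q) - N)) - a * b * A'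
     = 2 * a * b * g * sign_form a b g p q * (1 + p) * (1 + q)"
    unfolding A'_def sign_form_def NXZ e_def l[symmetric] X_def Z_def
    by (simp add: field_simps power2_eq_square)
  have "N * X * Z * (3 * a * b * e\<^sup>2 * Y + N * (F2 - (a + b) * Y))
     = N * (X * Z * (3 * a * b * e\<^sup>2 - N * (2 * a * b + a + b)) * Y + b\<^sup>2 * Z * (X * (N * fpp)) + a\<^sup>2 * X * (Z * (N * fqq)))"
    unfolding F2 by (simp add: algebra_simps)
  also have "\<dots> = A' * (N * Y) + F * (a * b * N * (b * Z * (2 * (1 + p) - N) + a * X * (2 * (1 + q) - N)))"
    unfolding fpp fqq A'_def by (simp add: algebra_simps power2_eq_square)
  also have "\<dots> = A' * (N * Y) + F * (a * b * A' + 2 * a * b * g * sign_form a b g p q * (1 + p) * (1 + q))"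
    using key by (simp add: algebra_simps)
  also have "\<dots> = A' * (a * b * F + N * Y) + 2 * a * b * g * sign_form a b g p q * (1 + p) * (1 + q) * F"
    by (simp add: algebra_simps)
  also have "\<dots> = N * X * Z * (A * (a * b * F + N * Y) + 2 * a * b * g * sign_form a b g p q / (N * p * q) * F)"
  proof -
    have "N * X * Z * (2 * a * b * g * sign_form a b g p q / (N * p * q) * F)
       = 2 * a * b * g * sign_form a b g p q * (1 + p) * (1 + q) * F"
      unfolding X_def Z_def using N p q by simp
    then show ?thesis unfolding A[symmetric] by (simp only: distrib_left mult.assoc)
  qed
  finally show ?thesis using N X Z unfolding e_def by simp
qed

section \<open>Critical points along the constraint line\<close>

lemma strict_increase_right:
  fixes f f' :: "real \<Rightarrow> real"
  assumes "z < u" and "\<And>x. z \<le> x \<Longrightarrow> x \<le> u \<Longrightarrow> (f has_real_derivative f' x) (at x)"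
    and "\<And>x. z < x \<Longrightarrow> x < u \<Longrightarrow> f' x > 0"
  shows "f z < f u"
proof (rule DERIV_pos_imp_increasing_open[OF assms(1)])
  show "\<exists>y. (f has_real_derivative y) (at x) \<and> 0 < y" if "z < x" "x < u" for x
    using assms(2)[of x] assms(3)[of x] that by auto
  show "continuous_on {z..u} f"
    by (rule DERIV_continuous_on[where D = f'], rule has_field_derivative_at_within, rule assms(2)) auto
qed

text \<open>Suppose x0 is a minimum of \<Psi>. If D is nonnegative at x0, no point of [0, x0) can
  maximise \<Psi> on [0, x0]. A maximum at x0, together with minimality there, would make \<Psi>
  constant on that interval, so 0 would be a maximum too. If D is negative at x0, \<Psi> drops
  strictly to the right of x0.\<close>

lemma weighted_section_not_minimal:
  fixes a b m :: nat and p0 q0 :: real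
  assumes a: "a \<ge> 1" and b: "b \<ge> 1"
    and c_pos: "\<And>j. j \<le> m \<Longrightarrow> c j > 0"
    and c: "\<And>j. j < m \<Longrightarrow> real (m - j) * real (a + j) * c j = real (Suc j) * real (b + m - Suc j) * c (Suc j)"
    and l0: "real a * p0 + real b * q0 = real (Suc m)" and q0: "0 < q0" "q0 < p0"
  shows "\<exists>p q. p > 0 \<and> q > 0 \<and> real a * p + real b * q = real (Suc m) \<and>
     (real a * p\<^sup>2 + real b * q\<^sup>2 + real (Suc m)) * (kernel_sum c a b m beta_kernel beta_kernel p q)\<^sup>2
     < (real a * p0\<^sup>2 + real b * q0\<^sup>2 + real (Suc m)) * (kernel_sum c a b m beta_kernel beta_kernel p0 q0)\<^sup>2"
proof (rule ccontr)
  assume neg: "\<not> ?thesis"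
  define \<alpha> where "\<alpha> = real a"
  define \<beta> where "\<beta> = real b"
  define \<gamma> where "\<gamma> = real (Suc m)"
  define \<sigma> where "\<sigma> = \<alpha> + \<beta>"
  have pos: "\<alpha> > 0" "\<beta> > 0" "\<gamma> > 0" "\<sigma> > 0"
    using a b by (auto simp: \<alpha>_def \<beta>_def \<gamma>_def \<sigma>_def)
  \<comment> \<open>(e, e) is the diagonal point of the constraint line, and x is the displacement
    from it in the direction (\<beta>, -\<alpha>). \<open>I\<close> is the range in which both
    coordinates stay positive.\<close>
  define e where "e = \<gamma> / \<sigma>"
  define P where "P = (\<lambda>x. e + \<beta> * x)"
  define Q where "Q = (\<lambda>x. e - \<alpha> * x)"
  define I where "I = {- e / \<beta> <..< e / \<alpha>}"
  have I_open: "open I" by (simp add: I_def)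
  have e: "e > 0" using pos by (simp add: e_def)
  have PQ: "P x > 0" "Q x > 0" if "x \<in> I" for x
    using that pos by (auto simp: I_def P_def Q_def field_simps)
  have \<sigma>e: "\<sigma> * e = \<gamma>" using pos by (simp add: e_def)
  have lin: "\<alpha> * P x + \<beta> * Q x = \<gamma>" for x
    unfolding \<sigma>e[symmetric] by (simp add: P_def Q_def \<sigma>_def algebra_simps)
  have diff: "P x - Q x = \<sigma> * x" for x
    by (simp add: P_def Q_def \<sigma>_def algebra_simps)
  have dP: "(P has_real_derivative \<beta>) (at x)" for x
    unfolding P_def by (auto intro!: derivative_eq_intros)
  have dQ: "(Q has_real_derivative - \<alpha>) (at x)" for x
    unfolding Q_def by (auto intro!: derivative_eq_intros)
  define F where "F = (\<lambda>x. kernel_sum c a b m beta_kernel beta_kernel (P x) (Q x))"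
  define fp where "fp = (\<lambda>x. kernel_sum c a b m beta_kernel_d1 beta_kernel (P x) (Q x))"
  define fq where "fq = (\<lambda>x. kernel_sum c a b m beta_kernel beta_kernel_d1 (P x) (Q x))"
  define Y where "Y = (\<lambda>x. kernel_sum c a b m beta_kernel_d1 beta_kernel_d1 (P x) (Q x))"
  define fpp where "fpp = (\<lambda>x. kernel_sum c a b m beta_kernel_d2 beta_kernel (P x) (Q x))"
  define fqq where "fqq = (\<lambda>x. kernel_sum c a b m beta_kernel beta_kernel_d2 (P x) (Q x))"
  define Y' where "Y' = (\<lambda>x. \<beta> * kernel_sum c a b m beta_kernel_d2 beta_kernel_d1 (P x) (Q x) - \<alpha> * kernel_sum c a b m beta_kernel_d1 beta_kernel_d2 (P x) (Q x))"
  have E: "\<sigma> * x * Y x = \<beta> * fp x - \<alpha> * fq x" if "x \<in> I" for x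
    using kernel_sum_epd[where c=c and m=m and a=a and b=b, OF c PQ[OF that]] diff[of x]
    by (simp add: Y_def fp_def fq_def \<alpha>_def \<beta>_def)
  have dF: "(F has_real_derivative \<beta> * fp x - \<alpha> * fq x) (at x)" if "x \<in> I" for x
    unfolding F_def fp_def fq_def
    by (rule kernel_sum_deriv) (auto intro!: beta_kernel_deriv dP dQ PQ that)
  have dfp: "(fp has_real_derivative \<beta> * fpp x - \<alpha> * Y x) (at x)" if "x \<in> I" for x
    unfolding fp_def fpp_def Y_def
    by (rule kernel_sum_deriv) (auto intro!: beta_kernel_deriv beta_kernel_d1_deriv dP dQ PQ that)
  have dfq: "(fq has_real_derivative \<beta> * Y x - \<alpha> * fqq x) (at x)" if "x \<in> I" for x
    unfolding fq_def fqq_def Y_def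
    by (rule kernel_sum_deriv) (auto intro!: beta_kernel_deriv beta_kernel_d1_deriv dP dQ PQ that)
  have dY: "(Y has_real_derivative Y' x) (at x)" if "x \<in> I" for x
    unfolding Y_def Y'_def
    by (rule kernel_sum_deriv) (auto intro!: beta_kernel_deriv beta_kernel_d1_deriv dP dQ PQ that)
  define F2 where "F2 = (\<lambda>x. \<beta>\<^sup>2 * fpp x - 2 * \<alpha> * \<beta> * Y x + \<alpha>\<^sup>2 * fqq x)"
  \<comment> \<open>Both sides are the derivative of the two sides of \<open>E\<close>. This
    expresses the third-order quantity \<open>Y'\<close>, multiplied by p - q, through second
    derivatives.\<close>
  have F2: "F2 x = \<sigma> * Y x + \<sigma> * x * Y' x" if x: "x \<in> I" for x
  proof -
    have "((\<lambda>x. \<beta> * fp x - \<alpha> * fq x) has_real_derivative F2 x) (at x)"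
      by (auto intro!: derivative_eq_intros dfp dfq x simp: F2_def algebra_simps power2_eq_square)
    moreover have "((\<lambda>x. \<sigma> * x * Y x) has_real_derivative \<sigma> * Y x + \<sigma> * x * Y' x) (at x)"
      by (auto intro!: derivative_eq_intros dY x)
    then have "((\<lambda>x. \<beta> * fp x - \<alpha> * fq x) has_real_derivative \<sigma> * Y x + \<sigma> * x * Y' x) (at x)"
      by (rule has_field_derivative_transform_within_open[OF _ _ x]) (simp_all add: I_open E)
    ultimately show ?thesis by (rule DERIV_unique)
  qed
  define N where "N = (\<lambda>x. \<alpha> * (P x)\<^sup>2 + \<beta> * (Q x)\<^sup>2 + \<gamma>)"
  have Npos: "N x > 0" for x using pos unfolding N_def by (simp add: add_nonneg_pos)
  have dN: "(N has_real_derivative 2 * \<alpha> * \<beta> * \<sigma> * x) (at x)" for x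
  proof -
    have "(N has_real_derivative 2 * \<alpha> * \<beta> * (P x - Q x)) (at x)"
      unfolding N_def by (auto intro!: derivative_eq_intros dP dQ simp: algebra_simps)
    then show ?thesis by (simp add: diff mult.assoc)
  qed
  define G where "G = (\<lambda>x. \<alpha> * \<beta> * F x + N x * Y x)"
  define G' where "G' = (\<lambda>x. \<alpha> * \<beta> * (\<sigma> * x * Y x) + (2 * \<alpha> * \<beta> * \<sigma> * x * Y x + N x * Y' x))"
  have dG: "(G has_real_derivative G' x) (at x)" if "x \<in> I" for x
    unfolding G_def G'_def
    by (auto intro!: derivative_eq_intros dN dY dF[OF that, folded E[OF that]] that simp: algebra_simps)
  define \<Psi> where "\<Psi> = (\<lambda>x. N x * (F x)\<^sup>2)"
  have d\<Psi>: "(\<Psi> has_real_derivative 2 * \<sigma> * x * F x * G x) (at x)" if "x \<in> I" for x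
    unfolding \<Psi>_def G_def
    by (auto intro!: derivative_eq_intros dN dF[OF that, folded E[OF that]] simp: algebra_simps power2_eq_square)
  have Fpos: "F x > 0" if "x \<in> I" for x
    unfolding F_def kernel_sum_def using PQ[OF that] c_pos
    by (intro sum_pos) (auto intro!: mult_pos_pos beta_kernel_pos)
  \<comment> \<open>Only the sign of \<open>A\<close> on the diagonal is ever computed; wherever
    else \<open>key\<close> is used, \<open>A\<close> is multiplied by G = 0.\<close>
  define A where "A = (\<lambda>p q N. 3 * \<alpha> * \<beta> * (p - q)\<^sup>2 / N - (2 * \<alpha> * \<beta> + \<alpha> + \<beta>)
      - \<beta>\<^sup>2 * q * (1 + q) * (2 * (1 + p) * (p - q) / N + 1) / (p * (1 + p))
      + \<alpha>\<^sup>2 * p * (1 + p) * (2 * (1 + q) * (p - q) / N - 1) / (q * (1 + q)))"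
  define D where "D = (\<lambda>x. sign_form \<alpha> \<beta> \<gamma> (P x) (Q x))"
  have key: "\<sigma> * x * G' x = A (P x) (Q x) (N x) * G x
      + 2 * \<alpha> * \<beta> * \<gamma> * D x / (N x * P x * Q x) * F x" if x: "x \<in> I" for x
  proof -
    \<comment> \<open>The constraint uses \<gamma> = m + 1 while the degree of homogeneity is m =
      \<gamma> - 1; hence the right-hand side -F in the first-order equation.\<close>
    have m\<gamma>: "real m - \<alpha> * P x - \<beta> * Q x = - 1" using lin[of x] by (simp add: \<gamma>_def)
    note eu = kernel_sum_euler[OF PQ[OF x], where c=c and a=a and b=b and m=m, folded \<alpha>_def \<beta>_def, unfolded m\<gamma>]
    have E': "(P x - Q x) * Y x = \<beta> * fp x - \<alpha> * fq x" using E[OF x] by (simp add: diff)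
    have H: "P x * (1 + P x) * fp x + Q x * (1 + Q x) * fq x = - F x"
      using eu(1) by (simp add: F_def fp_def fq_def)
    have Hp: "P x * (1 + P x) * fpp x + (1 + 2 * P x) * fp x + Q x * (1 + Q x) * Y x = - fp x - \<alpha> * F x"
      using eu(2) by (simp add: F_def fp_def fpp_def Y_def)
    have Hq: "Q x * (1 + Q x) * fqq x + (1 + 2 * Q x) * fq x + P x * (1 + P x) * Y x = - fq x - \<beta> * F x"
      using eu(3) by (simp add: F_def fq_def fqq_def Y_def)
    have F2x: "F2 x = \<beta>\<^sup>2 * fpp x - 2 * \<alpha> * \<beta> * Y x + \<alpha>\<^sup>2 * fqq x" by (simp add: F2_def)
    have "3 * \<alpha> * \<beta> * (P x - Q x)\<^sup>2 * Y x + N x * (F2 x - (\<alpha> + \<beta>) * Y x)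
      = A (P x) (Q x) (N x) * (\<alpha> * \<beta> * F x + N x * Y x)
        + 2 * \<alpha> * \<beta> * \<gamma> * D x / (N x * P x * Q x) * F x"
      unfolding A_def N_def D_def
      by (rule second_order_identity[OF PQ[OF x] pos(1,2) lin E' H Hp Hq F2x])
    \<comment> \<open>The coefficient 3 is 1 from differentiating \<alpha> \<beta> F and 2 from
      differentiating N.\<close>
    moreover have "\<sigma> * x * G' x = 3 * \<alpha> * \<beta> * (P x - Q x)\<^sup>2 * Y x + N x * (F2 x - (\<alpha> + \<beta>) * Y x)"
      unfolding F2[OF x] diff G'_def \<sigma>_def[symmetric] by (simp add: algebra_simps power2_eq_square)
    ultimately show ?thesis by (simp add: G_def)
  qed
  define x0 where "x0 = (p0 - e) / \<beta>"
  have P0: "P x0 = p0" using pos by (simp add: P_def x0_def)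
  have Q0: "Q x0 = q0"
  proof -
    have "\<beta> * Q x0 = \<beta> * q0"
      using lin[of x0, unfolded P0] l0[folded \<alpha>_def \<beta>_def \<gamma>_def] by linarith
    then show ?thesis using pos by simp
  qed
  have "\<sigma> * x0 > 0" using diff[of x0] q0 P0 Q0 by simp
  then have x0: "x0 > 0" using pos by (simp add: zero_less_mult_iff)
  have x0I: "x0 < e / \<alpha>" using Q0 q0 pos by (simp add: Q_def field_simps)
  have I0: "x \<in> I" if "0 \<le> x" "x < e / \<alpha>" for x
    using that e pos by (auto simp: I_def intro: less_le_trans[of _ 0])
  have min: "\<Psi> x0 \<le> \<Psi> x" if "x \<in> I" for x
  proof (rule ccontr)
    assume "\<not> ?thesis"
    then have "P x > 0 \<and> Q x > 0 \<and> real a * P x + real b * Q x = real (Suc m) \<and>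
     (real a * (P x)\<^sup>2 + real b * (Q x)\<^sup>2 + real (Suc m)) * (kernel_sum c a b m beta_kernel beta_kernel (P x) (Q x))\<^sup>2
     < (real a * p0\<^sup>2 + real b * q0\<^sup>2 + real (Suc m)) * (kernel_sum c a b m beta_kernel beta_kernel p0 q0)\<^sup>2"
      using PQ[OF that] lin[of x, unfolded \<alpha>_def \<beta>_def \<gamma>_def]
      by (simp add: \<Psi>_def N_def F_def P0 Q0 \<alpha>_def \<beta>_def \<gamma>_def)
    then show False using neg by blast
  qed
  \<comment> \<open>At the points where this is applied the derivative of \<Psi> vanishes.
    Positivity of G strictly to the right of z still makes \<Psi> increase, and u can be taken as
    close to z as desired.\<close>
  have up: "\<exists>u. z < u \<and> u < e / \<alpha> \<and> u < z + r \<and> \<Psi> z < \<Psi> u"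
    if z: "0 \<le> z" "z < e / \<alpha>" and r: "r > 0" and G: "\<exists>d>0. \<forall>h. 0 < h \<longrightarrow> h < d \<longrightarrow> G (z + h) > 0" for z r
  proof -
    obtain d where d: "d > 0" "\<And>h. 0 < h \<Longrightarrow> h < d \<Longrightarrow> G (z + h) > 0" using G by blast
    have "z < min (min (z + d) (z + r)) (e / \<alpha>)" using d(1) r z by simp
    from dense[OF this] obtain u where u: "z < u" "u < z + d" "u < z + r" "u < e / \<alpha>" by auto
    have "\<Psi> z < \<Psi> u"
    proof (rule strict_increase_right[OF u(1), where f' = "\<lambda>x. 2 * \<sigma> * x * F x * G x"])
      fix x assume x: "z < x" "x < u"
      then have "x \<in> I" using u z by (intro I0) auto
      moreover have "G x > 0" using d(2)[of "x - z"] x u by simp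
      ultimately show "2 * \<sigma> * x * F x * G x > 0" using Fpos[of x] x z pos by simp
    qed (use u z in \<open>auto intro!: d\<Psi> I0\<close>)
    then show ?thesis using u by blast
  qed
  have G0: "G x0 = 0"
  proof -
    have "2 * \<sigma> * x0 * F x0 * G x0 = 0"
    proof (rule DERIV_local_min[OF d\<Psi>])
      show "x0 \<in> I" using x0 x0I I0 by simp
      show "0 < min x0 (e / \<alpha> - x0)" using x0 x0I by simp
      show "\<forall>y. \<bar>x0 - y\<bar> < min x0 (e / \<alpha> - x0) \<longrightarrow> \<Psi> x0 \<le> \<Psi> y"
        by (auto intro!: min I0)
    qed
    then show ?thesis using Fpos[OF I0, of x0] x0 x0I pos by simp
  qed
  show False
  proof (cases "D x0 \<ge> 0")
    case True
    have Dpos: "D x > 0" if "0 \<le> x" "x < x0" for x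
    proof -
      have "Q x \<le> P x" using diff[of x] that pos by (simp add: algebra_simps)
      moreover have "P x < p0" unfolding P0[symmetric] P_def using that pos by simp
      ultimately show ?thesis
        unfolding D_def
        using sign_form_single_crossing[OF pos(1-3) lin[of x0] _ _ lin[of x]] True q0
        by (simp add: P0 Q0 D_def)
    qed
    \<comment> \<open>At z = 0 the left side of \<open>key\<close> vanishes, and A < 0 with D > 0
      forces G > 0 there, hence nearby. At an interior maximum G = 0, and \<open>key\<close> gives
      G' > 0. In both cases G is positive just to the right of z, so \<Psi> rises.\<close>
    have no_max: False if z: "0 \<le> z" "z < x0" and mx: "\<And>x. 0 \<le> x \<Longrightarrow> x \<le> x0 \<Longrightarrow> \<Psi> x \<le> \<Psi> z" for z
    proof -
      have zI: "z \<in> I" "z < e / \<alpha>" using z x0I by (auto intro: I0)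
      have B: "2 * \<alpha> * \<beta> * \<gamma> * D z / (N z * P z * Q z) * F z > 0"
        using Dpos[OF z] Npos[of z] PQ[OF zI(1)] Fpos[OF zI(1)] pos by simp
      have "\<exists>d>0. \<forall>h. 0 < h \<longrightarrow> h < d \<longrightarrow> G (z + h) > 0"
      proof (cases "z = 0")
        case True
        have eq: "P z = e" "Q z = e" by (simp_all add: True P_def Q_def)
        have "A e e (N z) = - (2 * \<alpha> * \<beta> + \<alpha> + \<beta>) - \<beta>\<^sup>2 - \<alpha>\<^sup>2"
          unfolding A_def using e by simp
        also have "\<dots> < 0" using pos by (smt (verit) mult_pos_pos zero_le_power2)
        finally have "A e e (N z) < 0" .
        moreover have "A e e (N z) * G z < 0"
          using key[OF zI(1)] B unfolding eq by (simp add: True)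
        ultimately have "G z > 0" by (simp add: mult_less_0_iff)
        moreover have "isCont G z" using dG[OF zI(1)] by (rule DERIV_isCont)
        ultimately have "\<forall>\<^sub>F x in at z. G x > 0"
          by (auto simp: isCont_def intro: order_tendstoD)
        then show ?thesis
          unfolding eventually_at by (auto simp: dist_real_def)
      next
        case False
        then have z0: "z > 0" using z by simp
        have "2 * \<sigma> * z * F z * G z = 0"
        proof (rule DERIV_local_max[OF d\<Psi>[OF zI(1)]])
          show "0 < min z (x0 - z)" using z z0 by simp
          show "\<forall>y. \<bar>z - y\<bar> < min z (x0 - z) \<longrightarrow> \<Psi> y \<le> \<Psi> z" by (auto intro!: mx)
        qed
        then have Gz: "G z = 0" using Fpos[OF zI(1)] z0 pos by simp
        have "\<sigma> * z * G' z > 0" using key[OF zI(1)] B Gz by simp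
        then have "G' z > 0" by (rule zero_less_mult_pos) (simp add: z0 pos)
        from DERIV_pos_inc_right[OF dG[OF zI(1)] this] show ?thesis using Gz by simp
      qed
      from up[OF z(1) zI(2) _ this, of "x0 - z"] z obtain u where "z < u" "u < x0" "\<Psi> z < \<Psi> u"
        by auto
      then show False using mx[of u] z by simp
    qed
    have "continuous_on {0..x0} \<Psi>"
      using x0I by (auto intro!: DERIV_continuous_on has_field_derivative_at_within[OF d\<Psi>] I0)
    then obtain z where z: "z \<in> {0..x0}" "\<And>x. x \<in> {0..x0} \<Longrightarrow> \<Psi> x \<le> \<Psi> z"
      using continuous_attains_sup[of "{0..x0}" \<Psi>] x0 by auto
    show False
    proof (cases "z = x0")
      case True
      have "\<Psi> x \<le> \<Psi> 0" if "0 \<le> x" "x \<le> x0" for x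
        using z(2)[of x] min[OF I0, of 0] True that x0 x0I by simp
      then show False using no_max[of 0] x0 by simp
    next
      case False
      then show False using no_max[of z] z by auto
    qed
  next
    case False
    have x0': "x0 \<in> I" using x0 x0I by (intro I0) auto
    \<comment> \<open>Since G vanishes at x0, \<open>key\<close> makes G' negative there. G is then
      negative just to the right of x0, which contradicts minimality.\<close>
    have "2 * \<alpha> * \<beta> * \<gamma> * D x0 / (N x0 * P x0 * Q x0) * F x0 < 0"
      using False Npos[of x0] PQ[OF x0'] Fpos[OF x0'] pos
      by (intro mult_neg_pos divide_neg_pos mult_pos_neg) auto
    then have "\<sigma> * x0 * G' x0 < 0" using key[OF x0'] G0 by simp
    then have "0 < \<sigma> * x0 * (- G' x0)" by simp
    then have "0 < - G' x0" by (rule zero_less_mult_pos) (simp add: x0 pos)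
    then have "G' x0 < 0" by simp
    from DERIV_neg_dec_right[OF dG[OF x0'] this] G0
    obtain d where d: "d > 0" "\<And>h. 0 < h \<Longrightarrow> h < d \<Longrightarrow> G (x0 + h) < 0" by auto
    have "x0 < min (x0 + d) (e / \<alpha>)" using d(1) x0I by simp
    from dense[OF this] obtain u where u: "x0 < u" "u < x0 + d" "u < e / \<alpha>" by auto
    have "- \<Psi> x0 < - \<Psi> u"
    proof (rule strict_increase_right[OF u(1), where f' = "\<lambda>x. - (2 * \<sigma> * x * F x * G x)"])
      fix x assume x: "x0 < x" "x < u"
      then have "x \<in> I" using u x0 by (intro I0) auto
      moreover have "G x < 0" using d(2)[of "x - x0"] x u by simp
      ultimately show "- (2 * \<sigma> * x * F x * G x) > 0" using Fpos[of x] x x0 pos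
        by (simp add: mult_pos_neg)
    qed (use u x0 in \<open>auto intro!: DERIV_minus d\<Psi> I0\<close>)
    then show False using min[OF I0, of u] u x0 by simp
  qed
qed

section \<open>The section integral\<close>

text \<open>The Beta function at (k+1, l+1).\<close>

definition euler_int :: "nat \<Rightarrow> nat \<Rightarrow> real" where
  "euler_int k l = integral {0..1} (\<lambda>t. t ^ k * (1 - t) ^ l)"

lemma euler_int_has_integral: "((\<lambda>t. t ^ k * (1 - t) ^ l) has_integral euler_int k l) {0..1::real}"
  unfolding euler_int_def
  by (intro integrable_integral integrable_continuous_interval continuous_intros)

text \<open>t^(k+1) (1-t)^(l+1) vanishes at both ends, so its derivative integrates to zero.\<close>

lemma euler_int_shift: "real (Suc k) * euler_int k (Suc l) = real (Suc l) * euler_int (Suc k) l"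
proof -
  have 1: "((\<lambda>t. real (Suc k) * (t ^ k * (1 - t) ^ Suc l) - real (Suc l) * (t ^ Suc k * (1 - t) ^ l))
      has_integral (1 ^ Suc k * (1 - 1) ^ Suc l - 0 ^ Suc k * (1 - 0) ^ Suc l)) {0..1::real}"
  proof (rule fundamental_theorem_of_calculus)
    show "((\<lambda>t. t ^ Suc k * (1 - t) ^ Suc l) has_vector_derivative
       real (Suc k) * (t ^ k * (1 - t) ^ Suc l) - real (Suc l) * (t ^ Suc k * (1 - t) ^ l)) (at t within {0..1})"
      for t :: real
      unfolding has_real_derivative_iff_has_vector_derivative[symmetric]
      by (rule derivative_eq_intros refl | simp add: algebra_simps)+
  qed simp
  have 2: "((\<lambda>t. real (Suc k) * (t ^ k * (1 - t) ^ Suc l) - real (Suc l) * (t ^ Suc k * (1 - t) ^ l))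
      has_integral (real (Suc k) * euler_int k (Suc l) - real (Suc l) * euler_int (Suc k) l)) {0..1::real}"
    by (intro has_integral_diff has_integral_mult_right euler_int_has_integral)
  have "real (Suc k) * euler_int k (Suc l) - real (Suc l) * euler_int (Suc k) l = 0"
    using has_integral_unique[OF 2 1] by simp
  then show ?thesis by simp
qed

text \<open>The shift relation trades one power of 1 - t for one power of t, which reduces to l = 0;
  the induction therefore needs k arbitrary.\<close>

lemma euler_int_pos: "euler_int k l > 0"
proof (induction l arbitrary: k)
  case 0
  have "((\<lambda>t. t ^ k * (1 - t) ^ 0) has_integral (1 ^ Suc k / real (Suc k) - 0 ^ Suc k / real (Suc k))) {0..1::real}"
  proof (rule fundamental_theorem_of_calculus)
    show "((\<lambda>t. t ^ Suc k / real (Suc k)) has_vector_derivative t ^ k * (1 - t) ^ 0) (at t within {0..1})"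
      for t :: real
      unfolding has_real_derivative_iff_has_vector_derivative[symmetric]
      by (rule derivative_eq_intros refl | simp)+
  qed simp
  then have "euler_int k 0 = 1 ^ Suc k / real (Suc k) - 0 ^ Suc k / real (Suc k)"
    by (rule has_integral_unique[OF euler_int_has_integral])
  then show ?case by simp
next
  case (Suc l)
  have "0 < real (Suc k) * euler_int k (Suc l)"
    unfolding euler_int_shift using Suc.IH by simp
  then show ?case by (rule zero_less_mult_pos) simp
qed

text \<open>The coefficient of u^j v^(m-j) in the integral of t^(a-1) (1-t)^(b-1) (t u + (1-t) v)^m
  over [0,1].\<close>

definition section_coeff :: "nat \<Rightarrow> nat \<Rightarrow> nat \<Rightarrow> nat \<Rightarrow> real" where
  "section_coeff a b m j = real (m choose j) * euler_int (a - 1 + j) (b - 1 + (m - j))"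

lemma section_coeff_pos: "j \<le> m \<Longrightarrow> section_coeff a b m j > 0"
  by (simp add: section_coeff_def euler_int_pos)

text \<open>The product of binomial absorption and \<open>euler_int_shift\<close>. It is the
  recurrence that \<open>kernel_sum_epd\<close> demands.\<close>

lemma section_coeff_rec:
  assumes "a \<ge> 1" "b \<ge> 1" "j < m"
  shows "real (m - j) * real (a + j) * section_coeff a b m j
    = real (Suc j) * real (b + m - Suc j) * section_coeff a b m (Suc j)"
proof -
  obtain a' b' where ab: "a = Suc a'" "b = Suc b'" using assms by (cases a; cases b) auto
  obtain l where m: "m = Suc (j + l)" using assms(3) less_imp_Suc_add by blast
  have "(m - j) * (m choose j) = Suc j * (m choose Suc j)"
  proof -
    have "(m - j) * (m choose j) = m * ((m - 1) choose j)" by (rule binomial_absorb_comp)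
    also have "\<dots> = Suc j * (m choose Suc j)"
      using Suc_times_binomial[of j "m - 1"] assms(3) by simp
    finally show ?thesis .
  qed
  then have bin: "real (m - j) * real (m choose j) = real (Suc j) * real (m choose Suc j)"
    by (metis of_nat_mult)
  have "real (m - j) * real (a + j) * section_coeff a b m j
      = (real (m - j) * real (m choose j)) * (real (Suc (a' + j)) * euler_int (a' + j) (Suc (b' + l)))"
    by (simp add: section_coeff_def ab m mult_ac)
  also have "\<dots> = real (Suc j) * real (m choose Suc j) * (real (Suc (b' + l)) * euler_int (Suc (a' + j)) (b' + l))"
    unfolding bin euler_int_shift ..
  also have "\<dots> = real (Suc j) * real (b + m - Suc j) * section_coeff a b m (Suc j)"
    by (simp add: section_coeff_def ab m mult_ac)
  finally show ?thesis .
qed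

text \<open>Since 0^0 = 1, exponent 0 gives the indicator of s \<ge> 0, boundary included. This fits
  a block of size one, whose only constraint is that its single coordinate be nonnegative.\<close>

definition pos_pow :: "nat \<Rightarrow> real \<Rightarrow> real" where
  "pos_pow k s = (if s \<ge> 0 then s ^ k else 0)"

lemma pos_pow_nonneg [simp]: "pos_pow k s \<ge> 0"
  by (simp add: pos_pow_def)

lemma pos_pow_measurable [measurable]: "pos_pow k \<in> borel_measurable borel"
  unfolding pos_pow_def[abs_def] by measurable

lemma pos_pow_mult: "c > 0 \<Longrightarrow> pos_pow k (c * s) = c ^ k * pos_pow k s"
  by (simp add: pos_pow_def power_mult_distrib zero_le_mult_iff)

text \<open>The differences divided by block lengths are, up to a common factor, the block values of
  the direction orthogonal to the all-ones vector and to the vector with block values p, q, r. The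
  cyclic form makes the symmetry between the blocks visible.\<close>

definition section_integral :: "nat \<Rightarrow> nat \<Rightarrow> nat \<Rightarrow> real \<Rightarrow> real \<Rightarrow> real \<Rightarrow> ennreal" where
  "section_integral a b c p q r = (\<integral>\<^sup>+ t. ennreal
      (pos_pow (a - 1) (1 + (q - r) * t / real a) * pos_pow (b - 1) (1 + (r - p) * t / real b)
        * pos_pow (c - 1) (1 + (p - q) * t / real c)) \<partial>lborel)"

lemma section_integral_rotate: "section_integral b c a q r p = section_integral a b c p q r"
  unfolding section_integral_def by (simp add: mult_ac)

lemma section_integral_scale:
  assumes "s \<noteq> 0"
  shows "section_integral a b c p q r = ennreal \<bar>s\<bar> * section_integral a b c (s * p) (s * q) (s * r)"
proof -
  have "section_integral a b c p q r = ennreal \<bar>s\<bar> * (\<integral>\<^sup>+ t. ennreal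
      (pos_pow (a - 1) (1 + (q - r) * (0 + s * t) / real a) * pos_pow (b - 1) (1 + (r - p) * (0 + s * t) / real b)
        * pos_pow (c - 1) (1 + (p - q) * (0 + s * t) / real c)) \<partial>lborel)"
    unfolding section_integral_def by (rule nn_integral_real_affine[OF _ assms]) measurable
  then show ?thesis unfolding section_integral_def by (simp add: algebra_simps)
qed

lemma section_integral_uminus: "section_integral a b c (- p) (- q) (- r) = section_integral a b c p q r"
  using section_integral_scale[of "-1" a b c p q r] by simp

lemma section_integral_swap: "section_integral b a c q p r = section_integral a b c p q r"
proof -
  have "section_integral b a c q p r = section_integral b a c (- q) (- p) (- r)"
    by (rule section_integral_uminus[symmetric])
  also have "\<dots> = section_integral a b c p q r"
    unfolding section_integral_def by (simp add: algebra_simps)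
  finally show ?thesis .
qed

text \<open>The essential point is that \<open>K\<close> is independent of p and q. The first two
  factors confine t to the interval between their zeros. Once this is mapped to [0,1], all
  dependence on p and q apart from u and v is the factor (1+p)^(-a) (1+q)^(-b), which the kernels
  absorb.\<close>

lemma section_integral_kernel_sum:
  assumes a: "a \<ge> 1" and b: "b \<ge> 1"
  obtains K where "K > 0"
    and "\<And>p q. p > 0 \<Longrightarrow> q > 0 \<Longrightarrow> real a * p + real b * q = real (Suc m) \<Longrightarrow>
      section_integral a b (Suc m) p q (- 1) = ennreal (K * kernel_sum (section_coeff a b m) a b m beta_kernel beta_kernel p q)"
proof
  define M where "M = real a + real b + real (Suc m)"
  have M: "M > 0" by (simp add: M_def)
  define K where "K = M * (M / real a) ^ (a - 1) * (M / real b) ^ (b - 1) * (M / real (Suc m)) ^ m"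
  show "K > 0" unfolding K_def using M a b by simp
  fix p q :: real assume p: "p > 0" and q: "q > 0" and l: "real a * p + real b * q = real (Suc m)"
  define u where "u = p / (1 + p)"
  define v where "v = q / (1 + q)"
  \<comment> \<open>\<open>t0\<close> is the zero of the first factor and \<open>L\<close> the
    distance from it to b/(1+p), the zero of the second. The constraint makes the numerator a (1+p)
    + b (1+q) equal to M.\<close>
  define L where "L = M / ((1 + p) * (1 + q))"
  define t0 where "t0 = - real a / (1 + q)"
  have uv: "u > 0" "v > 0" using p q by (auto simp: u_def v_def)
  have L: "L > 0" using M p q by (simp add: L_def)
  have M_eq: "M = real a * (1 + p) + real b * (1 + q)" using l by (simp add: M_def algebra_simps)
  have s1: "1 + (q - (- 1)) * (t0 + L * t) / real a = (M / real a) * (t / (1 + p))" for t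
  proof -
    have 1: "(1 + q) * t0 = - real a" unfolding t0_def using q by simp
    have 2: "(1 + q) * L = M / (1 + p)" unfolding L_def using p q by (simp add: divide_simps)
    have "(q - (- 1)) * (t0 + L * t) = (1 + q) * t0 + ((1 + q) * L) * t" by (simp add: algebra_simps)
    then have "(q - (- 1)) * (t0 + L * t) / real a = - 1 + (M / (1 + p) * t) / real a"
      unfolding 1 2 using a by (simp add: add_divide_distrib diff_divide_distrib)
    then show ?thesis by simp
  qed
  have s2: "1 + ((- 1) - p) * (t0 + L * t) / real b = (M / real b) * ((1 - t) / (1 + q))" for t
  proof -
    have 1: "(1 + p) * L = M / (1 + q)" unfolding L_def using p q by (simp add: divide_simps)
    have 2: "(1 + p) * t0 = real b - M / (1 + q)"
      unfolding t0_def M_eq using p q by (simp add: divide_simps; simp add: algebra_simps)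
    have "((- 1) - p) * (t0 + L * t) = - ((1 + p) * t0) - ((1 + p) * L) * t" by (simp add: algebra_simps)
    also have "\<dots> = - real b + M / (1 + q) * (1 - t)" unfolding 1 2 by (simp add: right_diff_distrib)
    finally have "((- 1) - p) * (t0 + L * t) / real b = - 1 + (M / (1 + q) * (1 - t)) / real b"
      using b by (simp add: add_divide_distrib diff_divide_distrib)
    then show ?thesis by simp
  qed
  have s3: "1 + (p - q) * (t0 + L * t) / real (Suc m) = (M / real (Suc m)) * (t * u + (1 - t) * v)" for t
  proof -
    have 1: "(p - q) * L = M * (u - v)"
      unfolding L_def u_def v_def using p q by (simp add: divide_simps; simp add: algebra_simps)
    have 2: "real (Suc m) + (p - q) * t0 = M * v"
      unfolding t0_def v_def M_eq l[symmetric] using p q by (simp add: divide_simps; simp add: algebra_simps)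
    have "real (Suc m) + (p - q) * (t0 + L * t) = M * (t * u + (1 - t) * v)"
    proof -
      have "real (Suc m) + (p - q) * (t0 + L * t) = (real (Suc m) + (p - q) * t0) + ((p - q) * L) * t"
        by (simp add: algebra_simps)
      then show ?thesis unfolding 1 2 by (simp add: algebra_simps)
    qed
    then have "(real (Suc m) + (p - q) * (t0 + L * t)) / real (Suc m) = (M / real (Suc m)) * (t * u + (1 - t) * v)"
      by simp
    then show ?thesis by (simp add: add_divide_distrib del: of_nat_Suc)
  qed
  define C where "C = (M / real a) ^ (a - 1) * (M / real b) ^ (b - 1) * (M / real (Suc m)) ^ m
     / ((1 + p) ^ (a - 1) * (1 + q) ^ (b - 1))"
  have C: "C \<ge> 0" unfolding C_def using M p q by simp
  define h where "h = (\<lambda>t::real. C * (t ^ (a - 1) * (1 - t) ^ (b - 1) * (t * u + (1 - t) * v) ^ m))"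
  \<comment> \<open>Outside [0,1] the first or the second base is negative, which kills the product
    even when the exponent is 0. Inside, the third base is positive as a convex combination of u and
    v.\<close>
  have integrand: "pos_pow (a - 1) ((M / real a) * (t / (1 + p))) * pos_pow (b - 1) ((M / real b) * ((1 - t) / (1 + q)))
        * pos_pow (Suc m - 1) ((M / real (Suc m)) * (t * u + (1 - t) * v))
     = indicator {0..1} t * h t" for t
  proof (cases "t \<in> {0..1}")
    case True
    then have "t * u + (1 - t) * v \<ge> 0" using uv by simp
    moreover have "t / (1 + p) \<ge> 0" "(1 - t) / (1 + q) \<ge> 0" using True p q by simp_all
    moreover have "M / real a > 0" "M / real b > 0" "M / real (Suc m) > 0" using M a b by simp_all
    ultimately show ?thesis using True
      by (simp only: pos_pow_mult) (simp add: pos_pow_def h_def C_def power_divide mult_ac)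
  next
    case False
    have "M / real a > 0" "M / real b > 0" using M a b by simp_all
    moreover have "t / (1 + p) < 0 \<or> (1 - t) / (1 + q) < 0"
      using False p q by (auto simp: divide_less_0_iff)
    ultimately show ?thesis using False
      by (simp only: pos_pow_mult) (auto simp: pos_pow_def)
  qed
  have "section_integral a b (Suc m) p q (- 1) = ennreal \<bar>L\<bar> * (\<integral>\<^sup>+ t. ennreal
      (pos_pow (a - 1) (1 + (q - (- 1)) * (t0 + L * t) / real a) * pos_pow (b - 1) (1 + ((- 1) - p) * (t0 + L * t) / real b)
        * pos_pow (Suc m - 1) (1 + (p - q) * (t0 + L * t) / real (Suc m))) \<partial>lborel)"
    unfolding section_integral_def by (rule nn_integral_real_affine) (use L in \<open>measurable, simp\<close>)
  also have "(\<integral>\<^sup>+ t. ennreal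
      (pos_pow (a - 1) (1 + (q - (- 1)) * (t0 + L * t) / real a) * pos_pow (b - 1) (1 + ((- 1) - p) * (t0 + L * t) / real b)
        * pos_pow (Suc m - 1) (1 + (p - q) * (t0 + L * t) / real (Suc m))) \<partial>lborel)
     = (\<integral>\<^sup>+ t. ennreal (indicator {0..1} t * h t) \<partial>lborel)"
    unfolding s1 s2 s3 integrand ..
  also have "\<dots> = ennreal (C * (\<Sum>j\<le>m. section_coeff a b m j * u ^ j * v ^ (m - j)))"
  proof (rule nn_integral_has_integral_lebesgue)
    show "h t \<ge> 0" if "t \<in> {0..1}" for t
      unfolding h_def using that C uv by simp
    have "h = (\<lambda>t. C * (\<Sum>j\<le>m. real (m choose j) * u ^ j * v ^ (m - j)
        * (t ^ (a - 1 + j) * (1 - t) ^ (b - 1 + (m - j)))))"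
      unfolding h_def binomial_ring sum_distrib_left
      by (intro ext sum.cong refl) (simp only: power_mult_distrib power_add mult_ac)
    moreover have "((\<lambda>t. C * (\<Sum>j\<le>m. real (m choose j) * u ^ j * v ^ (m - j)
        * (t ^ (a - 1 + j) * (1 - t) ^ (b - 1 + (m - j))))) has_integral
       C * (\<Sum>j\<le>m. real (m choose j) * u ^ j * v ^ (m - j) * euler_int (a - 1 + j) (b - 1 + (m - j)))) {0..1}"
      by (intro has_integral_mult_right has_integral_sum euler_int_has_integral) auto
    ultimately show "(h has_integral C * (\<Sum>j\<le>m. section_coeff a b m j * u ^ j * v ^ (m - j))) {0..1}"
      by (simp add: section_coeff_def mult_ac)
  qed
  also have "ennreal \<bar>L\<bar> * ennreal (C * (\<Sum>j\<le>m. section_coeff a b m j * u ^ j * v ^ (m - j)))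
     = ennreal (L * C * (\<Sum>j\<le>m. section_coeff a b m j * u ^ j * v ^ (m - j)))"
    using L by (simp add: ennreal_mult'[symmetric] mult.assoc)
  also have "L * C * (\<Sum>j\<le>m. section_coeff a b m j * u ^ j * v ^ (m - j))
     = K * kernel_sum (section_coeff a b m) a b m beta_kernel beta_kernel p q"
  proof -
    have LC: "L * C = K / ((1 + p) ^ a * (1 + q) ^ b)"
    proof -
      have "(1 + p) ^ a = (1 + p) * (1 + p) ^ (a - 1)" "(1 + q) ^ b = (1 + q) * (1 + q) ^ (b - 1)"
        using a b by (simp_all add: power_eq_if)
      then show ?thesis by (simp add: L_def C_def K_def mult_ac)
    qed
    have "L * C * (section_coeff a b m j * u ^ j * v ^ (m - j))
       = K * (section_coeff a b m j * beta_kernel a j p * beta_kernel b (m - j) q)" for j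
      unfolding LC beta_kernel_def u_def v_def by (simp add: power_divide power_add mult_ac)
    then show ?thesis unfolding kernel_sum_def sum_distrib_left by (rule sum.cong[OF refl])
  qed
  finally show "section_integral a b (Suc m) p q (- 1) = ennreal (K * kernel_sum (section_coeff a b m) a b m beta_kernel beta_kernel p q)" .
qed

section \<open>Reduction to one sign pattern by symmetry\<close>

definition section_improvable :: "nat \<Rightarrow> nat \<Rightarrow> nat \<Rightarrow> real \<Rightarrow> real \<Rightarrow> real \<Rightarrow> bool" where
  "section_improvable a b c p q r \<longleftrightarrow> (\<exists>p' q' r'. block_constraints a b c p' q' r' \<and>
     section_integral a b c p' q' r' < section_integral a b c p q r)"

lemma section_improvable_rotate: "section_improvable b c a q r p \<longleftrightarrow> section_improvable a b c p q r"
proof -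
  have "block_constraints b c a q' r' p' \<longleftrightarrow> block_constraints a b c p' q' r'" for p' q' r'
    by (auto simp: block_constraints_def algebra_simps)
  then show ?thesis unfolding section_improvable_def
    using section_integral_rotate by (smt (verit))
qed

lemma section_improvable_swap: "section_improvable b a c q p r \<longleftrightarrow> section_improvable a b c p q r"
proof -
  have "block_constraints b a c q' p' r' \<longleftrightarrow> block_constraints a b c p' q' r'" for p' q' r'
    by (auto simp: block_constraints_def algebra_simps)
  then show ?thesis unfolding section_improvable_def
    using section_integral_swap by (smt (verit))
qed

lemma section_improvable_uminus: "section_improvable a b c (- p) (- q) (- r) \<longleftrightarrow> section_improvable a b c p q r"
  by (simp add: section_improvable_def section_integral_uminus)

text \<open>A triple (p, q, -1) on the constraint line, divided by sqrt N, is admissible and has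
  integral K sqrt N f. So comparing N f^2 on the line is comparing section integrals in the
  family.\<close>

lemma section_improvable_sector:
  assumes "a \<ge> 1" "b \<ge> 1" "c \<ge> 1" and bc: "block_constraints a b c p q r"
    and pq: "q < p" "0 < q" "r < 0"
  shows "section_improvable a b c p q r"
proof -
  obtain m where c: "c = Suc m" using assms(3) by (cases c) auto
  obtain K where K: "K > 0" and sec: "\<And>p q. p > 0 \<Longrightarrow> q > 0 \<Longrightarrow> real a * p + real b * q = real (Suc m) \<Longrightarrow>
      section_integral a b (Suc m) p q (- 1) = ennreal (K * kernel_sum (section_coeff a b m) a b m beta_kernel beta_kernel p q)"
    using section_integral_kernel_sum[OF assms(1,2)] by blast
  define f where "f = kernel_sum (section_coeff a b m) a b m beta_kernel beta_kernel"
  define N where "N = (\<lambda>p q. real a * p\<^sup>2 + real b * q\<^sup>2 + real (Suc m))"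
  have N: "N p q > 0" for p q by (simp add: N_def add_nonneg_pos)
  have fpos: "f p q \<ge> 0" if "p > 0" "q > 0" for p q
    unfolding f_def kernel_sum_def
    by (intro sum_nonneg mult_nonneg_nonneg less_imp_le[OF beta_kernel_pos] less_imp_le[OF section_coeff_pos] that) auto
  have val: "block_constraints a b c (p / sqrt (N p q)) (q / sqrt (N p q)) (- 1 / sqrt (N p q)) \<and>
      section_integral a b c (p / sqrt (N p q)) (q / sqrt (N p q)) (- 1 / sqrt (N p q))
        = ennreal (K * (sqrt (N p q) * f p q))"
    if "p > 0" "q > 0" "real a * p + real b * q = real (Suc m)" for p q
  proof
    define s where "s = sqrt (N p q)"
    have s: "s > 0" and s2: "s\<^sup>2 = N p q" using N[of p q] by (simp_all add: s_def)
    have "real a * (p / s) + real b * (q / s) + real c * (- 1 / s) = (real a * p + real b * q - real c) / s"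
      by (simp add: add_divide_distrib diff_divide_distrib)
    moreover have "real a * (p / s)\<^sup>2 + real b * (q / s)\<^sup>2 + real c * (- 1 / s)\<^sup>2 = N p q / s\<^sup>2"
      by (simp add: N_def c power_divide add_divide_distrib del: of_nat_Suc)
    ultimately show "block_constraints a b c (p / s) (q / s) (- 1 / s)"
      using that(3) s s2 N[of p q] by (simp add: block_constraints_def c)
    have "section_integral a b c (p / s) (q / s) (- 1 / s)
        = ennreal s * section_integral a b c (s * (p / s)) (s * (q / s)) (s * (- 1 / s))"
      using section_integral_scale[of s a b c "p / s" "q / s" "- 1 / s"] s by (simp only: abs_of_pos)
    also have "\<dots> = ennreal s * ennreal (K * f p q)"
      using s sec[OF that] by (simp add: c f_def)
    also have "\<dots> = ennreal (K * (s * f p q))"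
      using s K fpos[OF that(1,2)] by (simp add: ennreal_mult'[symmetric] mult_ac)
    finally show "section_integral a b c (p / s) (q / s) (- 1 / s) = ennreal (K * (s * f p q))" .
  qed
  define s where "s = - r"
  have s: "s > 0" using pq by (simp add: s_def)
  define p0 where "p0 = p / s"
  define q0 where "q0 = q / s"
  have l: "real a * p + real b * q = s * real (Suc m)" and n: "real a * p\<^sup>2 + real b * q\<^sup>2 + real (Suc m) * s\<^sup>2 = 1"
    using bc by (simp_all add: block_constraints_def s_def c algebra_simps)
  have l0: "real a * p0 + real b * q0 = real (Suc m)"
  proof -
    have "real a * p0 + real b * q0 = (real a * p + real b * q) / s"
      by (simp add: p0_def q0_def add_divide_distrib)
    then show ?thesis unfolding l using s by simp
  qed
  have N0: "sqrt (N p0 q0) = 1 / s"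
  proof -
    have "N p0 q0 = (real a * p\<^sup>2 + real b * q\<^sup>2 + real (Suc m) * s\<^sup>2) / s\<^sup>2"
      using s by (simp add: N_def p0_def q0_def power_divide add_divide_distrib del: of_nat_Suc)
    then have "N p0 q0 = (1 / s)\<^sup>2" unfolding n by (simp add: power_divide)
    then show ?thesis using s by simp
  qed
  have pq0: "q0 < p0" "0 < q0" "0 < p0" using pq s by (auto simp: p0_def q0_def divide_strict_right_mono)
  have old: "section_integral a b c p q r = ennreal (K * (sqrt (N p0 q0) * f p0 q0))"
    using val[OF pq0(3,2) l0] s unfolding N0 by (simp add: p0_def q0_def s_def)
  obtain p1 q1 where 1: "p1 > 0" "q1 > 0" "real a * p1 + real b * q1 = real (Suc m)"
    and less: "N p1 q1 * (f p1 q1)\<^sup>2 < N p0 q0 * (f p0 q0)\<^sup>2"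
    using weighted_section_not_minimal[OF assms(1,2) section_coeff_pos section_coeff_rec[OF assms(1,2)] l0 pq0(2,1)]
    unfolding N_def f_def by blast
  have "(sqrt (N p1 q1) * f p1 q1)\<^sup>2 < (sqrt (N p0 q0) * f p0 q0)\<^sup>2"
    using less N[THEN less_imp_le] by (simp add: power_mult_distrib)
  moreover have "sqrt (N p0 q0) * f p0 q0 \<ge> 0" using fpos[OF pq0(3,2)] N[THEN less_imp_le] by simp
  ultimately have "sqrt (N p1 q1) * f p1 q1 < sqrt (N p0 q0) * f p0 q0" by (rule power_less_imp_less_base)
  moreover have "sqrt (N p1 q1) * f p1 q1 \<ge> 0" using fpos[OF 1(1,2)] N[THEN less_imp_le] by simp
  ultimately have "ennreal (K * (sqrt (N p1 q1) * f p1 q1)) < ennreal (K * (sqrt (N p0 q0) * f p0 q0))"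
    using K by (intro ennreal_lessI) auto
  then show ?thesis unfolding section_improvable_def using val[OF 1] old by metis
qed

text \<open>Two of three nonzero reals share a sign. Rotation puts them first, negation makes them
  positive, a swap orders them, and the zero-sum condition makes the third one negative.\<close>

theorem section_improvable_generic:
  assumes "a \<ge> 1" "b \<ge> 1" "c \<ge> 1" and bc: "block_constraints a b c p q r"
    and nz: "p \<noteq> 0" "q \<noteq> 0" "r \<noteq> 0" and ne: "p \<noteq> q" "q \<noteq> r" "p \<noteq> r"
  shows "section_improvable a b c p q r"
proof -
  have pos_case: "section_improvable a b c p q r"
    if "a \<ge> 1" "b \<ge> 1" "c \<ge> 1" "block_constraints a b c p q r" "p \<noteq> q" "p > 0" "q > 0" for a b c p q r
  proof -
    have "real a * p > 0" "real b * q > 0" using that by simp_all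
    then have "real c * r < 0" using that(4) by (simp add: block_constraints_def)
    then have "r < 0" using that(3) by (simp add: mult_less_0_iff)
    show ?thesis
    proof (cases "q < p")
      case True
      then show ?thesis using section_improvable_sector that \<open>r < 0\<close> by blast
    next
      case False
      have "block_constraints b a c q p r" using that(4) by (auto simp: block_constraints_def algebra_simps)
      then have "section_improvable b a c q p r"
        using section_improvable_sector[of b a c q p r] that False \<open>r < 0\<close> by simp
      then show ?thesis by (simp only: section_improvable_swap)
    qed
  qed
  have same_sign: "section_improvable a b c p q r"
    if "a \<ge> 1" "b \<ge> 1" "c \<ge> 1" "block_constraints a b c p q r" "p \<noteq> q" "p * q > 0" for a b c p q r
  proof (cases "p > 0")
    case True
    then show ?thesis using pos_case that by (simp add: zero_less_mult_iff)
  next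
    case False
    then have "- p > 0" "- q > 0" using that by (auto simp: zero_less_mult_iff)
    moreover have "block_constraints a b c (- p) (- q) (- r)" using that(4) by (simp add: block_constraints_def)
    ultimately have "section_improvable a b c (- p) (- q) (- r)" using pos_case that by simp
    then show ?thesis by (simp only: section_improvable_uminus)
  qed
  consider (pq) "p * q > 0" | (qr) "q * r > 0" | (rp) "r * p > 0"
    using nz by (auto simp: zero_less_mult_iff linorder_neq_iff)
  then show ?thesis
  proof cases
    case pq
    then show ?thesis using same_sign assms by blast
  next
    case qr
    have "block_constraints b c a q r p" using bc by (auto simp: block_constraints_def algebra_simps)
    then have "section_improvable b c a q r p" using same_sign[of b c a q r p] qr assms by blast
    then show ?thesis by (simp only: section_improvable_rotate)
  next
    case rp
    have "block_constraints c a b r p q" using bc by (auto simp: block_constraints_def algebra_simps)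
    then have "section_improvable c a b r p q" using same_sign[of c a b r p q] rp assms by blast
    then show ?thesis using section_improvable_rotate by blast
  qed
qed

section \<open>Lebesgue measure in orthonormal coordinates\<close>

text \<open>The library has invariance under orthogonal maps only for index types of class
  \<open>wellorder\<close>. For general Euclidean spaces it follows from uniqueness of translation invariant measures.\<close>

lemma translation_invariant_swap:
  fixes \<mu> \<nu> :: "'a::euclidean_space measure"
  assumes sf: "sigma_finite_measure \<mu>" "sigma_finite_measure \<nu>"
    and sets: "sets \<mu> = sets borel" "sets \<nu> = sets borel"
    and ti: "\<And>a. distr \<mu> borel ((+) a) = \<mu>" "\<And>a. distr \<nu> borel ((+) a) = \<nu>"
    and [measurable]: "f \<in> borel_measurable borel" "g \<in> borel_measurable borel"
  shows "(\<integral>\<^sup>+ x. f x \<partial>\<mu>) * (\<integral>\<^sup>+ y. g y \<partial>\<nu>) = (\<integral>\<^sup>+ x. g x \<partial>\<mu>) * (\<integral>\<^sup>+ y. f (- y) \<partial>\<nu>)"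
proof -
  interpret pair_sigma_finite \<mu> \<nu> using sf by (simp add: pair_sigma_finite_def)
  have [measurable_cong]: "sets \<mu> = sets borel" "sets \<nu> = sets borel" by fact+
  have tr\<mu>: "(\<integral>\<^sup>+ x. h (a + x) \<partial>\<mu>) = (\<integral>\<^sup>+ x. h x \<partial>\<mu>)" if [measurable]: "h \<in> borel_measurable borel" for h a
    by (subst (2) ti(1)[of a, symmetric], subst nn_integral_distr) auto
  have tr\<nu>: "(\<integral>\<^sup>+ x. h (a + x) \<partial>\<nu>) = (\<integral>\<^sup>+ x. h x \<partial>\<nu>)" if [measurable]: "h \<in> borel_measurable borel" for h a
    by (subst (2) ti(2)[of a, symmetric], subst nn_integral_distr) auto
  \<comment> \<open>Shift y by x, exchange the integrals, shift x by -y, exchange back, shift y by x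
    once more. Each shift uses invariance of one of the two measures.\<close>
  have "(\<integral>\<^sup>+ x. f x \<partial>\<mu>) * (\<integral>\<^sup>+ y. g y \<partial>\<nu>) = (\<integral>\<^sup>+ x. f x * (\<integral>\<^sup>+ y. g (x + y) \<partial>\<nu>) \<partial>\<mu>)"
    by (simp add: tr\<nu> nn_integral_multc)
  also have "\<dots> = (\<integral>\<^sup>+ x. \<integral>\<^sup>+ y. f x * g (x + y) \<partial>\<nu> \<partial>\<mu>)"
    by (simp add: nn_integral_cmult)
  also have "\<dots> = (\<integral>\<^sup>+ y. \<integral>\<^sup>+ x. f x * g (x + y) \<partial>\<mu> \<partial>\<nu>)"
    by (rule Fubini'[symmetric]) measurable
  also have "\<dots> = (\<integral>\<^sup>+ y. \<integral>\<^sup>+ x. f (- y + x) * g x \<partial>\<mu> \<partial>\<nu>)"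
  proof (rule nn_integral_cong)
    fix y
    show "(\<integral>\<^sup>+ x. f x * g (x + y) \<partial>\<mu>) = (\<integral>\<^sup>+ x. f (- y + x) * g x \<partial>\<mu>)"
      using tr\<mu>[of "\<lambda>x. f (- y + x) * g x" y] by (simp add: add.commute)
  qed
  also have "\<dots> = (\<integral>\<^sup>+ x. \<integral>\<^sup>+ y. f (- y + x) * g x \<partial>\<nu> \<partial>\<mu>)"
    by (rule Fubini') measurable
  also have "\<dots> = (\<integral>\<^sup>+ x. g x * (\<integral>\<^sup>+ y. f (- y + x) \<partial>\<nu>) \<partial>\<mu>)"
    by (subst nn_integral_multc) (auto simp: mult.commute)
  also have "\<dots> = (\<integral>\<^sup>+ x. g x * (\<integral>\<^sup>+ y. f (- y) \<partial>\<nu>) \<partial>\<mu>)"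
  proof (rule nn_integral_cong)
    fix x
    show "g x * (\<integral>\<^sup>+ y. f (- y + x) \<partial>\<nu>) = g x * (\<integral>\<^sup>+ y. f (- y) \<partial>\<nu>)"
      using tr\<nu>[of "\<lambda>y. f (- y + x)" x] by simp
  qed
  also have "\<dots> = (\<integral>\<^sup>+ x. g x \<partial>\<mu>) * (\<integral>\<^sup>+ y. f (- y) \<partial>\<nu>)"
    by (rule nn_integral_multc) measurable
  finally show ?thesis .
qed

text \<open>The image measure is again translation invariant, as T is linear and onto. It agrees
  with Lebesgue measure on the unit ball, which T preserves and whose measure is positive and
  finite.\<close>

lemma distr_orthogonal_transformation:
  fixes T :: "'a::euclidean_space \<Rightarrow> 'a"
  assumes T: "orthogonal_transformation T"
  shows "distr lborel borel T = lborel"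
proof -
  have lin: "linear T" using T by (rule orthogonal_transformation_linear)
  have [measurable]: "T \<in> borel_measurable borel"
    using linear_continuous_on[OF lin[unfolded linear_conv_bounded_linear], of UNIV]
    by (rule borel_measurable_continuous_onI)
  define \<mu> where "\<mu> = distr lborel borel T"
  define S where "S = inv T"
  have S: "orthogonal_transformation S" unfolding S_def using T by (rule orthogonal_transformation_inv)
  have TS: "T (S x) = x" for x
    unfolding S_def using orthogonal_transformation_surj[OF T] by (simp add: surj_f_inv_f)
  have [measurable]: "S \<in> borel_measurable borel"
    using linear_continuous_on[OF orthogonal_transformation_linear[OF S, unfolded linear_conv_bounded_linear], of UNIV]
    by (rule borel_measurable_continuous_onI)
  have ti\<mu>: "distr \<mu> borel ((+) a) = \<mu>" for a
  proof -
    have "distr \<mu> borel ((+) a) = distr lborel borel (\<lambda>x. T (S a + x))"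
      unfolding \<mu>_def by (subst distr_distr) (auto simp: comp_def linear_add[OF lin] TS)
    also have "\<dots> = distr (distr lborel borel ((+) (S a))) borel T"
      by (subst distr_distr) (auto simp: comp_def)
    finally show ?thesis unfolding \<mu>_def by (simp add: lborel_distr_plus)
  qed
  have ball: "T -` ball 0 1 = ball 0 1"
    using orthogonal_transformation_norm[OF T] by auto
  have "unit_ball_vol (real DIM('a)) \<noteq> 0"
    using unit_ball_vol_pos[of "real DIM('a)"] by linarith
  then have fin: "emeasure lborel (ball (0::'a) 1) \<noteq> top" "emeasure lborel (ball (0::'a) 1) \<noteq> 0"
    by (simp_all add: emeasure_ball)
  \<comment> \<open>Sigma-finiteness of \<mu> is inherited from its image under S, which is Lebesgue
    measure.\<close>
  have "distr \<mu> borel S = lborel"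
  proof -
    have "S (T x) = x" for x
      unfolding S_def using orthogonal_transformation_inj[OF T] by simp
    then show ?thesis unfolding \<mu>_def by (subst distr_distr) (auto simp: comp_def distr_id2)
  qed
  then have sf: "sigma_finite_measure \<mu>"
    by (intro sigma_finite_measure_distr[of \<mu> borel S]) (auto simp: \<mu>_def lborel.sigma_finite_measure_axioms)
  have ball\<mu>: "emeasure \<mu> (ball 0 1) = emeasure lborel (ball (0::'a) 1)"
    unfolding \<mu>_def using ball by (subst emeasure_distr) auto
  note swap = translation_invariant_swap[of _ "lborel :: 'a measure", OF _ lborel.sigma_finite_measure_axioms _ _ _ lborel_distr_plus]
  \<comment> \<open>The exchange formula compares \<mu> on A with Lebesgue measure on the reflected
    set. Applying it to the image measure and to Lebesgue measure itself removes the
    reflection.\<close>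
  have eq: "emeasure \<mu> A = emeasure lborel (uminus -` A)" if "A \<in> sets borel" and
    \<mu>: "sigma_finite_measure \<mu>" "sets \<mu> = sets borel" "\<And>a. distr \<mu> borel ((+) a) = \<mu>"
      "emeasure \<mu> (ball 0 1) = emeasure lborel (ball (0::'a) 1)" for A and \<mu> :: "'a measure"
  proof -
    have [measurable]: "A \<in> sets borel" by fact
    have [measurable_cong]: "sets \<mu> = sets borel" by fact
    have "emeasure \<mu> A * emeasure lborel (ball (0::'a) 1) = emeasure \<mu> (ball 0 1) * (\<integral>\<^sup>+ y. indicator A (- y) \<partial>lborel)"
    proof -
      have "(indicator A :: 'a \<Rightarrow> ennreal) \<in> borel_measurable borel"
        "(indicator (ball 0 1) :: 'a \<Rightarrow> ennreal) \<in> borel_measurable borel"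
        by (auto intro!: borel_measurable_indicator)
      from swap[OF \<mu>(1,2) sets_lborel \<mu>(3) this] show ?thesis by (simp add: \<mu>(2))
    qed
    also have "(\<integral>\<^sup>+ y. indicator A (- y) \<partial>lborel) = (\<integral>\<^sup>+ y. indicator (uminus -` A) y \<partial>lborel)"
      by (intro nn_integral_cong) (auto simp: indicator_def)
    also have "\<dots> = emeasure lborel (uminus -` A)"
    proof -
      have "(uminus :: 'a \<Rightarrow> 'a) \<in> borel_measurable borel" by measurable
      from measurable_sets[OF this that(1)] show ?thesis by simp
    qed
    finally have "emeasure lborel (ball (0::'a) 1) * emeasure \<mu> A = emeasure lborel (ball (0::'a) 1) * emeasure lborel (uminus -` A)"
      unfolding \<mu>(4) by (simp only: mult.commute)
    then show ?thesis using fin by (simp add: ennreal_mult_cancel_left)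
  qed
  show ?thesis
  proof (rule measure_eqI)
    show "sets (distr lborel borel T) = sets (lborel :: 'a measure)" by simp
    fix A assume "A \<in> sets (distr lborel borel T)"
    then have A: "A \<in> sets borel" by simp
    have "emeasure \<mu> A = emeasure lborel (uminus -` A)"
      by (rule eq[OF A sf _ ti\<mu> ball\<mu>]) (simp add: \<mu>_def)
    moreover have "emeasure lborel A = emeasure lborel (uminus -` A)"
      by (rule eq[OF A lborel.sigma_finite_measure_axioms _ lborel_distr_plus]) auto
    ultimately show "emeasure (distr lborel borel T) A = emeasure lborel A" by (simp add: \<mu>_def)
  qed
qed

interpretation lborel_PiM: product_sigma_finite "\<lambda>_. lborel :: real measure"
  by standard

lemma distr_PiM_lborel_reindex:
  assumes f: "bij_betw f J I" and I: "finite I"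
  shows "distr (PiM I (\<lambda>_. lborel :: real measure)) (PiM J (\<lambda>_. lborel)) (\<lambda>\<omega>. \<lambda>j\<in>J. \<omega> (f j))
    = PiM J (\<lambda>_. lborel)"
proof (rule lborel_PiM.PiM_eqI)
  show J: "finite J" using f I bij_betw_finite by blast
  fix A :: "'a \<Rightarrow> real set" assume A: "\<And>j. j \<in> J \<Longrightarrow> A j \<in> sets lborel"
  define g where "g = the_inv_into J f"
  have fI: "f j \<in> I" if "j \<in> J" for j using f that by (auto simp: bij_betw_def)
  have gf: "g (f j) = j" if "j \<in> J" for j
    unfolding g_def using f that by (simp add: bij_betw_def the_inv_into_f_f)
  have meas: "(\<lambda>\<omega>. \<lambda>j\<in>J. \<omega> (f j)) \<in> PiM I (\<lambda>_. lborel :: real measure) \<rightarrow>\<^sub>M PiM J (\<lambda>_. lborel)"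
    using fI by (intro measurable_restrict measurable_component_singleton) auto
  have "(\<lambda>\<omega>. \<lambda>j\<in>J. \<omega> (f j)) -` (Pi\<^sub>E J A) \<inter> space (PiM I (\<lambda>_. lborel)) = (Pi\<^sub>E I (\<lambda>i. A (g i)))"
  proof (intro set_eqI iffI)
    fix x assume x: "x \<in> (\<lambda>\<omega>. \<lambda>j\<in>J. \<omega> (f j)) -` (Pi\<^sub>E J A) \<inter> space (PiM I (\<lambda>_. lborel))"
    then have A: "x (f j) \<in> A j" if "j \<in> J" for j using that by (auto simp: PiE_iff)
    have "x i \<in> A (g i)" if i: "i \<in> I" for i
    proof -
      obtain j where "j \<in> J" "i = f j" using f i by (auto simp: bij_betw_def)
      then show ?thesis using A gf by simp
    qed
    then show "x \<in> Pi\<^sub>E I (\<lambda>i. A (g i))" using x by (simp add: PiE_iff space_PiM)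
  next
    fix x assume x: "x \<in> Pi\<^sub>E I (\<lambda>i. A (g i))"
    then have "x (f j) \<in> A j" if "j \<in> J" for j using fI[OF that] gf[OF that] that by (metis PiE_mem)
    with x show "x \<in> (\<lambda>\<omega>. \<lambda>j\<in>J. \<omega> (f j)) -` (Pi\<^sub>E J A) \<inter> space (PiM I (\<lambda>_. lborel))"
      by (simp add: PiE_iff space_PiM)
  qed
  moreover have "emeasure (PiM I (\<lambda>_. lborel :: real measure)) (Pi\<^sub>E I (\<lambda>i. A (g i))) = (\<Prod>i\<in>I. emeasure lborel (A (g i)))"
  proof (rule lborel_PiM.emeasure_PiM[OF I])
    fix i assume "i \<in> I"
    then have "g i \<in> J" using f by (auto simp: g_def bij_betw_def intro: the_inv_into_into)
    then show "A (g i) \<in> sets lborel" by (rule A)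
  qed
  moreover have "(\<Prod>i\<in>I. emeasure lborel (A (g i))) = (\<Prod>j\<in>J. emeasure lborel (A j))"
    using prod.reindex_bij_betw[OF f, of "\<lambda>i. emeasure lborel (A (g i))"] gf by simp
  ultimately show "emeasure (distr (PiM I (\<lambda>_. lborel)) (PiM J (\<lambda>_. lborel)) (\<lambda>\<omega>. \<lambda>j\<in>J. \<omega> (f j))) (Pi\<^sub>E J A)
      = (\<Prod>j\<in>J. emeasure lborel (A j))"
    using A J by (subst emeasure_distr[OF meas]) (auto intro!: sets_PiM_I_finite)
qed simp

definition orthonormal_on :: "'i set \<Rightarrow> ('i \<Rightarrow> 'a::real_inner) \<Rightarrow> bool" where
  "orthonormal_on I b \<longleftrightarrow> (\<forall>i\<in>I. \<forall>j\<in>I. b i \<bullet> b j = (if i = j then 1 else 0))"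

lemma orthonormal_onD: "orthonormal_on I b \<Longrightarrow> i \<in> I \<Longrightarrow> j \<in> I \<Longrightarrow> b i \<bullet> b j = (if i = j then 1 else 0)"
  by (simp add: orthonormal_on_def)

lemma orthonormal_on_inner_sum:
  assumes "orthonormal_on I b" "finite I" "J \<subseteq> I" "i \<in> I"
  shows "(\<Sum>j\<in>J. t j *\<^sub>R b j) \<bullet> b i = (if i \<in> J then t i else 0)"
proof -
  have "(\<Sum>j\<in>J. t j *\<^sub>R b j) \<bullet> b i = (\<Sum>j\<in>J. if i = j then t j else 0)"
    unfolding inner_sum_left
    by (intro sum.cong) (use assms in \<open>auto simp: orthonormal_on_def subset_iff\<close>)
  moreover have "finite J" using assms finite_subset by blast
  ultimately show ?thesis by simp
qed

text \<open>Matching the standard basis with \<open>I\<close> makes the coordinate map a relabelling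
  followed by an orthogonal map and a translation, each of which preserves Lebesgue measure.\<close>

lemma distr_orthonormal_basis:
  fixes b :: "'i \<Rightarrow> 'a::euclidean_space"
  assumes b: "orthonormal_on I b" and I: "finite I" and card: "card I = DIM('a)"
  shows "distr (PiM I (\<lambda>_. lborel)) borel (\<lambda>t. c + (\<Sum>i\<in>I. t i *\<^sub>R b i)) = lborel"
proof -
  obtain \<pi> where \<pi>: "bij_betw \<pi> (Basis :: 'a set) I"
    using I card by (metis finite_Basis bij_betw_iff_card)
  have \<pi>I: "\<pi> e \<in> I" if "e \<in> Basis" for e using \<pi> that by (auto simp: bij_betw_def)
  have \<pi>inj: "\<pi> e = \<pi> e' \<longleftrightarrow> e = e'" if "e \<in> Basis" "e' \<in> Basis" for e e'
    using \<pi> that by (auto simp: bij_betw_def inj_on_def)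
  define T where "T = (\<lambda>x::'a. \<Sum>e\<in>Basis. (x \<bullet> e) *\<^sub>R b (\<pi> e))"
  have lin: "linear T"
    unfolding T_def
    by (rule linearI) (auto simp: inner_left_distrib scaleR_add_left sum.distrib scaleR_right.sum)
  have "T x \<bullet> T y = x \<bullet> y" for x y
  proof -
    have "orthonormal_on Basis (\<lambda>e. b (\<pi> e))"
      by (simp add: orthonormal_on_def orthonormal_onD[OF b] \<pi>I \<pi>inj)
    from orthonormal_on_inner_sum[OF this finite_Basis subset_refl, of _ "\<lambda>e. x \<bullet> e"]
    have Tb: "T x \<bullet> b (\<pi> e) = x \<bullet> e" if "e \<in> Basis" for e
      using that by (simp add: T_def)
    have "T x \<bullet> T y = (\<Sum>e\<in>Basis. (y \<bullet> e) * (T x \<bullet> b (\<pi> e)))"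
      by (subst (2) T_def) (simp add: inner_sum_right)
    also have "\<dots> = (\<Sum>e\<in>Basis. (x \<bullet> e) * (y \<bullet> e))"
      by (intro sum.cong) (simp_all add: Tb)
    also have "\<dots> = x \<bullet> y" by (rule euclidean_inner[symmetric])
    finally show ?thesis .
  qed
  then have T: "orthogonal_transformation T" using lin by (simp add: orthogonal_transformation_def)
  have [measurable]: "T \<in> borel_measurable borel"
    using linear_continuous_on[OF lin[unfolded linear_conv_bounded_linear], of UNIV]
    by (rule borel_measurable_continuous_onI)
  let ?PB = "PiM (Basis :: 'a set) (\<lambda>_. lborel :: real measure)"
  let ?PI = "PiM I (\<lambda>_. lborel :: real measure)"
  have m1: "(\<lambda>f. \<Sum>e\<in>Basis. f e *\<^sub>R e) \<in> ?PB \<rightarrow>\<^sub>M (borel :: 'a measure)" by measurable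
  have m2: "(\<lambda>\<omega>. \<lambda>e\<in>Basis. \<omega> (\<pi> e)) \<in> ?PI \<rightarrow>\<^sub>M ?PB"
    using \<pi>I by (intro measurable_restrict measurable_component_singleton) auto
  have "lborel = distr (distr lborel borel T) borel ((+) c)"
    by (simp add: distr_orthogonal_transformation[OF T] lborel_distr_plus)
  also have "\<dots> = distr lborel borel (\<lambda>x. c + T x)"
    by (subst distr_distr) (auto simp: comp_def)
  also have "\<dots> = distr (distr (distr ?PI ?PB (\<lambda>\<omega>. \<lambda>e\<in>Basis. \<omega> (\<pi> e))) borel (\<lambda>f. \<Sum>e\<in>Basis. f e *\<^sub>R e)) borel (\<lambda>x. c + T x)"
    by (simp add: distr_PiM_lborel_reindex[OF \<pi> I] lborel_eq[symmetric])
  also have "\<dots> = distr ?PI borel (\<lambda>\<omega>. c + T (\<Sum>e\<in>Basis. (\<lambda>e\<in>Basis. \<omega> (\<pi> e)) e *\<^sub>R e))"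
    by (subst distr_distr[OF m1 m2], subst distr_distr) (use measurable_comp[OF m2 m1] in \<open>auto simp: comp_def\<close>)
  also have "(\<lambda>\<omega>. c + T (\<Sum>e\<in>Basis. (\<lambda>e\<in>Basis. \<omega> (\<pi> e)) e *\<^sub>R e)) = (\<lambda>\<omega>. c + (\<Sum>i\<in>I. \<omega> i *\<^sub>R b i))"
  proof
    fix \<omega> :: "'i \<Rightarrow> real"
    have "T (\<Sum>e\<in>Basis. (\<lambda>e\<in>Basis. \<omega> (\<pi> e)) e *\<^sub>R e) = (\<Sum>e\<in>Basis. \<omega> (\<pi> e) *\<^sub>R b (\<pi> e))"
      unfolding T_def by (intro sum.cong) (auto simp: inner_sum_left inner_Basis sum.delta if_distrib cong: if_cong)
    then show "c + T (\<Sum>e\<in>Basis. (\<lambda>e\<in>Basis. \<omega> (\<pi> e)) e *\<^sub>R e) = c + (\<Sum>i\<in>I. \<omega> i *\<^sub>R b i)"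
      using sum.reindex_bij_betw[OF \<pi>, of "\<lambda>i. \<omega> i *\<^sub>R b i"] by simp
  qed
  finally show ?thesis by simp
qed

section \<open>Flat volume by thickening\<close>

text \<open>Thickening turns volumes in a flat of codimension two, whatever frame computes them, into
  full-dimensional Lebesgue measure.\<close>

definition thickened :: "'a::real_vector set \<Rightarrow> 'a \<Rightarrow> 'a \<Rightarrow> 'a set" where
  "thickened S u v = (\<lambda>(s, y, z). s + y *\<^sub>R u + z *\<^sub>R v) ` (S \<times> {0..1::real} \<times> {0..1::real})"

lemma compact_thickened:
  fixes S :: "'a::euclidean_space set"
  shows "compact S \<Longrightarrow> compact (thickened S u v)"
  unfolding thickened_def
  by (intro compact_continuous_image compact_Times continuous_intros)
     (auto intro!: continuous_intros simp: case_prod_unfold)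

text \<open>In coordinates along all of b the thickened set is a product of S with two unit
  intervals; integrating out the coordinates \<open>i1\<close> and \<open>i2\<close> contributes a
  factor 1 each.\<close>

lemma emeasure_thickened:
  fixes b :: "'i \<Rightarrow> 'a::euclidean_space"
  assumes b: "orthonormal_on (insert i1 (insert i2 I)) b" and I: "finite I" "i1 \<notin> I" "i2 \<notin> I" "i1 \<noteq> i2"
    and card: "card I + 2 = DIM('a)" and S: "compact S"
    and sub: "\<And>s. s \<in> S \<Longrightarrow> \<exists>t. s = c + (\<Sum>i\<in>I. t i *\<^sub>R b i)"
  shows "emeasure (PiM I (\<lambda>_. lborel)) {t \<in> I \<rightarrow>\<^sub>E UNIV. c + (\<Sum>i\<in>I. t i *\<^sub>R b i) \<in> S}
    = emeasure lborel (thickened S (b i1) (b i2))"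
proof -
  define J where "J = insert i1 (insert i2 I)"
  define T where "T = thickened S (b i1) (b i2)"
  define k where "k = (\<lambda>t. indicator S (c + (\<Sum>i\<in>I. t i *\<^sub>R b i)) :: ennreal)"
  have bJ: "orthonormal_on J b" using b by (simp add: J_def)
  have finJ: "finite J" using I by (simp add: J_def)
  have [measurable]: "S \<in> sets borel" "T \<in> sets borel"
    using S compact_thickened[OF S] by (auto simp: T_def intro: borel_compact)
  have k_meas: "k \<in> borel_measurable (PiM K (\<lambda>_. lborel))" if "I \<subseteq> K" for K
  proof -
    have [measurable]: "(\<lambda>t. t i) \<in> PiM K (\<lambda>_. lborel :: real measure) \<rightarrow>\<^sub>M borel" if "i \<in> I" for i
      using that \<open>I \<subseteq> K\<close> measurable_component_singleton[of i K "\<lambda>_. lborel :: real measure"] by auto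
    show ?thesis unfolding k_def by measurable
  qed
  have sumJ: "(\<Sum>i\<in>J. t i *\<^sub>R b i) = t i1 *\<^sub>R b i1 + t i2 *\<^sub>R b i2 + (\<Sum>i\<in>I. t i *\<^sub>R b i)" for t :: "'i \<Rightarrow> real"
    unfolding J_def using I by (simp add: add.assoc)
  have mem: "c + (\<Sum>i\<in>J. t i *\<^sub>R b i) \<in> T \<longleftrightarrow> t i1 \<in> {0..1} \<and> t i2 \<in> {0..1} \<and> c + (\<Sum>i\<in>I. t i *\<^sub>R b i) \<in> S"
    for t :: "'i \<Rightarrow> real"
  proof
    assume "c + (\<Sum>i\<in>J. t i *\<^sub>R b i) \<in> T"
    then obtain s y z where s: "s \<in> S" and yz: "y \<in> {0..1}" "z \<in> {0..1}"
      and eq: "c + (\<Sum>i\<in>J. t i *\<^sub>R b i) = s + y *\<^sub>R b i1 + z *\<^sub>R b i2"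
      by (auto simp: T_def thickened_def)
    obtain w where w: "s = c + (\<Sum>i\<in>I. w i *\<^sub>R b i)" using sub[OF s] by blast
    define w' where "w' = w(i1 := y, i2 := z)"
    have "(\<Sum>i\<in>I. w' i *\<^sub>R b i) = (\<Sum>i\<in>I. w i *\<^sub>R b i)"
      using I by (intro sum.cong) (auto simp: w'_def)
    then have "(\<Sum>i\<in>J. t i *\<^sub>R b i) = (\<Sum>i\<in>J. w' i *\<^sub>R b i)"
      using eq I unfolding w sumJ[of w'] by (simp add: w'_def algebra_simps)
    then have "t i = w' i" if "i \<in> J" for i
      using orthonormal_on_inner_sum[OF bJ finJ subset_refl that, of t]
        orthonormal_on_inner_sum[OF bJ finJ subset_refl that, of w'] that by simp
    then have "t i1 = y" "t i2 = z" "\<And>i. i \<in> I \<Longrightarrow> t i = w i"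
      using I by (auto simp: J_def w'_def)
    moreover from this(3) have "(\<Sum>i\<in>I. t i *\<^sub>R b i) = (\<Sum>i\<in>I. w i *\<^sub>R b i)" by (intro sum.cong) auto
    ultimately show "t i1 \<in> {0..1} \<and> t i2 \<in> {0..1} \<and> c + (\<Sum>i\<in>I. t i *\<^sub>R b i) \<in> S"
      using s w yz by simp
  next
    assume t: "t i1 \<in> {0..1} \<and> t i2 \<in> {0..1} \<and> c + (\<Sum>i\<in>I. t i *\<^sub>R b i) \<in> S"
    have "c + (\<Sum>i\<in>J. t i *\<^sub>R b i) = (\<lambda>(s, y, z). s + y *\<^sub>R b i1 + z *\<^sub>R b i2) (c + (\<Sum>i\<in>I. t i *\<^sub>R b i), t i1, t i2)"
      by (simp add: sumJ algebra_simps)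
    then show "c + (\<Sum>i\<in>J. t i *\<^sub>R b i) \<in> T"
      unfolding T_def thickened_def by (rule image_eqI) (use t in auto)
  qed
  have k_upd: "k (t(i := y)) = k t" if "i \<notin> I" for t i y
  proof -
    have "(\<Sum>j\<in>I. (t(i := y)) j *\<^sub>R b j) = (\<Sum>j\<in>I. t j *\<^sub>R b j)"
      using that by (intro sum.cong) auto
    then show ?thesis by (simp only: k_def)
  qed
  have ind1: "(\<integral>\<^sup>+ y. indicator {0..1::real} y * C \<partial>lborel) = C" for C :: ennreal
    by (subst nn_integral_multc) auto
  have m: "(\<lambda>t. c + (\<Sum>i\<in>J. t i *\<^sub>R b i)) \<in> PiM J (\<lambda>_. lborel) \<rightarrow>\<^sub>M borel" by measurable
  have "emeasure lborel T = emeasure (distr (PiM J (\<lambda>_. lborel)) borel (\<lambda>t. c + (\<Sum>i\<in>J. t i *\<^sub>R b i))) T"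
    using distr_orthonormal_basis[OF bJ finJ, of c] card I by (simp add: J_def)
  also have "\<dots> = (\<integral>\<^sup>+ x. indicator T x \<partial>(distr (PiM J (\<lambda>_. lborel)) borel (\<lambda>t. c + (\<Sum>i\<in>J. t i *\<^sub>R b i))))"
    by (subst nn_integral_indicator) auto
  also have "\<dots> = (\<integral>\<^sup>+ t. indicator T (c + (\<Sum>i\<in>J. t i *\<^sub>R b i)) \<partial>PiM J (\<lambda>_. lborel))"
    by (rule nn_integral_distr[OF m]) measurable
  also have "\<dots> = (\<integral>\<^sup>+ t. indicator {0..1} (t i1) * (indicator {0..1} (t i2) * k t) \<partial>PiM J (\<lambda>_. lborel))"
    by (intro nn_integral_cong) (auto simp: k_def indicator_def mem)
  also have "\<dots> = (\<integral>\<^sup>+ t. (\<integral>\<^sup>+ y. indicator {0..1::real} y * (indicator {0..1} (t i2) * k t) \<partial>lborel) \<partial>PiM (insert i2 I) (\<lambda>_. lborel))"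
  proof -
    have 1: "k \<in> borel_measurable (PiM (insert i1 (insert i2 I)) (\<lambda>_. lborel))" by (rule k_meas) auto
    show ?thesis
      unfolding J_def using I 1
      by (subst lborel_PiM.product_nn_integral_insert) (auto simp: k_upd)
  qed
  also have "\<dots> = (\<integral>\<^sup>+ t. indicator {0..1} (t i2) * k t \<partial>PiM (insert i2 I) (\<lambda>_. lborel))"
    by (simp only: ind1)
  also have "\<dots> = (\<integral>\<^sup>+ t. (\<integral>\<^sup>+ y. indicator {0..1::real} y * k t \<partial>lborel) \<partial>PiM I (\<lambda>_. lborel))"
  proof -
    have 1: "k \<in> borel_measurable (PiM (insert i2 I) (\<lambda>_. lborel))" by (rule k_meas) auto
    show ?thesis
      using I 1 by (subst lborel_PiM.product_nn_integral_insert) (auto simp: k_upd)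
  qed
  also have "\<dots> = (\<integral>\<^sup>+ t. k t \<partial>PiM I (\<lambda>_. lborel))" by (simp only: ind1)
  also have "\<dots> = (\<integral>\<^sup>+ t. indicator {t \<in> space (PiM I (\<lambda>_. lborel)). c + (\<Sum>i\<in>I. t i *\<^sub>R b i) \<in> S} t \<partial>PiM I (\<lambda>_. lborel))"
    by (intro nn_integral_cong) (auto simp: k_def indicator_def)
  also have "\<dots> = emeasure (PiM I (\<lambda>_. lborel)) {t \<in> space (PiM I (\<lambda>_. lborel)). c + (\<Sum>i\<in>I. t i *\<^sub>R b i) \<in> S}"
    by (rule nn_integral_indicator) measurable
  also have "space (PiM I (\<lambda>_. lborel :: real measure)) = I \<rightarrow>\<^sub>E UNIV" by (simp add: space_PiM)
  finally show ?thesis by (simp add: T_def)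
qed

text \<open>\<open>frame\<close> shows that the choice in \<open>flat_volume\<close> has a
  candidate. \<open>orth\<close> lets any candidate frame be completed by \<open>u1\<close> and
  \<open>u2\<close>, so all candidates yield one number, the measure of a set that mentions no
  frame.\<close>

lemma flat_volume_eq_thickened:
  fixes S :: "'a::euclidean_space set"
  assumes S: "compact S" and k: "k + 2 = DIM('a)"
    and u: "norm u1 = 1" "norm u2 = 1" "u1 \<bullet> u2 = 0"
    and frame: "orthonormal_frame k b0" "S \<subseteq> range (frame_point k c0 b0)"
    and orth: "\<And>c b i. orthonormal_frame k b \<Longrightarrow> S \<subseteq> range (frame_point k c b) \<Longrightarrow> i < k \<Longrightarrow> b i \<bullet> u1 = 0 \<and> b i \<bullet> u2 = 0"
  shows "ennreal (flat_volume k S) = emeasure lborel (thickened S u1 u2)"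
proof -
  have fin: "emeasure lborel (thickened S u1 u2) \<noteq> \<infinity>"
    using emeasure_bounded_finite[OF compact_imp_bounded[OF compact_thickened[OF S, of u1 u2]]]
    by (rule less_imp_neq)
  have eq: "measure (\<Pi>\<^sub>M i\<in>{..<k}. lborel) {t \<in> {..<k} \<rightarrow>\<^sub>E UNIV. frame_point k c b t \<in> S}
      = measure lborel (thickened S u1 u2)"
    if b: "orthonormal_frame k b" and sub: "S \<subseteq> range (frame_point k c b)" for c b
  proof -
    define b' where "b' = b(k := u1, Suc k := u2)"
    have sum: "(\<Sum>i<k. t i *\<^sub>R b' i) = (\<Sum>i<k. t i *\<^sub>R b i)" for t :: "nat \<Rightarrow> real"
      by (intro sum.cong) (auto simp: b'_def)
    have on: "orthonormal_on (insert k (insert (Suc k) {..<k})) b'"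
      unfolding orthonormal_on_def
      using b u orth[OF b sub]
      by (auto simp: b'_def orthonormal_frame_def inner_commute norm_eq_1)
    have ex: "\<exists>t. s = c + (\<Sum>i<k. t i *\<^sub>R b' i)" if "s \<in> S" for s
      using sub that by (auto simp: frame_point_def sum)
    have "emeasure (PiM {..<k} (\<lambda>_. lborel)) {t \<in> {..<k} \<rightarrow>\<^sub>E UNIV. c + (\<Sum>i<k. t i *\<^sub>R b' i) \<in> S}
        = emeasure lborel (thickened S (b' k) (b' (Suc k)))"
      by (rule emeasure_thickened[OF on _ _ _ _ _ S ex]) (use k in auto)
    moreover have "b' k = u1" "b' (Suc k) = u2" by (simp_all add: b'_def)
    ultimately show ?thesis by (simp only: measure_def sum frame_point_def)
  qed
  have "flat_volume k S = measure lborel (thickened S u1 u2)"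
    unfolding flat_volume_def
  proof (rule some_equality)
    show "\<exists>c b. orthonormal_frame k b \<and> S \<subseteq> range (frame_point k c b) \<and> measure lborel (thickened S u1 u2) =
       measure (\<Pi>\<^sub>M i\<in>{..<k}. lborel) {t \<in> {..<k} \<rightarrow>\<^sub>E UNIV. frame_point k c b t \<in> S}"
      by (intro exI[of _ c0] exI[of _ b0] conjI frame eq[OF frame, symmetric])
  qed (elim exE conjE, simp only: eq)
  then show ?thesis using fin by (simp add: emeasure_eq_ennreal_measure)
qed

section \<open>Volumes of blocks with zero coordinate sum\<close>

lemma emeasure_PiM_lborel_scale:
  assumes I: "finite I" and c: "c > 0" and A: "A \<in> sets (PiM I (\<lambda>_. lborel :: real measure))"
  shows "emeasure (PiM I (\<lambda>_. lborel)) A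
    = ennreal (c ^ card I) * emeasure (PiM I (\<lambda>_. lborel)) {t \<in> I \<rightarrow>\<^sub>E UNIV. (\<lambda>i\<in>I. c * t i) \<in> A}"
proof -
  let ?P = "PiM I (\<lambda>_. lborel :: real measure)"
  let ?h = "\<lambda>t. \<lambda>i\<in>I. c * t i"
  have m: "?h \<in> ?P \<rightarrow>\<^sub>M ?P"
  proof (rule measurable_restrict)
    fix i assume "i \<in> I"
    then have "(\<lambda>t. t i) \<in> borel_measurable ?P"
      using measurable_component_singleton[of i I "\<lambda>_. lborel :: real measure"] by simp
    then show "(\<lambda>t. c * t i) \<in> ?P \<rightarrow>\<^sub>M lborel" by simp
  qed
  have one: "ennreal c * emeasure lborel ((*) c -` B) = emeasure lborel B" if "B \<in> sets lborel" for B
  proof -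
    have "emeasure lborel ((*) c -` B) = emeasure (distr lborel borel ((*) c)) B"
      using that by (subst emeasure_distr) auto
    also have "\<dots> = ennreal (inverse c) * emeasure lborel B"
      using that c by (simp add: lborel_distr_mult emeasure_density_const)
    finally have "ennreal c * emeasure lborel ((*) c -` B) = ennreal c * ennreal (inverse c) * emeasure lborel B"
      by (simp only: mult.assoc)
    also have "ennreal c * ennreal (inverse c) = 1"
      using c ennreal_mult[of c "inverse c"] by simp
    finally show ?thesis by simp
  qed
  have "scale_measure (ennreal (c ^ card I)) (distr ?P ?P ?h) = ?P"
  proof (rule lborel_PiM.PiM_eqI[OF I])
    fix B :: "'a \<Rightarrow> real set" assume B: "\<And>i. i \<in> I \<Longrightarrow> B i \<in> sets lborel"
    have vB: "(*) c -` B i \<in> sets lborel" if "i \<in> I" for i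
      using measurable_sets[of "(*) c" borel borel "B i"] B[OF that] by simp
    have "?h -` (Pi\<^sub>E I B) \<inter> space ?P = Pi\<^sub>E I (\<lambda>i. (*) c -` B i)"
      by (auto simp: space_PiM PiE_iff)
    then have "emeasure (distr ?P ?P ?h) (Pi\<^sub>E I B) = (\<Prod>i\<in>I. emeasure lborel ((*) c -` B i))"
      using B vB I by (subst emeasure_distr[OF m]) (auto intro!: sets_PiM_I_finite simp: lborel_PiM.emeasure_PiM)
    then have "emeasure (scale_measure (ennreal (c ^ card I)) (distr ?P ?P ?h)) (Pi\<^sub>E I B)
        = (\<Prod>i\<in>I. ennreal c) * (\<Prod>i\<in>I. emeasure lborel ((*) c -` B i))"
      using c by (simp add: ennreal_power)
    also have "\<dots> = (\<Prod>i\<in>I. emeasure lborel (B i))"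
      unfolding prod.distrib[symmetric] by (intro prod.cong refl one B)
    finally show "emeasure (scale_measure (ennreal (c ^ card I)) (distr ?P ?P ?h)) (Pi\<^sub>E I B)
        = (\<Prod>i\<in>I. emeasure lborel (B i))" .
  qed simp
  then have "emeasure ?P A = emeasure (scale_measure (ennreal (c ^ card I)) (distr ?P ?P ?h)) A" by simp
  also have "\<dots> = ennreal (c ^ card I) * emeasure ?P (?h -` A \<inter> space ?P)"
    using emeasure_distr[OF m A] by simp
  also have "?h -` A \<inter> space ?P = {t \<in> I \<rightarrow>\<^sub>E UNIV. (\<lambda>i\<in>I. c * t i) \<in> A}"
    by (auto simp: space_PiM)
  finally show ?thesis .
qed

definition zero_sum :: "'n::finite set \<Rightarrow> (real ^ 'n) set" where
  "zero_sum X = {x. (\<forall>i. i \<notin> X \<longrightarrow> x $ i = 0) \<and> (\<Sum>i\<in>UNIV. x $ i) = 0}"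

lemma subspace_zero_sum: "subspace (zero_sum X)"
  by (auto simp: zero_sum_def subspace_def sum.distrib sum_distrib_left[symmetric])

lemma sum_zero_sum: "x \<in> zero_sum X \<Longrightarrow> (\<Sum>i\<in>X. x $ i) = 0"
proof -
  assume x: "x \<in> zero_sum X"
  then have "(\<Sum>i\<in>X. x $ i) = (\<Sum>i\<in>UNIV. x $ i)"
    by (intro sum.mono_neutral_left) (auto simp: zero_sum_def)
  then show ?thesis using x by (simp add: zero_sum_def)
qed

text \<open>Within the coordinate subspace of X this is the orthogonal complement of the indicator
  vector of X, which costs one dimension.\<close>

lemma dim_zero_sum:
  fixes X :: "'n::finite set"
  assumes "X \<noteq> {}"
  shows "dim (zero_sum X) + 1 = card X"
proof -
  define B where "B = {x :: real ^ 'n. \<forall>i. i \<notin> X \<longrightarrow> x $ i = 0}"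
  define w :: "real ^ 'n" where "w = (\<chi> i. if i \<in> X then 1 else 0)"
  have B: "subspace B" by (auto simp: B_def subspace_def)
  have w: "w \<in> B" "w \<noteq> 0" using assms by (auto simp: B_def w_def vec_eq_iff)
  have wx: "w \<bullet> x = (\<Sum>i\<in>UNIV. x $ i)" if "x \<in> B" for x
    unfolding inner_vec_def using that by (intro sum.cong) (auto simp: w_def B_def)
  have "{y \<in> B. \<forall>x \<in> span {w}. orthogonal x y} = zero_sum X"
  proof -
    have "(\<forall>x \<in> span {w}. orthogonal x y) \<longleftrightarrow> w \<bullet> y = 0" for y
      by (auto simp: span_singleton orthogonal_def)
    then show ?thesis using wx by (auto simp: zero_sum_def B_def)
  qed
  moreover have "dim {y \<in> B. \<forall>x \<in> span {w}. orthogonal x y} + dim (span {w}) = dim B"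
    using w B by (intro dim_subspace_orthogonal_to_vectors) (auto intro: span_minimal[THEN subsetD])
  moreover have "dim (span {w}) = 1" using w by (simp add: dim_singleton)
  moreover have "dim B = card X" unfolding B_def by (simp add: dim_substandard_cart flip: dim_vec_eq)
  ultimately show ?thesis by simp
qed

text \<open>In coordinates along an orthonormal basis B of the zero-sum space: the volume of the
  simplex of vectors on X with nonnegative entries and sum c |X|.\<close>

definition block_volume :: "(real ^ 'n) set \<Rightarrow> 'n::finite set \<Rightarrow> real \<Rightarrow> ennreal" where
  "block_volume B X c = emeasure (PiM B (\<lambda>_. lborel))
     {t \<in> B \<rightarrow>\<^sub>E UNIV. \<forall>i\<in>X. 0 \<le> c + (\<Sum>v\<in>B. t v *\<^sub>R v) $ i}"

lemma block_set_measurable: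
  fixes B :: "(real ^ 'n::finite) set"
  assumes "finite B"
  shows "{t \<in> B \<rightarrow>\<^sub>E UNIV. \<forall>i\<in>X. 0 \<le> c + (\<Sum>v\<in>B. t v *\<^sub>R v) $ i} \<in> sets (PiM B (\<lambda>_. lborel :: real measure))"
proof -
  have [measurable]: "(\<lambda>t. t v) \<in> borel_measurable (PiM B (\<lambda>_. lborel :: real measure))" if "v \<in> B" for v
    using that measurable_component_singleton[of v B "\<lambda>_. lborel :: real measure"] by simp
  have "{t \<in> space (PiM B (\<lambda>_. lborel :: real measure)). \<forall>i\<in>X. 0 \<le> c + (\<Sum>v\<in>B. t v * v $ i)} \<in> sets (PiM B (\<lambda>_. lborel))"
    by measurable
  then show ?thesis by (simp add: space_PiM)
qed

locale zero_sum_basis =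
  fixes X :: "'n::finite set" and B :: "(real ^ 'n) set"
  assumes X: "X \<noteq> {}" and B: "B \<subseteq> zero_sum X" "pairwise orthogonal B" "\<And>v. v \<in> B \<Longrightarrow> norm v = 1"
    "card B = dim (zero_sum X)" "finite B"
begin

lemma card_B: "card B = card X - 1"
  using dim_zero_sum[OF X] B(4) by simp

lemma combination_in: "(\<Sum>v\<in>B. t v *\<^sub>R v) \<in> zero_sum X"
  using B(1) by (intro subspace_sum subspace_zero_sum subspace_scale) auto

lemma orthonormal: "orthonormal_on B (\<lambda>v. v)"
  using B(2,3) by (auto simp: orthonormal_on_def pairwise_def orthogonal_def norm_eq_1)

lemma block_volume_scale:
  assumes "c > 0" shows "block_volume B X (c * s) = ennreal (c ^ (card X - 1)) * block_volume B X s"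
proof -
  have "{t \<in> B \<rightarrow>\<^sub>E UNIV. (\<lambda>v\<in>B. c * t v) \<in> {t \<in> B \<rightarrow>\<^sub>E UNIV. \<forall>i\<in>X. 0 \<le> c * s + (\<Sum>v\<in>B. t v *\<^sub>R v) $ i}}
     = {t \<in> B \<rightarrow>\<^sub>E UNIV. \<forall>i\<in>X. 0 \<le> s + (\<Sum>v\<in>B. t v *\<^sub>R v) $ i}"
  proof -
    have "(\<Sum>v\<in>B. (\<lambda>v\<in>B. c * t v) v *\<^sub>R v) $ i = c * (\<Sum>v\<in>B. t v *\<^sub>R v) $ i" for t :: "real ^ 'n \<Rightarrow> real" and i
      by (simp add: sum_distrib_left mult.assoc)
    then have "0 \<le> c * s + (\<Sum>v\<in>B. (\<lambda>v\<in>B. c * t v) v *\<^sub>R v) $ i \<longleftrightarrow> 0 \<le> s + (\<Sum>v\<in>B. t v *\<^sub>R v) $ i"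
      for t :: "real ^ 'n \<Rightarrow> real" and i
      using assms by (simp only: distrib_left[symmetric] zero_le_mult_iff) auto
    then show ?thesis by (auto simp: PiE_iff extensional_def)
  qed
  then show ?thesis
    unfolding block_volume_def
    by (subst emeasure_PiM_lborel_scale[OF B(5) assms block_set_measurable[OF B(5)]]) (simp add: card_B)
qed

text \<open>Entries bounded below by -1 and summing to zero are bounded above as well. Coordinates
  in an orthonormal basis are bounded by the norm, so the set fits in a box.\<close>

lemma block_volume_finite: "block_volume B X 1 < top"
proof -
  define R where "R = real (card X * CARD('n))"
  have sub: "{t \<in> B \<rightarrow>\<^sub>E UNIV. \<forall>i\<in>X. 0 \<le> 1 + (\<Sum>v\<in>B. t v *\<^sub>R v) $ i} \<subseteq> (\<Pi>\<^sub>E v\<in>B. {-R..R})"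
  proof
    fix t assume t: "t \<in> {t \<in> B \<rightarrow>\<^sub>E UNIV. \<forall>i\<in>X. 0 \<le> 1 + (\<Sum>v\<in>B. t v *\<^sub>R v) $ i}"
    define x where "x = (\<Sum>v\<in>B. t v *\<^sub>R v)"
    have xZ: "x \<in> zero_sum X" unfolding x_def by (rule combination_in)
    have lo: "x $ i \<ge> - 1" if "i \<in> X" for i using t that by (auto simp: x_def)
    have "\<bar>x $ i\<bar> \<le> real (card X)" for i
    proof (cases "i \<in> X")
      case True
      have "x $ i = - (\<Sum>j\<in>X - {i}. x $ j)"
        using sum_zero_sum[OF xZ] True by (simp add: sum.remove)
      also have "\<dots> = (\<Sum>j\<in>X - {i}. - (x $ j))" by (simp add: sum_negf)
      also have "\<dots> \<le> (\<Sum>j\<in>X - {i}. 1)" using lo by (intro sum_mono) (fastforce simp: minus_le_iff)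
      also have "\<dots> \<le> real (card X)" by (simp add: card_mono)
      finally have "x $ i \<le> real (card X)" .
      moreover have "1 \<le> card X" using X by (simp add: Suc_leI card_gt_0_iff)
      ultimately show ?thesis using lo[OF True] by (auto simp: abs_le_iff)
    next
      case False
      then show ?thesis using xZ by (simp add: zero_sum_def)
    qed
    then have "(\<Sum>i\<in>UNIV. \<bar>x $ i\<bar>) \<le> (\<Sum>i\<in>(UNIV :: 'n set). real (card X))" by (intro sum_mono)
    then have nx: "norm x \<le> R" using norm_le_l1_cart[of x] by (simp add: R_def mult.commute)
    have "t v \<in> {-R..R}" if "v \<in> B" for v
    proof -
      have "t v = x \<bullet> v"
        unfolding x_def using orthonormal_on_inner_sum[OF orthonormal B(5) subset_refl that, of t] that by simp
      then have "\<bar>t v\<bar> \<le> norm x * norm v" using Cauchy_Schwarz_ineq2[of x v] by simp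
      then show ?thesis using nx B(3)[OF that] by auto
    qed
    then show "t \<in> (\<Pi>\<^sub>E v\<in>B. {-R..R})" using t by (auto simp: PiE_iff)
  qed
  have "block_volume B X 1 \<le> emeasure (PiM B (\<lambda>_. lborel)) (\<Pi>\<^sub>E v\<in>B. {-R..R})"
    unfolding block_volume_def using B(5) by (intro emeasure_mono sub sets_PiM_I_finite) auto
  also have "\<dots> = (\<Prod>v\<in>B. emeasure lborel {-R..R})"
    using B(5) by (intro lborel_PiM.emeasure_PiM) auto
  also have "\<dots> < top" by (simp add: R_def ennreal_power[symmetric] power_less_top_ennreal)
  finally show ?thesis .
qed

lemma block_volume_pos: "block_volume B X 1 > 0"
proof -
  define \<epsilon> where "\<epsilon> = 1 / (real (card B) + 1)"
  have \<epsilon>: "\<epsilon> > 0" by (simp add: \<epsilon>_def)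
  have sub: "(\<Pi>\<^sub>E v\<in>B. {-\<epsilon>..\<epsilon>}) \<subseteq> {t \<in> B \<rightarrow>\<^sub>E UNIV. \<forall>i\<in>X. 0 \<le> 1 + (\<Sum>v\<in>B. t v *\<^sub>R v) $ i}"
  proof
    fix t assume t: "t \<in> (\<Pi>\<^sub>E v\<in>B. {-\<epsilon>..\<epsilon>})"
    have "0 \<le> 1 + (\<Sum>v\<in>B. t v *\<^sub>R v) $ i" for i
    proof -
      have "\<bar>(\<Sum>v\<in>B. t v *\<^sub>R v) $ i\<bar> \<le> norm (\<Sum>v\<in>B. t v *\<^sub>R v)" by (rule component_le_norm_cart)
      also have "\<dots> \<le> (\<Sum>v\<in>B. norm (t v *\<^sub>R v))" by (rule norm_sum)
      also have "\<dots> \<le> (\<Sum>v\<in>B. \<epsilon>)" using t B(3) by (intro sum_mono) (auto simp: PiE_iff abs_le_iff)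
      also have "\<dots> \<le> 1" by (simp add: \<epsilon>_def)
      finally show ?thesis by (simp add: abs_le_iff)
    qed
    then show "t \<in> {t \<in> B \<rightarrow>\<^sub>E UNIV. \<forall>i\<in>X. 0 \<le> 1 + (\<Sum>v\<in>B. t v *\<^sub>R v) $ i}" using t by (auto simp: PiE_iff)
  qed
  have "0 < (\<Prod>v\<in>B. emeasure lborel {-\<epsilon>..\<epsilon>})"
    using \<epsilon> B(5) by (auto simp: prod_zero_iff zero_less_iff_neq_zero)
  also have "\<dots> = emeasure (PiM B (\<lambda>_. lborel)) (\<Pi>\<^sub>E v\<in>B. {-\<epsilon>..\<epsilon>})"
    using B(5) by (intro lborel_PiM.emeasure_PiM[symmetric]) auto
  also have "\<dots> \<le> block_volume B X 1"
    unfolding block_volume_def using B(5) by (intro emeasure_mono sub block_set_measurable) auto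
  finally show ?thesis .
qed

text \<open>Scaling settles c > 0. At c = 0 a one-point block has the zero-dimensional volume 1,
  while for larger blocks a finite volume that doubling multiplies by a number above 1 must be 0.
  For c < 0 the entries would be nonnegative with a negative sum.\<close>

lemma block_volume_eq: "block_volume B X c = ennreal (pos_pow (card X - 1) c) * block_volume B X 1"
proof -
  have "card X > 0" using X by (simp add: card_gt_0_iff)
  then consider "c > 0" | "c = 0" "card X = 1" | "c = 0" "card X > 1" | "c < 0"
    by linarith
  then show ?thesis
  proof cases
    case 1
    then show ?thesis using block_volume_scale[of c 1] by (simp add: pos_pow_def)
  next
    case 2
    then have "B = {}" using card_B B(5) by simp
    then show ?thesis using 2 by (simp add: block_volume_def pos_pow_def)
  next
    case 3
    have "block_volume B X 0 \<le> block_volume B X 1"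
      unfolding block_volume_def
      by (intro emeasure_mono block_set_measurable B(5)) (auto intro: add_nonneg_nonneg)
    then have "block_volume B X 0 < top" using block_volume_finite by (rule le_less_trans)
    then obtain y where y: "block_volume B X 0 = ennreal y" "y \<ge> 0"
      by (cases "block_volume B X 0") auto
    have "block_volume B X 0 = ennreal (2 ^ (card X - 1)) * block_volume B X 0"
      by (rule block_volume_scale[of 2 0, unfolded mult_zero_right, OF zero_less_numeral])
    then have "y = 2 ^ (card X - 1) * y"
      unfolding y(1) using y(2) by (simp add: ennreal_mult[symmetric])
    moreover have "1 < (2::real) ^ (card X - 1)" using 3 by (intro one_less_power) auto
    then have "(2::real) ^ (card X - 1) \<noteq> 1" by linarith
    ultimately have "y = 0" by simp
    then show ?thesis using 3 y by (simp add: pos_pow_def power_0_left)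
  next
    case 4
    have "{t \<in> B \<rightarrow>\<^sub>E UNIV. \<forall>i\<in>X. 0 \<le> c + (\<Sum>v\<in>B. t v *\<^sub>R v) $ i} = {}"
    proof (rule ccontr)
      assume "\<not> ?thesis"
      then obtain t where "\<forall>i\<in>X. 0 \<le> c + (\<Sum>v\<in>B. t v *\<^sub>R v) $ i" by auto
      then have "0 \<le> (\<Sum>i\<in>X. c + (\<Sum>v\<in>B. t v *\<^sub>R v) $ i)" by (intro sum_nonneg) auto
      also have "\<dots> = real (card X) * c"
        using sum_zero_sum[OF combination_in] by (simp add: sum.distrib)
      finally show False using 4 X by (simp add: zero_le_mult_iff)
    qed
    then have "block_volume B X c = 0" unfolding block_volume_def by (simp only: emeasure_empty)
    then show ?thesis using 4 by (simp add: pos_pow_def)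
  qed
qed

end

section \<open>Orthonormal bases and the simplex\<close>

lemma orthonormal_on_Un:
  assumes "orthonormal_on A (\<lambda>v. v)" "orthonormal_on B (\<lambda>v. v)" "\<And>x y. x \<in> A \<Longrightarrow> y \<in> B \<Longrightarrow> x \<bullet> y = 0"
  shows "orthonormal_on (A \<union> B) (\<lambda>v. v)"
proof -
  have "x \<noteq> y" if "x \<in> A" "y \<in> B" for x y
    using assms(3)[OF that] orthonormal_onD[OF assms(1) that(1,1)] by auto
  then show ?thesis
    using assms unfolding orthonormal_on_def by (metis Un_iff inner_commute)
qed

lemma orthonormal_on_insert:
  assumes "orthonormal_on B (\<lambda>v. v)" "x \<bullet> x = 1" "\<And>y. y \<in> B \<Longrightarrow> x \<bullet> y = 0"
  shows "orthonormal_on (insert x B) (\<lambda>v. v)"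
  using orthonormal_on_Un[of "{x}" B] assms by (simp add: orthonormal_on_def)

lemma orthonormal_on_independent:
  assumes "orthonormal_on J (\<lambda>v. v)" shows "independent J"
proof (rule pairwise_orthogonal_independent)
  show "pairwise orthogonal J" using assms by (auto simp: pairwise_def orthogonal_def orthonormal_on_def)
  show "0 \<notin> J" using orthonormal_onD[OF assms, of 0 0] by auto
qed

lemma orthonormal_complete_card:
  fixes J :: "'a::euclidean_space set"
  assumes J: "orthonormal_on J (\<lambda>v. v)" and complete: "\<And>x. (\<And>v. v \<in> J \<Longrightarrow> x \<bullet> v = 0) \<Longrightarrow> x = 0"
  shows "card J = DIM('a)"
proof -
  have "dim J = card J" using orthonormal_on_independent[OF J] by (rule dim_eq_card_independent)
  moreover have "\<not> dim J < DIM('a)"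
  proof
    assume "dim J < DIM('a)"
    then obtain x where "x \<noteq> 0" "\<And>y. y \<in> span J \<Longrightarrow> orthogonal x y"
      using orthogonal_to_subspace_exists by metis
    then show False using complete[of x] by (auto simp: orthogonal_def intro: span_base)
  qed
  ultimately show ?thesis using dim_subset_UNIV[of J] by simp
qed

lemma orthonormal_expansion:
  fixes J :: "'a::euclidean_space set"
  assumes J: "orthonormal_on J (\<lambda>v. v)" "finite J" and complete: "\<And>x. (\<And>v. v \<in> J \<Longrightarrow> x \<bullet> v = 0) \<Longrightarrow> x = 0"
  shows "x = (\<Sum>v\<in>J. (x \<bullet> v) *\<^sub>R v)"
proof -
  have "(x - (\<Sum>v\<in>J. (x \<bullet> v) *\<^sub>R v)) \<bullet> w = 0" if "w \<in> J" for w
    using orthonormal_on_inner_sum[OF J subset_refl that, of "\<lambda>v. x \<bullet> v"] that by (simp add: inner_diff_left)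
  from complete[OF this] show ?thesis by simp
qed

lemma standard_simplex_eq: "standard_simplex = {x :: real ^ 'n::finite. (\<forall>i. 0 \<le> x $ i) \<and> (\<Sum>i\<in>UNIV. x $ i) = 1}"
proof
  let ?S = "{x :: real ^ 'n. (\<forall>i. 0 \<le> x $ i) \<and> (\<Sum>i\<in>UNIV. x $ i) = 1}"
  have "convex ?S"
    by (auto simp: convex_def sum.distrib sum_distrib_left[symmetric])
  moreover have "range (\<lambda>i. axis i 1) \<subseteq> ?S" by (auto simp: axis_def sum.delta)
  ultimately show "standard_simplex \<subseteq> ?S" unfolding standard_simplex_def by (rule hull_minimal[rotated])
  show "?S \<subseteq> standard_simplex"
  proof
    fix x :: "real ^ 'n" assume x: "x \<in> ?S"
    have "(\<Sum>i\<in>UNIV. x $ i *\<^sub>R axis i 1) \<in> standard_simplex"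
      unfolding standard_simplex_def using x
      by (intro convex_sum convex_convex_hull) (auto intro: hull_inc)
    also have "(\<Sum>i\<in>UNIV. x $ i *\<^sub>R axis i 1) = x"
      by (simp add: vec_eq_iff axis_def if_distrib sum.delta cong: if_cong)
    finally show "x \<in> standard_simplex" .
  qed
qed

lemma compact_standard_simplex: "compact (standard_simplex :: (real ^ 'n::finite) set)"
  unfolding standard_simplex_def by (intro compact_convex_hull finite_imp_compact) simp

lemma closed_hyperplane_perp: "closed (hyperplane_perp (a :: 'a::euclidean_space))"
  unfolding hyperplane_perp_def by (rule closed_hyperplane)

text \<open>Here f and g live on all assignments and are integrated over different index sets. Hence
  measurability is asked for every larger index set, and dependence on few coordinates is a separate
  hypothesis.\<close>

lemma product_nn_integral_separate:
  fixes f g :: "('i \<Rightarrow> real) \<Rightarrow> ennreal"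
  assumes IJ: "I \<inter> J = {}" "finite I" "finite J"
    and f: "\<And>K. I \<subseteq> K \<Longrightarrow> f \<in> borel_measurable (PiM K (\<lambda>_. lborel))"
    and g: "\<And>K. J \<subseteq> K \<Longrightarrow> g \<in> borel_measurable (PiM K (\<lambda>_. lborel))"
    and f_dep: "\<And>t t'. (\<And>i. i \<in> I \<Longrightarrow> t i = t' i) \<Longrightarrow> f t = f t'"
    and g_dep: "\<And>t t'. (\<And>i. i \<in> J \<Longrightarrow> t i = t' i) \<Longrightarrow> g t = g t'"
  shows "(\<integral>\<^sup>+ t. f t * g t \<partial>PiM (I \<union> J) (\<lambda>_. lborel))
    = (\<integral>\<^sup>+ t. f t \<partial>PiM I (\<lambda>_. lborel)) * (\<integral>\<^sup>+ t. g t \<partial>PiM J (\<lambda>_. lborel))"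
proof -
  have [measurable]: "f \<in> borel_measurable (PiM (I \<union> J) (\<lambda>_. lborel))" "g \<in> borel_measurable (PiM (I \<union> J) (\<lambda>_. lborel))"
    "f \<in> borel_measurable (PiM I (\<lambda>_. lborel))" "g \<in> borel_measurable (PiM J (\<lambda>_. lborel))"
    by (auto intro: f g)
  have fm: "f (merge I J (x, y)) = f x" for x y by (rule f_dep) (simp add: merge_def)
  have gm: "g (merge I J (x, y)) = g y" for x y
    by (rule g_dep) (use IJ(1) in \<open>auto simp: merge_def\<close>)
  have "(\<integral>\<^sup>+ t. f t * g t \<partial>PiM (I \<union> J) (\<lambda>_. lborel))
     = (\<integral>\<^sup>+ x. (\<integral>\<^sup>+ y. f x * g y \<partial>PiM J (\<lambda>_. lborel)) \<partial>PiM I (\<lambda>_. lborel))"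
    by (subst lborel_PiM.product_nn_integral_fold[OF IJ]) (measurable, simp add: fm gm)
  also have "\<dots> = (\<integral>\<^sup>+ x. f x * (\<integral>\<^sup>+ y. g y \<partial>PiM J (\<lambda>_. lborel)) \<partial>PiM I (\<lambda>_. lborel))"
    by (simp add: nn_integral_cmult)
  also have "\<dots> = (\<integral>\<^sup>+ t. f t \<partial>PiM I (\<lambda>_. lborel)) * (\<integral>\<^sup>+ t. g t \<partial>PiM J (\<lambda>_. lborel))"
    by (simp add: nn_integral_multc)
  finally show ?thesis .
qed

section \<open>The three blocks\<close>

text \<open>Free of the extensionality condition in \<open>block_volume\<close>, so that the same
  function can be integrated over any index set containing B.\<close>

definition block_indicator :: "(real ^ 'n) set \<Rightarrow> 'n::finite set \<Rightarrow> real \<Rightarrow> (real ^ 'n \<Rightarrow> real) \<Rightarrow> ennreal" where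
  "block_indicator B X c t = (if \<forall>i\<in>X. 0 \<le> c + (\<Sum>v\<in>B. t v * v $ i) then 1 else 0)"

lemma block_indicator_measurable:
  assumes "B \<subseteq> K" and [measurable]: "c \<in> borel_measurable (PiM K (\<lambda>_. lborel :: real measure))"
  shows "(\<lambda>t. block_indicator B X (c t) t) \<in> borel_measurable (PiM K (\<lambda>_. lborel))"
proof -
  have [measurable]: "(\<lambda>t. t v) \<in> borel_measurable (PiM K (\<lambda>_. lborel :: real measure))" if "v \<in> B" for v
    using that assms(1) measurable_component_singleton[of v K "\<lambda>_. lborel :: real measure"] by auto
  show ?thesis unfolding block_indicator_def by measurable
qed

lemma block_indicator_cong: "(\<And>v. v \<in> B \<Longrightarrow> t v = t' v) \<Longrightarrow> block_indicator B X c t = block_indicator B X c t'"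
  by (simp add: block_indicator_def cong: sum.cong)

lemma nn_integral_block_indicator:
  assumes "finite B"
  shows "(\<integral>\<^sup>+ t. block_indicator B X c t \<partial>PiM B (\<lambda>_. lborel)) = block_volume B X c"
proof -
  have "(\<integral>\<^sup>+ t. block_indicator B X c t \<partial>PiM B (\<lambda>_. lborel))
     = (\<integral>\<^sup>+ t. indicator {t \<in> B \<rightarrow>\<^sub>E UNIV. \<forall>i\<in>X. 0 \<le> c + (\<Sum>v\<in>B. t v *\<^sub>R v) $ i} t \<partial>PiM B (\<lambda>_. lborel))"
    by (intro nn_integral_cong) (auto simp: block_indicator_def indicator_def space_PiM)
  then show ?thesis unfolding block_volume_def using block_set_measurable[OF assms] by simp
qed

definition block_a :: "('a::finite + 'b::finite + 'c::finite) set" where "block_a = range Inl"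
definition block_b :: "('a::finite + 'b::finite + 'c::finite) set" where "block_b = range (\<lambda>y. Inr (Inl y))"
definition block_c :: "('a::finite + 'b::finite + 'c::finite) set" where "block_c = range (\<lambda>z. Inr (Inr z))"

lemma block_cases: "i \<in> block_a \<or> i \<in> block_b \<or> i \<in> block_c"
proof (cases i)
  case (Inr j)
  then show ?thesis by (cases j) (auto simp: block_b_def block_c_def)
qed (auto simp: block_a_def)

lemma block_disjoint: "block_a \<inter> block_b = {}" "block_a \<inter> block_c = {}" "block_b \<inter> block_c = {}"
  by (auto simp: block_a_def block_b_def block_c_def)

lemma block_union: "UNIV = block_a \<union> (block_b \<union> block_c)"
  using block_cases by blast

lemma block_nonempty: "block_a \<noteq> {}" "block_b \<noteq> {}" "block_c \<noteq> {}"
  by (auto simp: block_a_def block_b_def block_c_def)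

lemma card_block:
  "card (block_a :: ('a::finite + 'b::finite + 'c::finite) set) = CARD('a)"
  "card (block_b :: ('a::finite + 'b::finite + 'c::finite) set) = CARD('b)"
  "card (block_c :: ('a::finite + 'b::finite + 'c::finite) set) = CARD('c)"
  by (auto simp: block_a_def block_b_def block_c_def card_image inj_on_def)

lemma sum_blocks:
  fixes f :: "('a::finite + 'b::finite + 'c::finite) \<Rightarrow> 'd::comm_monoid_add"
  shows "(\<Sum>i\<in>UNIV. f i) = (\<Sum>i\<in>block_a. f i) + ((\<Sum>i\<in>block_b. f i) + (\<Sum>i\<in>block_c. f i))"
proof -
  have "(\<Sum>i\<in>UNIV. f i) = (\<Sum>i\<in>block_a. f i) + (\<Sum>i\<in>block_b \<union> block_c. f i)"
    using block_disjoint by (subst block_union, intro sum.union_disjoint) auto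
  also have "(\<Sum>i\<in>block_b \<union> block_c. f i) = (\<Sum>i\<in>block_b. f i) + (\<Sum>i\<in>block_c. f i)"
    using block_disjoint by (intro sum.union_disjoint) auto
  finally show ?thesis .
qed

lemma block_vec_nth:
  "i \<in> block_a \<Longrightarrow> block_vec p q r $ i = p"
  "i \<in> block_b \<Longrightarrow> block_vec p q r $ i = q"
  "i \<in> block_c \<Longrightarrow> block_vec p q r $ i = r"
  by (auto simp: block_vec_def block_a_def block_b_def block_c_def)

lemma inner_block_vec:
  "block_vec p q r \<bullet> x = p * (\<Sum>i\<in>block_a. x $ i) + q * (\<Sum>i\<in>block_b. x $ i) + r * (\<Sum>i\<in>block_c. x $ i)"
  by (simp add: inner_vec_def sum_blocks block_vec_nth sum_distrib_left cong: sum.cong)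

lemma inner_block_vec_block_vec:
  "(block_vec p q r :: real ^ ('a::finite + 'b::finite + 'c::finite)) \<bullet> block_vec p' q' r'
    = real CARD('a) * (p * p') + real CARD('b) * (q * q') + real CARD('c) * (r * r')"
  by (simp add: inner_block_vec block_vec_nth card_block cong: sum.cong)

lemma inner_block_vec_zero_sum:
  assumes "x \<in> zero_sum block_a \<or> x \<in> zero_sum block_b \<or> x \<in> zero_sum block_c"
  shows "block_vec p q r \<bullet> x = 0"
proof -
  have "(\<Sum>i\<in>Y. x $ i) = 0" if "x \<in> zero_sum X" "X = Y \<or> X \<inter> Y = {}" for X Y
  proof (cases "X = Y")
    case True
    then show ?thesis using that(1) sum_zero_sum by blast
  next
    case False
    then show ?thesis using that by (intro sum.neutral) (auto simp: zero_sum_def)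
  qed
  then have "(\<Sum>i\<in>block_a. x $ i) = 0 \<and> (\<Sum>i\<in>block_b. x $ i) = 0 \<and> (\<Sum>i\<in>block_c. x $ i) = 0"
    using assms block_disjoint by (metis Int_commute)
  then show ?thesis by (simp add: inner_block_vec)
qed

lemma inner_zero_sum_disjoint:
  assumes "x \<in> zero_sum X" "y \<in> zero_sum Y" "X \<inter> Y = {}"
  shows "x \<bullet> y = 0"
  unfolding inner_vec_def using assms by (intro sum.neutral) (auto simp: zero_sum_def)

text \<open>Test with the difference of two coordinate vectors of X.\<close>

lemma block_constant_if_orthogonal_zero_sum:
  assumes "\<And>v. v \<in> zero_sum X \<Longrightarrow> x \<bullet> v = 0" "i \<in> X" "j \<in> X"
  shows "(x :: real ^ 'n::finite) $ i = x $ j"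
proof (cases "i = j")
  case False
  have "axis i 1 - axis j 1 \<in> zero_sum X"
    using assms(2,3) by (auto simp: zero_sum_def axis_def sum_subtractf)
  from assms(1)[OF this] show ?thesis by (simp add: inner_diff_right inner_axis)
qed simp

lemma zero_sum_basis_exists:
  assumes "X \<noteq> {}" obtains B where "zero_sum_basis X B" "span B = zero_sum X"
proof -
  obtain B where "B \<subseteq> zero_sum X" "pairwise orthogonal B" "\<And>x. x \<in> B \<Longrightarrow> norm x = 1"
    "independent B" "card B = dim (zero_sum X)" "span B = zero_sum X"
    using orthonormal_basis_subspace[OF subspace_zero_sum[of X]] by metis
  then show thesis using assms by (intro that) (auto simp: zero_sum_basis_def independent_imp_finite)
qed

text \<open>Lagrange's identity for the constant vector and (p, q, r) with weights a, b, c. Under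
  the constraints the right side is a + b + c, which fixes the length of the cross product of the
  two.\<close>

lemma weighted_lagrange:
  fixes a b c p q r :: real
  shows "b * c * (q - r)\<^sup>2 + a * c * (r - p)\<^sup>2 + a * b * (p - q)\<^sup>2
    = (a + b + c) * (a * p\<^sup>2 + b * q\<^sup>2 + c * r\<^sup>2) - (a * p + b * q + c * r)\<^sup>2"
  by (simp add: algebra_simps power2_eq_square)

text \<open>(x, y, z) is orthogonal, in the weighted inner product, to the constant vector, to (p,
  q, r) and to their cross product. The first two conditions give the proportions \<open>e1\<close>
  to \<open>e3\<close>. Combined with the third, they leave each coordinate multiplied by the
  Lagrange sum a + b + c.\<close>

lemma three_orthogonal_zero:
  fixes a b c p q r x y z :: real
  assumes abc: "a > 0" "b > 0" "c > 0"
    and pqr: "a * p + b * q + c * r = 0" "a * p\<^sup>2 + b * q\<^sup>2 + c * r\<^sup>2 = 1"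
    and 1: "a * x + b * y + c * z = 0"
    and 2: "a * (p * x) + b * (q * y) + c * (r * z) = 0"
    and 3: "(q - r) * x + (r - p) * y + (p - q) * z = 0"
  shows "x = 0 \<and> y = 0 \<and> z = 0"
proof -
  have N: "b * c * (q - r)\<^sup>2 + a * c * (r - p)\<^sup>2 + a * b * (p - q)\<^sup>2 = a + b + c"
    using weighted_lagrange[of b c q r a p] pqr by simp
  have e1: "a * (p - q) * x = c * (q - r) * z"
  proof -
    have "a * (p - q) * x - c * (q - r) * z = a * (p * x) + b * (q * y) + c * (r * z) - q * (a * x + b * y + c * z)"
      by (simp add: algebra_simps)
    then show ?thesis unfolding 1 2 by simp
  qed
  have e2: "a * (r - p) * x = b * (q - r) * y"
  proof -
    have "a * (r - p) * x - b * (q - r) * y = r * (a * x + b * y + c * z) - (a * (p * x) + b * (q * y) + c * (r * z))"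
      by (simp add: algebra_simps)
    then show ?thesis unfolding 1 2 by simp
  qed
  have e3: "b * (p - q) * y = c * (r - p) * z"
  proof -
    have "b * (p - q) * y - c * (r - p) * z = p * (a * x + b * y + c * z) - (a * (p * x) + b * (q * y) + c * (r * z))"
      by (simp add: algebra_simps)
    then show ?thesis unfolding 1 2 by simp
  qed
  have "(a + b + c) * x = b * c * (q - r) * ((q - r) * x + (r - p) * y + (p - q) * z)
      + c * (r - p) * (a * (r - p) * x - b * (q - r) * y) + b * (p - q) * (a * (p - q) * x - c * (q - r) * z)"
    unfolding N[symmetric] by (simp add: algebra_simps power2_eq_square)
  then have "(a + b + c) * x = 0" unfolding e1 e2 3 by simp
  moreover have "(a + b + c) * y = a * c * (r - p) * ((q - r) * x + (r - p) * y + (p - q) * z)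
      - c * (q - r) * (a * (r - p) * x - b * (q - r) * y) + a * (p - q) * (b * (p - q) * y - c * (r - p) * z)"
    unfolding N[symmetric] by (simp add: algebra_simps power2_eq_square)
  then have "(a + b + c) * y = 0" unfolding e2 e3 3 by simp
  moreover have "(a + b + c) * z = a * b * (p - q) * ((q - r) * x + (r - p) * y + (p - q) * z)
      - b * (q - r) * (a * (p - q) * x - c * (q - r) * z) - a * (r - p) * (b * (p - q) * y - c * (r - p) * z)"
    unfolding N[symmetric] by (simp add: algebra_simps power2_eq_square)
  then have "(a + b + c) * z = 0" unfolding e1 e3 3 by simp
  ultimately show ?thesis using abc by simp
qed

locale block_bases =
  fixes BA BB BC :: "(real ^ ('a::finite + 'b::finite + 'c::finite)) set"
  assumes BA: "zero_sum_basis block_a BA" "span BA = zero_sum block_a"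
    and BB: "zero_sum_basis block_b BB" "span BB = zero_sum block_b"
    and BC: "zero_sum_basis block_c BC" "span BC = zero_sum block_c"
begin

lemma finite_bases: "finite BA" "finite BB" "finite BC"
  using BA BB BC by (auto simp: zero_sum_basis_def)

lemma bases_zero_sum: "BA \<subseteq> zero_sum block_a" "BB \<subseteq> zero_sum block_b" "BC \<subseteq> zero_sum block_c"
  using BA BB BC by (auto simp: zero_sum_basis_def)

lemma bases_orthogonal:
  "x \<in> BA \<Longrightarrow> y \<in> BB \<Longrightarrow> x \<bullet> y = 0" "x \<in> BA \<Longrightarrow> y \<in> BC \<Longrightarrow> x \<bullet> y = 0" "x \<in> BB \<Longrightarrow> y \<in> BC \<Longrightarrow> x \<bullet> y = 0"
  using inner_zero_sum_disjoint[OF subsetD[OF bases_zero_sum(1)] subsetD[OF bases_zero_sum(2)] block_disjoint(1)]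
    inner_zero_sum_disjoint[OF subsetD[OF bases_zero_sum(1)] subsetD[OF bases_zero_sum(3)] block_disjoint(2)]
    inner_zero_sum_disjoint[OF subsetD[OF bases_zero_sum(2)] subsetD[OF bases_zero_sum(3)] block_disjoint(3)]
  by simp_all

lemma orthonormal_bases: "orthonormal_on (BA \<union> (BB \<union> BC)) (\<lambda>v. v)"
  by (rule orthonormal_on_Un[OF zero_sum_basis.orthonormal[OF BA(1)]
        orthonormal_on_Un[OF zero_sum_basis.orthonormal[OF BB(1)] zero_sum_basis.orthonormal[OF BC(1)]]])
     (auto simp: bases_orthogonal)

lemma disjoint_bases: "BA \<inter> (BB \<union> BC) = {}" "BB \<inter> BC = {}"
proof -
  have n: "x \<bullet> x = 1" if "x \<in> BA \<union> (BB \<union> BC)" for x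
    using orthonormal_onD[OF orthonormal_bases that that] by simp
  have "x \<notin> BB \<union> BC" if "x \<in> BA" for x
    using n[of x] bases_orthogonal[of x x] that by auto
  moreover have "x \<notin> BC" if "x \<in> BB" for x
    using n[of x] bases_orthogonal[of x x] that by auto
  ultimately show "BA \<inter> (BB \<union> BC) = {}" "BB \<inter> BC = {}" by auto
qed

lemma inner_block_vec_bases: "v \<in> BA \<union> (BB \<union> BC) \<Longrightarrow> block_vec p q r \<bullet> v = 0"
  by (rule inner_block_vec_zero_sum)
     (use subsetD[OF bases_zero_sum(1), of v] subsetD[OF bases_zero_sum(2), of v] subsetD[OF bases_zero_sum(3), of v]
       in blast)

text \<open>Reduces completeness of a basis of the whole space to a question about three block
  values.\<close>

lemma orthogonal_bases_imp_block_vec: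
  assumes "\<And>v. v \<in> BA \<union> (BB \<union> BC) \<Longrightarrow> x \<bullet> v = 0"
  obtains y1 y2 y3 where "x = block_vec y1 y2 y3"
proof -
  have sp: "x \<bullet> v = 0" if "\<And>v. v \<in> B \<Longrightarrow> x \<bullet> v = 0" "v \<in> span B" for v B
  proof -
    have "orthogonal x v"
      by (rule orthogonal_to_span[OF that(2)]) (simp add: orthogonal_def that(1))
    then show ?thesis by (simp add: orthogonal_def)
  qed
  have c: "\<exists>y. \<forall>i\<in>X. x $ i = y"
    if "\<And>v. v \<in> zero_sum X \<Longrightarrow> x \<bullet> v = 0" "X \<noteq> {}" for X
    using block_constant_if_orthogonal_zero_sum[OF that(1)] that(2) by blast
  have "x \<bullet> v = 0" if "v \<in> zero_sum block_a" for v
    using sp[of BA v] assms that unfolding BA(2) by auto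
  from c[OF this block_nonempty(1)] obtain y1 where "\<forall>i\<in>block_a. x $ i = y1" by blast
  moreover have "x \<bullet> v = 0" if "v \<in> zero_sum block_b" for v
    using sp[of BB v] assms that unfolding BB(2) by auto
  from c[OF this block_nonempty(2)] obtain y2 where "\<forall>i\<in>block_b. x $ i = y2" by blast
  moreover have "x \<bullet> v = 0" if "v \<in> zero_sum block_c" for v
    using sp[of BC v] assms that unfolding BC(2) by auto
  from c[OF this block_nonempty(3)] obtain y3 where "\<forall>i\<in>block_c. x $ i = y3" by blast
  ultimately have "x $ i = block_vec y1 y2 y3 $ i" for i
    using block_cases[of i] by (auto simp: block_vec_nth)
  then have "x = block_vec y1 y2 y3" by (simp add: vec_eq_iff)
  then show thesis by (rule that)
qed

end

section \<open>The volume of a central section\<close>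

context block_bases
begin

text \<open>The powers of 1/M come from the centroid's coordinates, 1/(M \<kappa>) from rescaling
  the remaining coordinate, and the last factors are the block simplices. It does not involve p, q,
  r, so positivity and finiteness suffice for comparing sections.\<close>

definition section_const :: ennreal where
  "section_const = (let a = CARD('a); b = CARD('b); c = CARD('c); M = real a + real b + real c in
     ennreal ((1 / M) ^ (a - 1) * (1 / M) ^ (b - 1) * (1 / M) ^ (c - 1)
       / (M * sqrt (real a * real b * real c / M)))
     * (block_volume BA block_a 1 * (block_volume BB block_b 1 * block_volume BC block_c 1)))"

lemma section_const_pos_finite: "section_const > 0" "section_const < top"
proof -
  note v = zero_sum_basis.block_volume_pos[OF BA(1)] zero_sum_basis.block_volume_pos[OF BB(1)]
    zero_sum_basis.block_volume_pos[OF BC(1)]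
  note w = zero_sum_basis.block_volume_finite[OF BA(1)] zero_sum_basis.block_volume_finite[OF BB(1)]
    zero_sum_basis.block_volume_finite[OF BC(1)]
  have M: "real CARD('a) + real CARD('b) + real CARD('c) > 0" by (simp add: add_pos_pos)
  show "section_const > 0"
    using v M by (auto simp: section_const_def Let_def ennreal_zero_less_mult_iff intro!: divide_pos_pos mult_pos_pos)
  show "section_const < top"
    using w by (auto simp: section_const_def Let_def ennreal_mult_less_top)
qed

text \<open>The coordinate along \<open>d\<close> is constant on each block, and each block basis
  affects only its own block. For a fixed coordinate y along \<open>d\<close> the constraints
  therefore separate into three block volumes.\<close>

lemma section_measure:
  fixes p q r M \<kappa> :: real
  defines "M \<equiv> real CARD('a) + real CARD('b) + real CARD('c)"
    and "\<kappa> \<equiv> sqrt (real CARD('a) * real CARD('b) * real CARD('c) / (real CARD('a) + real CARD('b) + real CARD('c)))"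
  defines "d \<equiv> block_vec (\<kappa> * (q - r) / real CARD('a)) (\<kappa> * (r - p) / real CARD('b)) (\<kappa> * (p - q) / real CARD('c))"
    and "B \<equiv> BA \<union> (BB \<union> BC)"
  assumes d: "d \<notin> B"
  shows "emeasure (PiM (insert d B) (\<lambda>_. lborel))
      {t \<in> insert d B \<rightarrow>\<^sub>E UNIV. \<forall>i. 0 \<le> 1 / M + (\<Sum>v\<in>insert d B. t v *\<^sub>R v) $ i}
    = section_const * section_integral CARD('a) CARD('b) CARD('c) p q r"
proof -
  have M: "M > 0" by (simp add: M_def add_pos_pos)
  have \<kappa>: "\<kappa> > 0" unfolding \<kappa>_def using M by (simp add: M_def)
  define dA where "dA = \<kappa> * (q - r) / real CARD('a)"
  define dB where "dB = \<kappa> * (r - p) / real CARD('b)"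
  define dC where "dC = \<kappa> * (p - q) / real CARD('c)"
  have finB: "finite B" using finite_bases by (simp add: B_def)
  have sum: "(\<Sum>v\<in>insert d B. t v *\<^sub>R v) $ i = t d * d $ i + ((\<Sum>v\<in>BA. t v * v $ i) + ((\<Sum>v\<in>BB. t v * v $ i) + (\<Sum>v\<in>BC. t v * v $ i)))"
    for t :: "real ^ ('a + 'b + 'c) \<Rightarrow> real" and i
    using d finB finite_bases disjoint_bases by (simp add: B_def sum.union_disjoint)
  have zA: "(\<Sum>v\<in>BA. t v * v $ i) = 0" if "i \<notin> block_a" for t :: "real ^ ('a + 'b + 'c) \<Rightarrow> real" and i
    using bases_zero_sum(1) that by (intro sum.neutral) (auto simp: zero_sum_def)
  have zB: "(\<Sum>v\<in>BB. t v * v $ i) = 0" if "i \<notin> block_b" for t :: "real ^ ('a + 'b + 'c) \<Rightarrow> real" and i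
    using bases_zero_sum(2) that by (intro sum.neutral) (auto simp: zero_sum_def)
  have zC: "(\<Sum>v\<in>BC. t v * v $ i) = 0" if "i \<notin> block_c" for t :: "real ^ ('a + 'b + 'c) \<Rightarrow> real" and i
    using bases_zero_sum(3) that by (intro sum.neutral) (auto simp: zero_sum_def)
  have notin: "i \<in> block_a \<Longrightarrow> i \<notin> block_b \<and> i \<notin> block_c" "i \<in> block_b \<Longrightarrow> i \<notin> block_a \<and> i \<notin> block_c"
    "i \<in> block_c \<Longrightarrow> i \<notin> block_a \<and> i \<notin> block_b" for i :: "'a + 'b + 'c"
    by (auto simp: block_a_def block_b_def block_c_def)
  have dn: "i \<in> block_a \<Longrightarrow> d $ i = dA" "i \<in> block_b \<Longrightarrow> d $ i = dB" "i \<in> block_c \<Longrightarrow> d $ i = dC" for i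
    by (simp_all add: d_def dA_def dB_def dC_def block_vec_nth)
  have compA: "(\<Sum>v\<in>insert d B. t v *\<^sub>R v) $ i = dA * t d + (\<Sum>v\<in>BA. t v * v $ i)" if "i \<in> block_a"
    for t :: "real ^ ('a + 'b + 'c) \<Rightarrow> real" and i
    unfolding sum dn(1)[OF that] using notin(1)[OF that] by (simp add: zB zC)
  have compB: "(\<Sum>v\<in>insert d B. t v *\<^sub>R v) $ i = dB * t d + (\<Sum>v\<in>BB. t v * v $ i)" if "i \<in> block_b"
    for t :: "real ^ ('a + 'b + 'c) \<Rightarrow> real" and i
    unfolding sum dn(2)[OF that] using notin(2)[OF that] by (simp add: zA zC)
  have compC: "(\<Sum>v\<in>insert d B. t v *\<^sub>R v) $ i = dC * t d + (\<Sum>v\<in>BC. t v * v $ i)" if "i \<in> block_c"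
    for t :: "real ^ ('a + 'b + 'c) \<Rightarrow> real" and i
    unfolding sum dn(3)[OF that] using notin(3)[OF that] by (simp add: zA zB)
  define gA where "gA = (\<lambda>y. block_indicator BA block_a (1 / M + dA * y))"
  define gB where "gB = (\<lambda>y. block_indicator BB block_b (1 / M + dB * y))"
  define gC where "gC = (\<lambda>y. block_indicator BC block_c (1 / M + dC * y))"
  have all: "(\<forall>i. P i) \<longleftrightarrow> (\<forall>i\<in>block_a. P i) \<and> (\<forall>i\<in>block_b. P i) \<and> (\<forall>i\<in>block_c. P i)"
    for P :: "'a + 'b + 'c \<Rightarrow> bool"
    using block_cases by blast
  have ind: "indicator {t \<in> insert d B \<rightarrow>\<^sub>E UNIV. \<forall>i. 0 \<le> 1 / M + (\<Sum>v\<in>insert d B. t v *\<^sub>R v) $ i} t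
      = gA (t d) t * (gB (t d) t * gC (t d) t)" if "t \<in> space (PiM (insert d B) (\<lambda>_. lborel :: real measure))" for t
  proof -
    have "(\<forall>i. 0 \<le> 1 / M + (\<Sum>v\<in>insert d B. t v *\<^sub>R v) $ i) \<longleftrightarrow>
       (\<forall>i\<in>block_a. 0 \<le> (1 / M + dA * t d) + (\<Sum>v\<in>BA. t v * v $ i)) \<and>
       (\<forall>i\<in>block_b. 0 \<le> (1 / M + dB * t d) + (\<Sum>v\<in>BB. t v * v $ i)) \<and>
       (\<forall>i\<in>block_c. 0 \<le> (1 / M + dC * t d) + (\<Sum>v\<in>BC. t v * v $ i))"
      unfolding all by (intro conj_cong ball_cong refl; simp only: compA compB compC add.assoc)
    moreover have "t \<in> insert d B \<rightarrow>\<^sub>E UNIV" using that by (simp add: space_PiM)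
    ultimately show ?thesis unfolding gA_def gB_def gC_def block_indicator_def by simp
  qed
  have meas: "(\<lambda>t. gA (t d) t) \<in> borel_measurable (PiM (insert d B) (\<lambda>_. lborel))"
    "(\<lambda>t. gB (t d) t) \<in> borel_measurable (PiM (insert d B) (\<lambda>_. lborel))"
    "(\<lambda>t. gC (t d) t) \<in> borel_measurable (PiM (insert d B) (\<lambda>_. lborel))"
  proof -
    have [measurable]: "(\<lambda>t. t d) \<in> borel_measurable (PiM (insert d B) (\<lambda>_. lborel :: real measure))"
      using measurable_component_singleton[of d "insert d B" "\<lambda>_. lborel :: real measure"] by simp
    have cm: "(\<lambda>t. 1 / M + x * t d) \<in> borel_measurable (PiM (insert d B) (\<lambda>_. lborel))" for x
      by measurable
    have sub: "BA \<subseteq> insert d B" "BB \<subseteq> insert d B" "BC \<subseteq> insert d B" by (auto simp: B_def)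
    show "(\<lambda>t. gA (t d) t) \<in> borel_measurable (PiM (insert d B) (\<lambda>_. lborel))"
      unfolding gA_def by (rule block_indicator_measurable[OF sub(1) cm])
    show "(\<lambda>t. gB (t d) t) \<in> borel_measurable (PiM (insert d B) (\<lambda>_. lborel))"
      unfolding gB_def by (rule block_indicator_measurable[OF sub(2) cm])
    show "(\<lambda>t. gC (t d) t) \<in> borel_measurable (PiM (insert d B) (\<lambda>_. lborel))"
      unfolding gC_def by (rule block_indicator_measurable[OF sub(3) cm])
  qed
  have upd: "gA y (t(d := x)) = gA y t" "gB y (t(d := x)) = gB y t" "gC y (t(d := x)) = gC y t" for y x t
    unfolding gA_def gB_def gC_def using d by (auto intro!: block_indicator_cong simp: B_def)
  have set_meas: "{t \<in> insert d B \<rightarrow>\<^sub>E UNIV. \<forall>i. 0 \<le> 1 / M + (\<Sum>v\<in>insert d B. t v *\<^sub>R v) $ i}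
      \<in> sets (PiM (insert d B) (\<lambda>_. lborel :: real measure))"
    using block_set_measurable[of "insert d B" UNIV "1 / M"] finB by simp
  have "emeasure (PiM (insert d B) (\<lambda>_. lborel))
      {t \<in> insert d B \<rightarrow>\<^sub>E UNIV. \<forall>i. 0 \<le> 1 / M + (\<Sum>v\<in>insert d B. t v *\<^sub>R v) $ i}
    = (\<integral>\<^sup>+ t. indicator {t \<in> insert d B \<rightarrow>\<^sub>E UNIV. \<forall>i. 0 \<le> 1 / M + (\<Sum>v\<in>insert d B. t v *\<^sub>R v) $ i} t
        \<partial>PiM (insert d B) (\<lambda>_. lborel))"
    by (rule nn_integral_indicator[OF set_meas, symmetric])
  also have "\<dots> = (\<integral>\<^sup>+ t. gA (t d) t * (gB (t d) t * gC (t d) t) \<partial>PiM (insert d B) (\<lambda>_. lborel))"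
    by (intro nn_integral_cong ind)
  also have "\<dots> = (\<integral>\<^sup>+ y. (\<integral>\<^sup>+ t. gA y t * (gB y t * gC y t) \<partial>PiM B (\<lambda>_. lborel)) \<partial>lborel)"
    using finB d meas
    by (subst lborel_PiM.product_nn_integral_insert_rev) (auto simp: upd)
  also have "\<dots> = (\<integral>\<^sup>+ y. block_volume BA block_a (1 / M + dA * y) *
      (block_volume BB block_b (1 / M + dB * y) * block_volume BC block_c (1 / M + dC * y)) \<partial>lborel)"
  proof (rule nn_integral_cong)
    fix y :: real
    have m: "gA y \<in> borel_measurable (PiM K (\<lambda>_. lborel))" if "BA \<subseteq> K" for K
      unfolding gA_def using block_indicator_measurable[OF that, of "\<lambda>_. 1 / M + dA * y"] by simp
    have mB: "gB y \<in> borel_measurable (PiM K (\<lambda>_. lborel))" if "BB \<subseteq> K" for K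
      unfolding gB_def using block_indicator_measurable[OF that, of "\<lambda>_. 1 / M + dB * y"] by simp
    have mC: "gC y \<in> borel_measurable (PiM K (\<lambda>_. lborel))" if "BC \<subseteq> K" for K
      unfolding gC_def using block_indicator_measurable[OF that, of "\<lambda>_. 1 / M + dC * y"] by simp
    have cA: "gA y t = gA y t'" if "\<And>v. v \<in> BA \<Longrightarrow> t v = t' v" for t t'
      unfolding gA_def using that by (rule block_indicator_cong)
    have cB: "gB y t = gB y t'" if "\<And>v. v \<in> BB \<Longrightarrow> t v = t' v" for t t'
      unfolding gB_def using that by (rule block_indicator_cong)
    have cC: "gC y t = gC y t'" if "\<And>v. v \<in> BC \<Longrightarrow> t v = t' v" for t t'
      unfolding gC_def using that by (rule block_indicator_cong)
    have "(\<integral>\<^sup>+ t. gA y t * (gB y t * gC y t) \<partial>PiM B (\<lambda>_. lborel))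
       = (\<integral>\<^sup>+ t. gA y t \<partial>PiM BA (\<lambda>_. lborel)) * (\<integral>\<^sup>+ t. gB y t * gC y t \<partial>PiM (BB \<union> BC) (\<lambda>_. lborel))"
      unfolding B_def
    proof (rule product_nn_integral_separate[OF disjoint_bases(1) finite_bases(1) _ m _ cA])
      show "finite (BB \<union> BC)" using finite_bases by simp
      show "(\<lambda>t. gB y t * gC y t) \<in> borel_measurable (PiM K (\<lambda>_. lborel))" if "BB \<union> BC \<subseteq> K" for K
        using that by (intro borel_measurable_times_ennreal mB mC) auto
      show "gB y t * gC y t = gB y t' * gC y t'" if "\<And>v. v \<in> BB \<union> BC \<Longrightarrow> t v = t' v" for t t'
        using cB[of t t'] cC[of t t'] that by simp
    qed
    also have "(\<integral>\<^sup>+ t. gB y t * gC y t \<partial>PiM (BB \<union> BC) (\<lambda>_. lborel))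
       = (\<integral>\<^sup>+ t. gB y t \<partial>PiM BB (\<lambda>_. lborel)) * (\<integral>\<^sup>+ t. gC y t \<partial>PiM BC (\<lambda>_. lborel))"
      by (rule product_nn_integral_separate[OF disjoint_bases(2) finite_bases(2,3) mB mC cB cC])
    finally show "(\<integral>\<^sup>+ t. gA y t * (gB y t * gC y t) \<partial>PiM B (\<lambda>_. lborel)) = block_volume BA block_a (1 / M + dA * y) *
      (block_volume BB block_b (1 / M + dB * y) * block_volume BC block_c (1 / M + dC * y))"
      unfolding gA_def gB_def gC_def by (simp add: nn_integral_block_indicator finite_bases)
  qed
  \<comment> \<open>Each base 1/M + \<open>dA\<close> y (likewise \<open>dB\<close>,
    \<open>dC\<close>) is 1/M times the base in \<open>section_integral\<close> at (M \<kappa>) y;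
    the summand 0 only matches the affine substitution rule used next.\<close>
  also have "\<dots> = (\<integral>\<^sup>+ y. ennreal ((1 / M) ^ (CARD('a) - 1) * (1 / M) ^ (CARD('b) - 1) * (1 / M) ^ (CARD('c) - 1)) *
      (block_volume BA block_a 1 * (block_volume BB block_b 1 * block_volume BC block_c 1)) *
      ennreal (pos_pow (CARD('a) - 1) (1 + (q - r) * (0 + (M * \<kappa>) * y) / real CARD('a))
       * pos_pow (CARD('b) - 1) (1 + (r - p) * (0 + (M * \<kappa>) * y) / real CARD('b))
       * pos_pow (CARD('c) - 1) (1 + (p - q) * (0 + (M * \<kappa>) * y) / real CARD('c))) \<partial>lborel)"
  proof (rule nn_integral_cong)
    fix y :: real
    have e: "1 / M + \<kappa> * s / k * y = (1 / M) * (1 + s * (0 + (M * \<kappa>) * y) / k)" for s k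
      using M by (simp add: field_simps)
    have iM: "1 / M > 0" using M by simp
    show "block_volume BA block_a (1 / M + dA * y) *
      (block_volume BB block_b (1 / M + dB * y) * block_volume BC block_c (1 / M + dC * y))
     = ennreal ((1 / M) ^ (CARD('a) - 1) * (1 / M) ^ (CARD('b) - 1) * (1 / M) ^ (CARD('c) - 1)) *
      (block_volume BA block_a 1 * (block_volume BB block_b 1 * block_volume BC block_c 1)) *
      ennreal (pos_pow (CARD('a) - 1) (1 + (q - r) * (0 + (M * \<kappa>) * y) / real CARD('a))
       * pos_pow (CARD('b) - 1) (1 + (r - p) * (0 + (M * \<kappa>) * y) / real CARD('b))
       * pos_pow (CARD('c) - 1) (1 + (p - q) * (0 + (M * \<kappa>) * y) / real CARD('c)))"
      unfolding zero_sum_basis.block_volume_eq[OF BA(1), of "1 / M + dA * y"]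
        zero_sum_basis.block_volume_eq[OF BB(1), of "1 / M + dB * y"]
        zero_sum_basis.block_volume_eq[OF BC(1), of "1 / M + dC * y"] card_block
      unfolding dA_def dB_def dC_def e pos_pow_mult[OF iM]
      using iM by (simp add: ennreal_mult' ennreal_mult'' mult_ac del: add_0)
  qed
  also have "\<dots> = ennreal ((1 / M) ^ (CARD('a) - 1) * (1 / M) ^ (CARD('b) - 1) * (1 / M) ^ (CARD('c) - 1)) *
      (block_volume BA block_a 1 * (block_volume BB block_b 1 * block_volume BC block_c 1)) *
     (\<integral>\<^sup>+ y. ennreal (pos_pow (CARD('a) - 1) (1 + (q - r) * (0 + (M * \<kappa>) * y) / real CARD('a))
       * pos_pow (CARD('b) - 1) (1 + (r - p) * (0 + (M * \<kappa>) * y) / real CARD('b))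
       * pos_pow (CARD('c) - 1) (1 + (p - q) * (0 + (M * \<kappa>) * y) / real CARD('c))) \<partial>lborel)"
    (is "_ = _ * ?J")
    by (rule nn_integral_cmult) measurable
  also have "?J = ennreal (1 / (M * \<kappa>)) * section_integral CARD('a) CARD('b) CARD('c) p q r"
  proof -
    have "M * \<kappa> \<noteq> 0" using M \<kappa> by simp
    have "section_integral CARD('a) CARD('b) CARD('c) p q r = ennreal \<bar>M * \<kappa>\<bar> * ?J"
      unfolding section_integral_def by (rule nn_integral_real_affine[OF _ \<open>M * \<kappa> \<noteq> 0\<close>]) measurable
    also have "\<bar>M * \<kappa>\<bar> = M * \<kappa>" using M \<kappa> by simp
    finally have "ennreal (1 / (M * \<kappa>)) * section_integral CARD('a) CARD('b) CARD('c) p q r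
       = ennreal (1 / (M * \<kappa>)) * ennreal (M * \<kappa>) * ?J" by (simp only: mult.assoc)
    also have "ennreal (1 / (M * \<kappa>)) * ennreal (M * \<kappa>) = ennreal (1 / (M * \<kappa>) * (M * \<kappa>))"
      using M \<kappa> by (intro ennreal_mult[symmetric]) auto
    also have "1 / (M * \<kappa>) * (M * \<kappa>) = 1" using M \<kappa> by simp
    finally show ?thesis by simp
  qed
  also have "ennreal ((1 / M) ^ (CARD('a) - 1) * (1 / M) ^ (CARD('b) - 1) * (1 / M) ^ (CARD('c) - 1)) *
      (block_volume BA block_a 1 * (block_volume BB block_b 1 * block_volume BC block_c 1)) *
      (ennreal (1 / (M * \<kappa>)) * section_integral CARD('a) CARD('b) CARD('c) p q r)
     = section_const * section_integral CARD('a) CARD('b) CARD('c) p q r"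
  proof -
    have "ennreal ((1 / M) ^ (CARD('a) - 1) * (1 / M) ^ (CARD('b) - 1) * (1 / M) ^ (CARD('c) - 1)) * ennreal (1 / (M * \<kappa>))
      = ennreal ((1 / M) ^ (CARD('a) - 1) * (1 / M) ^ (CARD('b) - 1) * (1 / M) ^ (CARD('c) - 1) * (1 / (M * \<kappa>)))"
      using M \<kappa> by (intro ennreal_mult[symmetric]) auto
    then show ?thesis
      unfolding section_const_def Let_def M_def \<kappa>_def by (simp add: mult_ac)
  qed
  finally show ?thesis .
qed

end

context block_bases
begin

text \<open>The section lies in the flat of codimension two through the centroid, orthogonal to the
  all-ones vector and to the given vector, hence k + 2. Thickening passes from the unknown frame to
  the basis consisting of \<open>d\<close> and the block bases.\<close>

lemma flat_volume_section:
  assumes bc: "block_constraints CARD('a) CARD('b) CARD('c) p q r"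
    and k: "k + 2 = CARD('a) + CARD('b) + CARD('c)"
  shows "ennreal (flat_volume k (standard_simplex \<inter> hyperplane_perp (block_vec p q r :: real ^ ('a + 'b + 'c))))
    = section_const * section_integral CARD('a) CARD('b) CARD('c) p q r"
proof -
  define \<alpha> \<beta> \<gamma> where "\<alpha> = real CARD('a)" and "\<beta> = real CARD('b)" and "\<gamma> = real CARD('c)"
  define M where "M = \<alpha> + \<beta> + \<gamma>"
  have pos: "\<alpha> > 0" "\<beta> > 0" "\<gamma> > 0" by (auto simp: \<alpha>_def \<beta>_def \<gamma>_def)
  have M: "M > 0" using pos by (simp add: M_def)
  have c1: "\<alpha> * p + \<beta> * q + \<gamma> * r = 0" and c2: "\<alpha> * p\<^sup>2 + \<beta> * q\<^sup>2 + \<gamma> * r\<^sup>2 = 1"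
    using bc by (simp_all add: block_constraints_def \<alpha>_def \<beta>_def \<gamma>_def)
  define \<kappa> where "\<kappa> = sqrt (\<alpha> * \<beta> * \<gamma> / M)"
  have \<kappa>: "\<kappa> > 0" "\<kappa>\<^sup>2 = \<alpha> * \<beta> * \<gamma> / M" using pos M by (simp_all add: \<kappa>_def)
  \<comment> \<open>\<open>e0\<close> is the centroid of the simplex and lies on the hyperplane
    because the coordinates of \<open>u2\<close> sum to zero. \<open>d\<close> is the weighted cross
    product of \<open>u1\<close> and \<open>u2\<close>; \<kappa> is the factor that makes it a unit
    vector, by \<open>weighted_lagrange\<close>.\<close>
  define e0 u1 u2 d :: "real ^ ('a + 'b + 'c)"
    where "e0 = block_vec (1 / M) (1 / M) (1 / M)"
      and "u1 = block_vec (1 / sqrt M) (1 / sqrt M) (1 / sqrt M)"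
      and "u2 = block_vec p q r"
      and "d = block_vec (\<kappa> * (q - r) / \<alpha>) (\<kappa> * (r - p) / \<beta>) (\<kappa> * (p - q) / \<gamma>)"
  define B where "B = BA \<union> (BB \<union> BC)"
  define S where "S = standard_simplex \<inter> hyperplane_perp u2"
  note ip = inner_block_vec_block_vec[where ?'a = 'a and ?'b = 'b and ?'c = 'c, folded \<alpha>_def \<beta>_def \<gamma>_def]
  have u11: "u1 \<bullet> u1 = 1"
    using M by (simp add: u1_def ip M_def[symmetric] add_divide_distrib[symmetric])
  have u12: "u1 \<bullet> u2 = 0"
    using c1 by (simp add: u1_def u2_def ip add_divide_distrib[symmetric])
  have u22: "u2 \<bullet> u2 = 1"
    using c2 by (simp add: u2_def ip power2_eq_square)
  have canc: "\<alpha> * (x * (y / \<alpha>)) = x * y" "\<beta> * (x * (y / \<beta>)) = x * y" "\<gamma> * (x * (y / \<gamma>)) = x * y" for x y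
    using pos by simp_all
  have u1d: "u1 \<bullet> d = 0"
  proof -
    have "u1 \<bullet> d = 1 / sqrt M * \<kappa> * ((q - r) + (r - p) + (p - q))"
      unfolding u1_def d_def ip canc by (simp add: algebra_simps)
    then show ?thesis by simp
  qed
  have u2d: "u2 \<bullet> d = 0"
    unfolding u2_def d_def ip canc by (simp add: algebra_simps)
  have dd: "d \<bullet> d = 1"
  proof -
    have frac: "\<alpha> * \<beta> * \<gamma> / M * (x / \<alpha> + y / \<beta> + z / \<gamma>) = (\<beta> * \<gamma> * x + \<alpha> * \<gamma> * y + \<alpha> * \<beta> * z) / M" for x y z
      using pos M by (simp add: field_simps)
    have "d \<bullet> d = \<kappa>\<^sup>2 * ((q - r)\<^sup>2 / \<alpha> + (r - p)\<^sup>2 / \<beta> + (p - q)\<^sup>2 / \<gamma>)"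
      unfolding d_def ip canc by (simp add: power2_eq_square distrib_left mult_ac)
    also have "\<dots> = (\<beta> * \<gamma> * (q - r)\<^sup>2 + \<alpha> * \<gamma> * (r - p)\<^sup>2 + \<alpha> * \<beta> * (p - q)\<^sup>2) / M"
      unfolding \<kappa>(2) by (rule frac)
    also have "\<dots> = 1"
      unfolding weighted_lagrange c1 c2 using M by (simp add: M_def)
    finally show ?thesis .
  qed
  define J where "J = insert u1 (insert u2 (insert d B))"
  have bv: "u1 \<bullet> v = 0" "u2 \<bullet> v = 0" "d \<bullet> v = 0" if "v \<in> B" for v
    using inner_block_vec_bases[of v] that by (simp_all add: u1_def u2_def d_def B_def)
  have onB: "orthonormal_on B (\<lambda>v. v)" using orthonormal_bases by (simp add: B_def)
  have onI: "orthonormal_on (insert d B) (\<lambda>v. v)"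
    by (rule orthonormal_on_insert[OF onB dd bv(3)])
  have onJ: "orthonormal_on J (\<lambda>v. v)"
    unfolding J_def
    by (intro orthonormal_on_insert onI u11 u22) (auto simp: u12 u1d u2d bv)
  have finB: "finite B" using finite_bases by (simp add: B_def)
  have finJ: "finite J" using finB by (simp add: J_def)
  have dB: "d \<notin> B" using bv(3)[of d] dd by auto
  have u2I: "u2 \<notin> insert d B" using bv(2)[of u2] u2d u22 by auto
  have u1I: "u1 \<notin> insert d B" using bv(1)[of u1] u1d u11 by auto
  have u1u2: "u1 \<noteq> u2" using u12 u11 by auto
  have complete: "x = 0" if x: "\<And>v. v \<in> J \<Longrightarrow> x \<bullet> v = 0" for x
  proof -
    obtain y1 y2 y3 where y: "x = block_vec y1 y2 y3"
      using orthogonal_bases_imp_block_vec[of x] x by (auto simp: J_def B_def)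
    have "u1 \<bullet> x = 0" "u2 \<bullet> x = 0" "d \<bullet> x = 0"
      using x by (simp_all add: J_def inner_commute)
    then have 1: "\<alpha> * y1 + \<beta> * y2 + \<gamma> * y3 = 0"
      and 2: "\<alpha> * (p * y1) + \<beta> * (q * y2) + \<gamma> * (r * y3) = 0"
      and 3: "\<kappa> * ((q - r) * y1 + (r - p) * y2 + (p - q) * y3) = 0"
      using pos M unfolding u1_def u2_def d_def y ip
      by (simp_all add: add_divide_distrib[symmetric] distrib_left mult.assoc)
    then have "y1 = 0 \<and> y2 = 0 \<and> y3 = 0"
      using three_orthogonal_zero[OF pos c1 c2 1 2] \<kappa>(1) by simp
    then show "x = 0" by (simp add: y vec_eq_iff block_vec_def split: sum.split)
  qed
  have DIM: "DIM(real ^ ('a + 'b + 'c)) = CARD('a) + CARD('b) + CARD('c)"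
    using sum_blocks[of "\<lambda>_ :: 'a + 'b + 'c. 1 :: nat"] by (simp add: card_block)
  have card: "card (insert d B) + 2 = DIM(real ^ ('a + 'b + 'c))"
    using orthonormal_complete_card[OF onJ complete] u1I u2I u1u2 finB by (simp add: J_def)
  have kI: "k = card (insert d B)" using card DIM k by simp
  have u1_sum: "u1 \<bullet> x = (\<Sum>i\<in>UNIV. x $ i) / sqrt M" for x
    unfolding u1_def inner_block_vec sum_blocks[of "\<lambda>i. x $ i"] by (simp add: add_divide_distrib)
  have e0_nth: "e0 $ i = 1 / M" for i
    using block_cases[of i] by (auto simp: e0_def block_vec_nth)
  have e0_sum: "(\<Sum>i\<in>UNIV. e0 $ i) = 1"
    using M DIM by (simp add: e0_nth M_def \<alpha>_def \<beta>_def \<gamma>_def)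
  have e0_u2: "u2 \<bullet> e0 = 0"
    using c1 unfolding u2_def e0_def ip by (simp add: add_divide_distrib[symmetric])
  have memS: "e0 + w \<in> S \<longleftrightarrow> (\<forall>i. 0 \<le> 1 / M + w $ i)" if "u1 \<bullet> w = 0" "u2 \<bullet> w = 0" for w
    using that M e0_sum e0_u2
    by (simp add: S_def standard_simplex_eq hyperplane_perp_def e0_nth sum.distrib u1_sum inner_add_right)
  have S_orth: "u1 \<bullet> (s - e0) = 0" "u2 \<bullet> (s - e0) = 0" if "s \<in> S" for s
    using that e0_sum e0_u2
    by (simp_all add: S_def standard_simplex_eq hyperplane_perp_def u1_sum sum_subtractf inner_diff_right)
  have expand: "w = (\<Sum>v\<in>insert d B. (w \<bullet> v) *\<^sub>R v)" if "u1 \<bullet> w = 0" "u2 \<bullet> w = 0" for w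
  proof -
    have "w = (\<Sum>v\<in>J. (w \<bullet> v) *\<^sub>R v)" by (rule orthonormal_expansion[OF onJ finJ complete])
    also have "\<dots> = (\<Sum>v\<in>insert d B. (w \<bullet> v) *\<^sub>R v)"
      unfolding J_def using u1I u2I u1u2 finB that by (simp add: inner_commute)
    finally show ?thesis .
  qed
  have compS: "compact S"
    unfolding S_def by (intro compact_Int_closed compact_standard_simplex closed_hyperplane_perp)
  have combo: "u1 \<bullet> (\<Sum>v\<in>insert d B. t v *\<^sub>R v) = 0" "u2 \<bullet> (\<Sum>v\<in>insert d B. t v *\<^sub>R v) = 0" for t
    by (auto simp: inner_sum_right u1d u2d bv intro!: sum.neutral)
  obtain f where f: "bij_betw f {..<k} (insert d B)"
    using ex_bij_betw_nat_finite[of "insert d B"] finB kI by (auto simp: atLeast0LessThan)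
  have frame: "orthonormal_frame k f"
    unfolding orthonormal_frame_def
  proof (intro allI impI)
    fix i j assume ij: "i < k" "j < k"
    then have "f i \<in> insert d B" "f j \<in> insert d B" using bij_betwE[OF f] by auto
    moreover have "f i = f j \<longleftrightarrow> i = j"
      using ij inj_on_eq_iff[OF bij_betw_imp_inj_on[OF f]] by simp
    ultimately show "f i \<bullet> f j = (if i = j then 1 else 0)"
      using orthonormal_onD[OF onI, of "f i" "f j"] by (simp only:)
  qed
  have sub: "S \<subseteq> range (frame_point k e0 f)"
  proof
    fix s assume s: "s \<in> S"
    have "s = e0 + (\<Sum>v\<in>insert d B. ((s - e0) \<bullet> v) *\<^sub>R v)"
      using expand[OF S_orth[OF s]] by (simp add: algebra_simps)
    also have "\<dots> = frame_point k e0 f (\<lambda>i. (s - e0) \<bullet> f i)"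
      unfolding frame_point_def using sum.reindex_bij_betw[OF f, of "\<lambda>v. ((s - e0) \<bullet> v) *\<^sub>R v"] by simp
    finally show "s \<in> range (frame_point k e0 f)" by blast
  qed
  \<comment> \<open>The centroid is a relative interior point of the section, so any flat containing
    S contains every direction orthogonal to \<open>u1\<close> and \<open>u2\<close>; a flat of
    dimension k has room for no others.\<close>
  have orth: "b i \<bullet> u1 = 0 \<and> b i \<bullet> u2 = 0"
    if b: "orthonormal_frame k b" and Sb: "S \<subseteq> range (frame_point k c b)" and i: "i < k" for c b i
  proof -
    have diff: "frame_point k c b t - frame_point k c b t' \<in> span (b ` {..<k})" for t t'
    proof -
      have "(\<Sum>i<k. t i *\<^sub>R b i) \<in> span (b ` {..<k})" for t :: "nat \<Rightarrow> real"
        by (intro span_sum span_scale) (simp add: span_base)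
      then show ?thesis by (simp add: frame_point_def span_diff)
    qed
    have "w \<in> span (b ` {..<k})" if w: "u1 \<bullet> w = 0" "u2 \<bullet> w = 0" for w
    proof -
      \<comment> \<open>Small enough that no coordinate of the centroid becomes negative; the added
        1 covers w = 0.\<close>
      define \<epsilon> where "\<epsilon> = 1 / (M * (norm w + 1))"
      have \<epsilon>: "\<epsilon> > 0" using M by (simp add: \<epsilon>_def add_nonneg_pos)
      have "e0 + \<epsilon> *\<^sub>R w \<in> S"
      proof -
        have "0 \<le> 1 / M + (\<epsilon> *\<^sub>R w) $ i" for i
        proof -
          have "\<epsilon> * \<bar>w $ i\<bar> \<le> \<epsilon> * (norm w + 1)"
            using component_le_norm_cart[of w i] \<epsilon> by (intro mult_left_mono) auto
          also have "\<dots> = 1 / M" unfolding \<epsilon>_def using M by (simp add: add_nonneg_eq_0_iff)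
          finally have "\<epsilon> * \<bar>w $ i\<bar> \<le> 1 / M" .
          moreover have "- (\<epsilon> * \<bar>w $ i\<bar>) \<le> \<epsilon> * w $ i"
            using mult_left_mono[of "- \<bar>w $ i\<bar>" "w $ i" \<epsilon>] \<epsilon> by simp
          ultimately show ?thesis by simp
        qed
        then show ?thesis using memS[of "\<epsilon> *\<^sub>R w"] w by simp
      qed
      then obtain t where t: "e0 + \<epsilon> *\<^sub>R w = frame_point k c b t" using Sb by blast
      have "e0 \<in> S" using memS[of 0] M by simp
      then obtain t' where "e0 = frame_point k c b t'" using Sb by blast
      with t diff[of t t'] have "\<epsilon> *\<^sub>R w \<in> span (b ` {..<k})" by (metis add_diff_cancel_left')
      then have "(1 / \<epsilon>) *\<^sub>R (\<epsilon> *\<^sub>R w) \<in> span (b ` {..<k})" by (rule span_scale)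
      then show ?thesis using \<epsilon> by simp
    qed
    moreover have "u1 \<bullet> v = 0 \<and> u2 \<bullet> v = 0" if "v \<in> insert d B" for v
      using that u1d u2d bv by auto
    ultimately have le: "insert d B \<subseteq> span (b ` {..<k})" by blast
    \<comment> \<open>One inclusion is \<open>le\<close>; the k vectors of the frame span at most k
      dimensions, which the left side already has.\<close>
    have "span (insert d B) = span (b ` {..<k})"
    proof (rule subspace_dim_equal)
      show "span (insert d B) \<subseteq> span (b ` {..<k})" using le by (rule span_minimal) simp
      have "dim (span (b ` {..<k})) \<le> card (b ` {..<k})" by (simp add: dim_le_card')
      also have "\<dots> \<le> k" using card_image_le[of "{..<k}" b] by simp
      also have "k = dim (insert d B)"
        using kI dim_eq_card_independent[OF orthonormal_on_independent[OF onI]] by simp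
      finally show "dim (span (b ` {..<k})) \<le> dim (span (insert d B))" by simp
    qed auto
    then have "b i \<in> span (insert d B)" using i by (auto intro: span_base)
    moreover have "span (insert d B) \<subseteq> {x. u1 \<bullet> x = 0 \<and> u2 \<bullet> x = 0}"
      by (rule span_minimal) (auto simp: u1d u2d bv subspace_def inner_add_right)
    ultimately show ?thesis by (auto simp: inner_commute)
  qed
  have "ennreal (flat_volume k S) = emeasure lborel (thickened S u1 u2)"
  proof (rule flat_volume_eq_thickened[OF compS _ _ _ u12 frame sub])
    show "k + 2 = DIM(real ^ ('a + 'b + 'c))" using k DIM by simp
    show "norm u1 = 1" "norm u2 = 1" using u11 u22 by (simp_all add: norm_eq_1)
  qed (rule orth)
  also have "\<dots> = emeasure (PiM (insert d B) (\<lambda>_. lborel))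
      {t \<in> insert d B \<rightarrow>\<^sub>E UNIV. e0 + (\<Sum>v\<in>insert d B. t v *\<^sub>R v) \<in> S}"
  proof (rule emeasure_thickened[symmetric, where b = "\<lambda>v. v"])
    show "orthonormal_on (insert u1 (insert u2 (insert d B))) (\<lambda>v. v)" using onJ by (simp only: J_def)
    show "\<exists>t. s = e0 + (\<Sum>v\<in>insert d B. t v *\<^sub>R v)" if "s \<in> S" for s
    proof
      show "s = e0 + (\<Sum>v\<in>insert d B. ((s - e0) \<bullet> v) *\<^sub>R v)"
        unfolding expand[OF S_orth[OF that], symmetric] by simp
    qed
  qed (use finB u1I u2I u1u2 card compS in auto)
  also have "{t \<in> insert d B \<rightarrow>\<^sub>E UNIV. e0 + (\<Sum>v\<in>insert d B. t v *\<^sub>R v) \<in> S}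
     = {t \<in> insert d B \<rightarrow>\<^sub>E UNIV. \<forall>i. 0 \<le> 1 / M + (\<Sum>v\<in>insert d B. t v *\<^sub>R v) $ i}"
    using memS[OF combo] by blast
  also have "emeasure (PiM (insert d B) (\<lambda>_. lborel)) \<dots>
     = section_const * section_integral CARD('a) CARD('b) CARD('c) p q r"
    using dB unfolding B_def d_def M_def \<kappa>_def \<alpha>_def \<beta>_def \<gamma>_def
    by (rule section_measure)
  finally show ?thesis by (simp add: S_def u2_def)
qed

end

section \<open>Minimisers of the section volume\<close>

theorem proposition4:
  fixes \<alpha> \<beta> \<gamma> n :: nat
    and p q r :: real
    and a :: "real ^ ('a::finite + 'b::finite + 'c::finite)"
  assumes "\<alpha> \<ge> 1" and "\<beta> \<ge> 1" and "\<gamma> \<ge> 1"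
    and "CARD('a) = \<alpha>" and "CARD('b) = \<beta>" and "CARD('c) = \<gamma>"
    and "n = \<alpha> + \<beta> + \<gamma> - 1"
    and "a = block_vec p q r"
    and "block_constraints \<alpha> \<beta> \<gamma> p q r"
    and "\<And>b. b \<in> (block_family :: (real ^ ('a + 'b + 'c)) set) \<Longrightarrow>
           flat_volume (n - 1) (standard_simplex \<inter> hyperplane_perp a)
           \<le> flat_volume (n - 1) (standard_simplex \<inter> hyperplane_perp b)"
  shows "card (range (\<lambda>i. a $ i)) = 2 \<or> p = 0 \<or> q = 0 \<or> r = 0"
proof (rule ccontr)
  assume neg: "\<not> ?thesis"
  obtain BA BB BC :: "(real ^ ('a + 'b + 'c)) set" where bases: "block_bases BA BB BC"
    using zero_sum_basis_exists[OF block_nonempty(1)] zero_sum_basis_exists[OF block_nonempty(2)]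
      zero_sum_basis_exists[OF block_nonempty(3)] unfolding block_bases_def by metis
  interpret block_bases BA BB BC by (rule bases)
  have vol: "ennreal (flat_volume (n - 1) (standard_simplex \<inter> hyperplane_perp (block_vec p q r :: real ^ ('a + 'b + 'c))))
      = section_const * section_integral \<alpha> \<beta> \<gamma> p q r"
    if "block_constraints \<alpha> \<beta> \<gamma> p q r" for p q r
    using flat_volume_section[of p q r "n - 1"] that assms(1-7) by simp
  have rng: "range (\<lambda>i. a $ i) = {p, q, r}"
  proof -
    have "{p, q, r} \<subseteq> range (\<lambda>i. a $ i)"
      using block_nonempty block_vec_nth unfolding assms(8) by (metis (no_types) all_not_in_conv empty_subsetI insert_subset rangeI)
    moreover have "a $ i \<in> {p, q, r}" for i
      using block_cases[of i] by (auto simp: assms(8) block_vec_nth)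
    ultimately show ?thesis by blast
  qed
  \<comment> \<open>A single coincidence leaves exactly two distinct values, excluded by
    \<open>neg\<close>. If all three agree, the zero-sum condition gives p = 0, excluded as
    well.\<close>
  have ne: "p \<noteq> q \<and> q \<noteq> r \<and> p \<noteq> r"
  proof (rule ccontr)
    assume "\<not> ?thesis"
    then have "p = q \<and> q = r"
      using neg rng by (auto simp: card_insert_if split: if_splits)
    moreover have "(real \<alpha> + real \<beta> + real \<gamma>) * p = 0" if "p = q" "q = r"
      using assms(9) that by (simp add: block_constraints_def algebra_simps)
    ultimately show False using neg assms(1) by auto
  qed
  have "section_improvable \<alpha> \<beta> \<gamma> p q r"
    using section_improvable_generic[OF assms(1-3,9)] ne neg by blast
  then obtain p' q' r' where bc': "block_constraints \<alpha> \<beta> \<gamma> p' q' r'"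
    and less: "section_integral \<alpha> \<beta> \<gamma> p' q' r' < section_integral \<alpha> \<beta> \<gamma> p q r"
    unfolding section_improvable_def by blast
  have "block_vec p' q' r' \<in> (block_family :: (real ^ ('a + 'b + 'c)) set)"
    using bc' assms(4-6) by (auto simp: block_family_def)
  from assms(10)[OF this]
  have "section_const * section_integral \<alpha> \<beta> \<gamma> p q r \<le> section_const * section_integral \<alpha> \<beta> \<gamma> p' q' r'"
    unfolding vol[OF bc', symmetric] vol[OF assms(9), symmetric] assms(8) by (rule ennreal_leI)
  \<comment> \<open>Strictness survives the multiplication in \<open>ennreal\<close> because the
    constant is neither 0 nor infinite.\<close>
  moreover have "section_const * section_integral \<alpha> \<beta> \<gamma> p' q' r' < section_const * section_integral \<alpha> \<beta> \<gamma> p q r"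
    using less section_const_pos_finite by (intro ennreal_mult_strict_left_mono) auto
  ultimately show False by simp
qed

end
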